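(* Let $\mathcal A$ be a finitely generated, infinite dimensional, simple unital C$^*$-algebra with a unique tracial state $\tau$. Let $x_1,\ldots,x_n$ be a family of self-adjoint generators of $\mathcal A$. If $\mathcal A$ has approximation property, then $$\delta_{top}(x_1,\ldots,x_n)\ge1.$$
   Context: $\mathcal M_k^{s.a}(\mathbb C)$ is the set of self-adjoint $k\times k$ complex matrices; for a tuple, $\|(A_1,\ldots,A_n)\|=\max_i\|A_i\|$ (operator norms). Let $\{P_r\}_{r=1}^\infty$ be a fixed enumeration of all noncommutative polynomials in $\mathbb C\langle X_1,\ldots,X_n\rangle$ (constant terms allowed, evaluated as multiples of the identity) whose coefficients have rational real and imaginary parts. For $R,\epsilon>0$ and integers $r,k\ge1$, $\Gamma^{(top)}_R(x_1,\ldots,x_n;k,\epsilon,P_1,\ldots,P_r)$ is the set of $(A_1,\ldots,A_n)\in(\mathcal M_k^{s.a}(\mathbb C))^n$ with $\|A_i\|\le R$ for all $i$ and $|\|P_j(A_1,\ldots,A_n)\|-\|P_j(x_1,\ldots,x_n)\||\le\epsilon$ for $1\le j\le r$. $\nu_\infty(\Sigma,\omega)$ is the minimal number of open $\|\cdot\|$-balls of radius $\omega$ with centers in $\Sigma$ covering $\Sigma$. Then (with $\log 0=-\infty$, $0<\omega<1$) $$\delta_{top}(x_1,\ldots,x_n)=\limsup_{\omega\to0^+}\ \sup_{R>0}\ \inf_{\epsilon>0,\,r\in\mathbb N}\ \limsup_{k\to\infty}\frac{\log\nu_\infty(\Gamma^{(top)}_R(x_1,\ldots,x_n;k,\epsilon,P_1,\ldots,P_r),\omega)}{-k^2\log\omega}.$$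 Approximation property: for a unital C$^*$-algebra $\mathcal A$ generated as a C$^*$-algebra by self-adjoint elements $x_1,\ldots,x_n$, $\mathcal A$ is said to have approximation property if for all $R>\max\{\|x_1\|,\ldots,\|x_n\|\}$, $r\ge1$ and $\epsilon>0$ there is a sequence of positive integers $k_1<k_2<\cdots$ such that $\Gamma^{(top)}_R(x_1,\ldots,x_n;k_s,\epsilon,P_1,\ldots,P_r)\neq\varnothing$ for all $s\ge1$. *)

theory Defs
  imports
    Complex_Main
    "HOL-Library.Extended_Real"
    "HOL-Library.Extended_Nat"
    "HOL-Library.Liminf_Limsup"
    "HOL-Library.Poly_Mapping"
    "HOL-Library.Complex_Order"
    "Jordan_Normal_Form.Matrix"
    "Jordan_Normal_Form.Schur_Decomposition"
begin

section \<open>Unital C*-algebras\<close>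

text \<open>The norm axiom \<open>norm 1 = 1\<close> inherited from \<open>real_normed_algebra_1\<close> only excludes the zero algebra.\<close>

class unital_cstar_algebra = real_normed_algebra_1 + banach +
  fixes scaleC :: "complex \<Rightarrow> 'a \<Rightarrow> 'a"  (infixr "*\<^sub>C" 75)
    and cstar :: "'a \<Rightarrow> 'a"
  assumes scaleC_add_right: "c *\<^sub>C (a + b) = c *\<^sub>C a + c *\<^sub>C b"
    and scaleC_add_left: "(c + d) *\<^sub>C a = c *\<^sub>C a + d *\<^sub>C a"
    and scaleC_scaleC: "c *\<^sub>C d *\<^sub>C a = (c * d) *\<^sub>C a"
    and scaleC_of_real: "complex_of_real r *\<^sub>C a = r *\<^sub>R a"
    and scaleC_mult_left: "(c *\<^sub>C a) * b = c *\<^sub>C (a * b)"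
    and scaleC_mult_right: "a * (c *\<^sub>C b) = c *\<^sub>C (a * b)"
    and norm_scaleC: "norm (c *\<^sub>C a) = cmod c * norm a"
    and cstar_add: "cstar (a + b) = cstar a + cstar b"
    and cstar_scaleC: "cstar (c *\<^sub>C a) = cnj c *\<^sub>C cstar a"
    and cstar_mult: "cstar (a * b) = cstar b * cstar a"
    and cstar_cstar: "cstar (cstar a) = a"
    and norm_cstar_mult_self: "norm (cstar a * a) = (norm a)\<^sup>2"

global_interpretation complex_vector:
  vector_space "scaleC :: complex \<Rightarrow> 'a \<Rightarrow> 'a::unital_cstar_algebra"
proof
  show "1 *\<^sub>C a = a" for a :: 'a
    using scaleC_of_real[of 1 a] by simp
qed (simp_all add: scaleC_add_right scaleC_add_left scaleC_scaleC)

definition closed_star_subalgebra :: "'a::unital_cstar_algebra set \<Rightarrow> bool" where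
  "closed_star_subalgebra B \<longleftrightarrow>
     complex_vector.subspace B \<and> closed B \<and> 1 \<in> B \<and>
     (\<forall>a\<in>B. \<forall>b\<in>B. a * b \<in> B) \<and> (\<forall>a\<in>B. cstar a \<in> B)"

definition generates_cstar :: "'a::unital_cstar_algebra set \<Rightarrow> bool" where
  "generates_cstar S \<longleftrightarrow> (\<forall>B. closed_star_subalgebra B \<and> S \<subseteq> B \<longrightarrow> B = UNIV)"

definition closed_ideal :: "'a::unital_cstar_algebra set \<Rightarrow> bool" where
  "closed_ideal I \<longleftrightarrow>
     complex_vector.subspace I \<and> closed I \<and>
     (\<forall>a. \<forall>b\<in>I. a * b \<in> I \<and> b * a \<in> I)"

definition simple_cstar :: "'a::unital_cstar_algebra itself \<Rightarrow> bool" where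
  "simple_cstar _ \<longleftrightarrow> (\<forall>I :: 'a set. closed_ideal I \<longrightarrow> I = {0} \<or> I = UNIV)"

definition infinite_dimensional :: "'a::unital_cstar_algebra itself \<Rightarrow> bool" where
  "infinite_dimensional _ \<longleftrightarrow> \<not> (\<exists>B :: 'a set. finite B \<and> complex_vector.span B = UNIV)"

text \<open>In the third conjunct \<open>\<le>\<close> is the order of \<open>Complex_Order\<close>:
  \<open>0 \<le> z\<close> means that \<open>z\<close> is real and nonnegative.\<close>

definition tracial_state :: "('a::unital_cstar_algebra \<Rightarrow> complex) \<Rightarrow> bool" where
  "tracial_state \<tau> \<longleftrightarrow>
     (\<forall>a b. \<tau> (a + b) = \<tau> a + \<tau> b) \<and> (\<forall>c a. \<tau> (c *\<^sub>C a) = c * \<tau> a) \<and>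
     (\<forall>a. 0 \<le> \<tau> (cstar a * a)) \<and> \<tau> 1 = 1 \<and>
     (\<forall>a b. \<tau> (a * b) = \<tau> (b * a))"


section \<open>Noncommutative polynomials\<close>

text \<open>The variables are indexed by a finite type \<open>'n\<close>. A polynomial maps each word in the
  variables to its coefficient; the empty word carries the constant term.\<close>

type_synonym 'n ncpoly = "'n list \<Rightarrow>\<^sub>0 complex"

definition rational_ncpolys :: "'n ncpoly set" where
  "rational_ncpolys = {p. \<forall>w. Re (Poly_Mapping.lookup p w) \<in> \<rat> \<and> Im (Poly_Mapping.lookup p w) \<in> \<rat>}"

definition ncpoly_eval :: "'n ncpoly \<Rightarrow> ('n \<Rightarrow> 'a::unital_cstar_algebra) \<Rightarrow> 'a" where
  "ncpoly_eval p x = (\<Sum>w\<in>Poly_Mapping.keys p. Poly_Mapping.lookup p w *\<^sub>C prod_list (map x w))"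

definition mat_word :: "nat \<Rightarrow> ('n \<Rightarrow> complex mat) \<Rightarrow> 'n list \<Rightarrow> complex mat" where
  "mat_word k A w = foldr (\<lambda>i M. A i * M) w (1\<^sub>m k)"

definition ncpoly_eval_mat :: "nat \<Rightarrow> 'n ncpoly \<Rightarrow> ('n \<Rightarrow> complex mat) \<Rightarrow> complex mat" where
  "ncpoly_eval_mat k p A =
     mat k k (\<lambda>ij. \<Sum>w\<in>Poly_Mapping.keys p. Poly_Mapping.lookup p w * mat_word k A w $$ ij)"


section \<open>Matrix norms and covering numbers\<close>

definition l2_norm_vec :: "complex vec \<Rightarrow> real" where
  "l2_norm_vec v = sqrt (\<Sum>i<dim_vec v. (cmod (v $ i))\<^sup>2)"

definition opnorm :: "complex mat \<Rightarrow> real" where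
  "opnorm A = (SUP v\<in>{v \<in> carrier_vec (dim_col A). l2_norm_vec v \<le> 1}. l2_norm_vec (A *\<^sub>v v))"

definition tuple_opnorm :: "('n::finite \<Rightarrow> complex mat) \<Rightarrow> real" where
  "tuple_opnorm A = Max (range (\<lambda>i. opnorm (A i)))"

definition covers :: "('n::finite \<Rightarrow> complex mat) set \<Rightarrow> real \<Rightarrow> ('n \<Rightarrow> complex mat) set \<Rightarrow> bool" where
  "covers C \<omega> \<Sigma> \<longleftrightarrow> (\<forall>B\<in>\<Sigma>. \<exists>A\<in>C. tuple_opnorm (\<lambda>i. B i - A i) < \<omega>)"

definition covering_number :: "('n::finite \<Rightarrow> complex mat) set \<Rightarrow> real \<Rightarrow> enat" where
  "covering_number \<Sigma> \<omega> = (INF C\<in>{C. finite C \<and> C \<subseteq> \<Sigma> \<and> covers C \<omega> \<Sigma>}. enat (card C))"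

definition log_enat :: "enat \<Rightarrow> ereal" where
  "log_enat N = (case N of enat m \<Rightarrow> if m = 0 then - \<infinity> else ereal (ln (real m)) | \<infinity> \<Rightarrow> \<infinity>)"


section \<open>Topological free entropy dimension\<close>

text \<open>\<open>P\<close> is the enumeration of the rational polynomials, indexed from \<open>1\<close>.\<close>

definition Gamma_top ::
  "(nat \<Rightarrow> 'n ncpoly) \<Rightarrow> real \<Rightarrow> ('n::finite \<Rightarrow> 'a::unital_cstar_algebra) \<Rightarrow> nat \<Rightarrow> real \<Rightarrow> nat
    \<Rightarrow> ('n \<Rightarrow> complex mat) set" where
  "Gamma_top P R x k \<epsilon> r =
     {A. (\<forall>i. A i \<in> carrier_mat k k \<and> mat_adjoint (A i) = A i \<and> opnorm (A i) \<le> R) \<and>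
         (\<forall>j\<in>{1..r}. \<bar>opnorm (ncpoly_eval_mat k (P j) A) - norm (ncpoly_eval (P j) x)\<bar> \<le> \<epsilon>)}"

definition delta_top ::
  "(nat \<Rightarrow> 'n ncpoly) \<Rightarrow> ('n::finite \<Rightarrow> 'a::unital_cstar_algebra) \<Rightarrow> ereal" where
  "delta_top P x =
     Limsup (at_right (0::real)) (\<lambda>\<omega>.
       SUP R\<in>{0::real<..}. INF (\<epsilon>, r)\<in>{0::real<..} \<times> {1::nat..}.
         limsup (\<lambda>k. log_enat (covering_number (Gamma_top P R x k \<epsilon> r) \<omega>)
                       / ereal (- ((real k)\<^sup>2 * ln \<omega>))))"

definition approximation_property ::
  "(nat \<Rightarrow> 'n ncpoly) \<Rightarrow> ('n::finite \<Rightarrow> 'a::unital_cstar_algebra) \<Rightarrow> bool" where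
  "approximation_property P x \<longleftrightarrow>
     (\<forall>R > Max (range (\<lambda>i. norm (x i))). \<forall>r\<ge>1. \<forall>\<epsilon>>0.
        \<exists>k :: nat \<Rightarrow> nat. strict_mono k \<and> (\<forall>s. k s \<ge> 1 \<and> Gamma_top P R x (k s) \<epsilon> r \<noteq> {}))"

end

theory Submission
  imports "HOL-Complex_Analysis.Great_Picard" Defs
begin

text \<open>
  Conjugating a microstate by a unitary matrix gives a microstate again, so it suffices that the unitary
  orbit of one good microstate \<open>A\<close> of size \<open>k\<close> is large. All distances are measured in the Frobenius norm
  divided by \<open>sqrt k\<close>, which is at most the operator norm.

  The unitary group contains at least \<open>(c / s)\<close> to the power \<open>k\<^sup>2 (1 - small)\<close> elements at mutual distance of
  order \<open>s\<close> (\<open>many_separated_frames\<close>). If the microstates are covered by \<open>N\<close> balls of radius \<open>\<delta>\<close>, these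
  unitaries fall into \<open>N\<close> classes, and two unitaries \<open>U0\<close>, \<open>U\<close> of one class satisfy
  \<open>U0 A\<^sub>i U0\<^sup>* \<approx> U A\<^sub>i U\<^sup>*\<close>, that is, \<open>V = U0\<^sup>* U\<close> nearly commutes with every \<open>A\<^sub>i\<close>. Such \<open>V\<close> lie close to the
  span of the eigenvectors of \<open>V \<mapsto> \<Sum>\<^sub>i [A\<^sub>i, [A\<^sub>i, V]]\<close> with small eigenvalue (\<open>spectral_subspace\<close>). If that
  span has dimension at most \<open>\<gamma> k\<^sup>2\<close>, a class has at most \<open>(C / \<sigma>)\<close> to the power \<open>2 \<gamma> k\<^sup>2\<close> elements
  (\<open>fibre_card_le\<close>). As \<open>s\<close> and \<open>\<sigma>\<close> are fixed multiples of \<open>\<delta>\<close>, this gives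
  \<open>ln N \<ge> k\<^sup>2 ((1 - 4 \<gamma>) ln (1 / \<delta>) - K)\<close> with \<open>K\<close> independent of \<open>k\<close> and \<open>\<delta>\<close>; let \<open>\<delta>\<close> and then \<open>\<gamma>\<close> tend to \<open>0\<close>.

  The algebra enters only through the dimension bound (\<open>small_almost_commutant\<close>). Suppose that for ever
  better microstates there were more than \<open>\<gamma> k\<^sup>2\<close> Frobenius-orthonormal matrices \<open>V\<^sub>\<alpha>\<close> nearly commuting
  with \<open>A\<close>. Both the normalised trace and the average of \<open>X \<mapsto> \<langle>V\<^sub>\<alpha>, X V\<^sub>\<alpha>\<rangle>\<close> are then states that are
  asymptotically tracial on words in \<open>A\<close>, so both converge to the unique trace \<open>\<tau>\<close>
  (\<open>moments_converge_to_unique_trace\<close>). For polynomials \<open>a\<^sub>1, ..., a\<^sub>m\<close> the operator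
  \<open>Z V = \<Sum>\<^sub>j a\<^sub>j(A) V a\<^sub>j(A)\<^sup>*\<close> acts on the \<open>V\<^sub>\<alpha>\<close> almost like multiplication by \<open>\<Sum>\<^sub>j a\<^sub>j a\<^sub>j\<^sup>*\<close>, while its trace on
  their span is at most the square root of their number times the Hilbert-Schmidt norm of \<open>Z\<close>. In the limit
  \<open>\<gamma> |\<Sum>\<^sub>j \<tau>(a\<^sub>j a\<^sub>j\<^sup>*)|\<^sup>2 \<le> \<Sum>\<^sub>i\<^sub>j |\<tau>(a\<^sub>j\<^sup>* a\<^sub>i)|\<^sup>2\<close>, first for polynomials and then for all elements. A simple
  algebra has a faithful trace, so in infinite dimension there are \<open>m\<close> elements orthonormal for \<open>\<tau>\<close>, for any
  \<open>m\<close>; the inequality becomes \<open>\<gamma> m\<^sup>2 \<le> m\<close>, which fails for large \<open>m\<close>.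
\<close>

section \<open>Finite-dimensional complex inner products in coordinates\<close>

text \<open>The dimensions vary, so vectors are functions on a finite index set \<open>I\<close>, whose values outside
  \<open>I\<close> are irrelevant.\<close>

definition cip :: "'i set \<Rightarrow> ('i \<Rightarrow> complex) \<Rightarrow> ('i \<Rightarrow> complex) \<Rightarrow> complex" where
  "cip I f g = (\<Sum>i\<in>I. cnj (f i) * g i)"

definition cnrm :: "'i set \<Rightarrow> ('i \<Rightarrow> complex) \<Rightarrow> real" where
  "cnrm I f = L2_set (\<lambda>i. cmod (f i)) I"

lemma cnrm_nonneg [simp]: "0 \<le> cnrm I f"
  by (simp add: cnrm_def)

lemma cnrm_sq: "(cnrm I f)\<^sup>2 = (\<Sum>i\<in>I. (cmod (f i))\<^sup>2)"
  by (simp add: cnrm_def L2_set_def sum_nonneg)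

lemma cip_self: "cip I f f = of_real ((cnrm I f)\<^sup>2)"
  unfolding cip_def cnrm_sq of_real_sum
  by (rule sum.cong) (auto simp: complex_norm_square mult.commute simp del: of_real_power)

lemma cnrm_triangle: "cnrm I (\<lambda>i. f i + g i) \<le> cnrm I f + cnrm I g"
  unfolding cnrm_def
  by (rule order_trans[OF L2_set_mono L2_set_triangle_ineq]) (auto simp: norm_triangle_ineq)

lemma cnrm_scale: "cnrm I (\<lambda>i. c * f i) = cmod c * cnrm I f"
  unfolding cnrm_def by (simp add: norm_mult L2_set_right_distrib)

lemma cnrm_minus: "cnrm I (\<lambda>i. - f i) = cnrm I f"
  by (simp add: cnrm_def)

lemma cnrm_diff_commute: "cnrm I (\<lambda>i. f i - g i) = cnrm I (\<lambda>i. g i - f i)"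
  by (simp add: cnrm_def norm_minus_commute)

lemma cnrm_triangle_diff: "cnrm I (\<lambda>i. f i - h i) \<le> cnrm I (\<lambda>i. f i - g i) + cnrm I (\<lambda>i. g i - h i)"
  using cnrm_triangle[of I "\<lambda>i. f i - g i" "\<lambda>i. g i - h i"] by simp

lemma cnrm_diff_le: "cnrm I (\<lambda>i. f i - g i) \<le> cnrm I f + cnrm I g"
  using cnrm_triangle[of I f "\<lambda>i. - g i"] by (simp add: cnrm_minus)

lemma cnrm_zero [simp]: "cnrm I (\<lambda>i. 0) = 0"
  by (simp add: cnrm_def L2_set_def)

lemma cnrm_cong: "(\<And>i. i \<in> I \<Longrightarrow> f i = g i) \<Longrightarrow> cnrm I f = cnrm I g"
  unfolding cnrm_def by (rule L2_set_cong) auto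

lemma cip_cong: "(\<And>i. i \<in> I \<Longrightarrow> f i = f' i) \<Longrightarrow> (\<And>i. i \<in> I \<Longrightarrow> g i = g' i) \<Longrightarrow> cip I f g = cip I f' g'"
  unfolding cip_def by (rule sum.cong) auto

lemma cmod_le_cnrm: "finite I \<Longrightarrow> i \<in> I \<Longrightarrow> cmod (f i) \<le> cnrm I f"
  unfolding cnrm_def by (rule member_le_L2_set)

lemma cnrm_le_sum: "cnrm I f \<le> (\<Sum>i\<in>I. cmod (f i))"
  unfolding cnrm_def by (rule L2_set_le_sum) auto

lemma cip_CS: "cmod (cip I f g) \<le> cnrm I f * cnrm I g"
proof -
  have "cmod (cip I f g) \<le> (\<Sum>i\<in>I. cmod (cnj (f i) * g i))"
    unfolding cip_def by (rule norm_sum)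
  also have "\<dots> = (\<Sum>i\<in>I. \<bar>cmod (f i)\<bar> * \<bar>cmod (g i)\<bar>)" by (simp add: norm_mult)
  also have "\<dots> \<le> cnrm I f * cnrm I g" unfolding cnrm_def by (rule L2_set_mult_ineq)
  finally show ?thesis .
qed

lemma cip_cnj: "cip I g f = cnj (cip I f g)"
  by (simp add: cip_def cnj_sum mult.commute)
lemma cip_add_right: "cip I f (\<lambda>i. g i + h i) = cip I f g + cip I f h"
  by (simp add: cip_def algebra_simps sum.distrib)
lemma cip_diff_right: "cip I f (\<lambda>i. g i - h i) = cip I f g - cip I f h"
  by (simp add: cip_def algebra_simps sum_subtractf)
lemma cip_diff_left: "cip I (\<lambda>i. g i - h i) f = cip I g f - cip I h f"
  by (simp add: cip_def algebra_simps sum_subtractf)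
lemma cip_add_left: "cip I (\<lambda>i. g i + h i) f = cip I g f + cip I h f"
  by (simp add: cip_def algebra_simps sum.distrib)
lemma cip_scale_right: "cip I f (\<lambda>i. c * g i) = c * cip I f g"
  by (simp add: cip_def sum_distrib_left algebra_simps)
lemma cip_scale_left: "cip I (\<lambda>i. c * f i) g = cnj c * cip I f g"
  by (simp add: cip_def sum_distrib_left algebra_simps)
lemma cip_sum_right: "cip I f (\<lambda>i. \<Sum>a\<in>S. g a i) = (\<Sum>a\<in>S. cip I f (g a))"
  unfolding cip_def by (subst sum.swap) (simp add: sum_distrib_left)
lemma cip_sum_left: "cip I (\<lambda>i. \<Sum>a\<in>S. g a i) f = (\<Sum>a\<in>S. cip I (g a) f)"
  unfolding cip_def by (subst sum.swap) (simp add: sum_distrib_right)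

lemma cnrm_add_sq: "(cnrm I (\<lambda>i. f i + g i))\<^sup>2 = (cnrm I f)\<^sup>2 + (cnrm I g)\<^sup>2 + 2 * Re (cip I f g)"
proof -
  have "of_real ((cnrm I (\<lambda>i. f i + g i))\<^sup>2) = cip I f f + cip I g g + (cip I f g + cip I g f)"
    unfolding cip_self[symmetric] by (simp add: cip_add_left cip_add_right)
  then have "(cnrm I (\<lambda>i. f i + g i))\<^sup>2 = Re (cip I f f + cip I g g + (cip I f g + cip I g f))"
    by (metis Re_complex_of_real)
  then show ?thesis by (simp add: cip_self cip_cnj[of I g f])
qed

definition ons :: "'i set \<Rightarrow> ('a \<Rightarrow> 'i \<Rightarrow> complex) \<Rightarrow> 'a set \<Rightarrow> bool" where
  "ons I e S \<longleftrightarrow> (\<forall>a\<in>S. \<forall>b\<in>S. cip I (e a) (e b) = (if a = b then 1 else 0))"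

lemma ons_norm_one: "ons I e S \<Longrightarrow> a \<in> S \<Longrightarrow> cnrm I (e a) = 1"
proof -
  assume "ons I e S" "a \<in> S"
  then have "cip I (e a) (e a) = 1" by (simp add: ons_def)
  then have "(cnrm I (e a))\<^sup>2 = 1" unfolding cip_self using of_real_eq_1_iff by blast
  then show ?thesis using cnrm_nonneg[of I "e a"] by (simp add: power2_eq_1_iff)
qed

lemma cnrm_ons_comb:
  assumes "finite S" "ons I e S"
  shows "(cnrm I (\<lambda>i. \<Sum>a\<in>S. c a * e a i))\<^sup>2 = (\<Sum>a\<in>S. (cmod (c a))\<^sup>2)"
proof -
  have "of_real ((cnrm I (\<lambda>i. \<Sum>a\<in>S. c a * e a i))\<^sup>2) = (\<Sum>b\<in>S. \<Sum>a\<in>S. c a * (cnj (c b) * cip I (e b) (e a)))"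
    unfolding cip_self[symmetric] cip_sum_left cip_sum_right by (simp add: cip_scale_left cip_scale_right mult_ac)
  also have "\<dots> = (\<Sum>b\<in>S. \<Sum>a\<in>S. if b = a then c a * cnj (c b) else 0)"
    using assms(2) by (intro sum.cong refl) (auto simp: ons_def)
  also have "\<dots> = (\<Sum>b\<in>S. c b * cnj (c b))" using assms(1) by simp
  also have "\<dots> = of_real (\<Sum>a\<in>S. (cmod (c a))\<^sup>2)" by (simp add: complex_norm_square del: of_real_power)
  finally show ?thesis using of_real_eq_iff by blast
qed

definition cproj :: "'i set \<Rightarrow> ('a \<Rightarrow> 'i \<Rightarrow> complex) \<Rightarrow> 'a set \<Rightarrow> ('i \<Rightarrow> complex) \<Rightarrow> 'i \<Rightarrow> complex" where
  "cproj I e S v = (\<lambda>i. \<Sum>a\<in>S. cip I (e a) v * e a i)"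

lemma cip_ons_residual:
  assumes "finite S" "ons I e S" "b \<in> S"
  shows "cip I (e b) (\<lambda>i. v i - cproj I e S v i) = 0"
proof -
  have "cip I (e b) (cproj I e S v) = (\<Sum>a\<in>S. cip I (e a) v * cip I (e b) (e a))"
    unfolding cproj_def cip_sum_right by (simp add: cip_scale_right)
  also have "\<dots> = (\<Sum>a\<in>S. if b = a then cip I (e a) v else 0)"
    using assms by (intro sum.cong refl) (auto simp: ons_def)
  also have "\<dots> = cip I (e b) v" using assms by simp
  finally show ?thesis by (simp add: cip_diff_right)
qed

lemma cnrm_pythagoras:
  assumes "finite S" "ons I e S"
  shows "(cnrm I v)\<^sup>2 = (\<Sum>a\<in>S. (cmod (cip I (e a) v))\<^sup>2) + (cnrm I (\<lambda>i. v i - cproj I e S v i))\<^sup>2"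
proof -
  let ?p = "cproj I e S v"
  have "cip I ?p (\<lambda>i. v i - ?p i) = (\<Sum>a\<in>S. cnj (cip I (e a) v) * cip I (e a) (\<lambda>i. v i - ?p i))"
    unfolding cproj_def[of I e S v] cip_sum_left by (simp add: cip_scale_left)
  also have "\<dots> = 0" using assms by (simp add: cip_ons_residual)
  finally have "cip I ?p (\<lambda>i. v i - ?p i) = 0" .
  then have "(cnrm I (\<lambda>i. ?p i + (v i - ?p i)))\<^sup>2 = (cnrm I ?p)\<^sup>2 + (cnrm I (\<lambda>i. v i - ?p i))\<^sup>2"
    using cnrm_add_sq[of I ?p "\<lambda>i. v i - ?p i"] by simp
  then show ?thesis using cnrm_ons_comb[OF assms, of "\<lambda>a. cip I (e a) v"] by (simp add: cproj_def)
qed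

lemma bessel: "finite S \<Longrightarrow> ons I e S \<Longrightarrow> (\<Sum>a\<in>S. (cmod (cip I (e a) v))\<^sup>2) \<le> (cnrm I v)\<^sup>2"
  using cnrm_pythagoras[of S I e v] by simp

section \<open>Separated sets and coverings of the unit ball\<close>

definition separated :: "'i set \<Rightarrow> real \<Rightarrow> ('i \<Rightarrow> complex) set \<Rightarrow> bool" where
  "separated I s X \<longleftrightarrow> (\<forall>x\<in>X. \<forall>y\<in>X. x \<noteq> y \<longrightarrow> s \<le> cnrm I (\<lambda>i. x i - y i))"

text \<open>This removes constants: a bound for all powers with a constant depending on the dimension becomes a bound
  without it.\<close>

lemma le_of_power_le:
  fixes a b C :: real
  assumes "0 \<le> a" "0 < b" and pow: "\<And>n. a ^ n \<le> C * b ^ n"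
  shows "a \<le> b"
proof (rule ccontr)
  assume "\<not> a \<le> b"
  then have "1 < a / b" using assms by simp
  then obtain n where "C < (a / b) ^ n" using real_arch_pow by blast
  moreover have "(a / b) ^ n \<le> C"
    using pow[of n] \<open>0 < b\<close> by (simp add: power_divide divide_le_eq)
  ultimately show False by simp
qed

lemma floor_eq_imp_diff_less:
  fixes a b h :: real assumes "0 < h" "\<lfloor>a / h\<rfloor> = \<lfloor>b / h\<rfloor>" shows "\<bar>a - b\<bar> < h"
proof -
  have "\<bar>a / h - b / h\<bar> < 1" using assms(2) by linarith
  then have "\<bar>(a - b) / h\<bar> < 1" by (simp add: diff_divide_distrib)
  then show ?thesis using assms(1) by (simp add: abs_divide)
qed

text \<open>Points in one cell of a fine cubic grid are closer than \<open>\<delta>\<close>, and a ball meets finitely many cells. The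
  constant depends on the dimension, which \<open>separated_card_le\<close> repairs.\<close>

lemma separated_card_crude:
  assumes "finite I" "0 < \<delta>" "\<delta> \<le> 1" and ball: "\<And>y. y \<in> Y \<Longrightarrow> cnrm I y \<le> 2" and sep: "separated I \<delta> Y"
  shows "finite Y \<and> real (card Y) \<le> (36 * (real (card I) + 1) / \<delta>) ^ (2 * card I)"
proof -
  define d where "d = real (card I)"
  define h where "h = \<delta> / (4 * (d + 1))"
  have d: "d \<ge> 0" by (simp add: d_def)
  have "0 < \<delta> * (4 + 2 * d)" using assms d by simp
  then have h: "0 < h" "h \<le> 1" "2 * h * d < \<delta>"
    using assms d by (auto simp: h_def field_simps)
  define K where "K = \<lceil>2 / h\<rceil> + 1"
  define B where "B = {-K..K}"
  define \<phi> where "\<phi> y = restrict (\<lambda>i. (\<lfloor>Re (y i) / h\<rfloor>, \<lfloor>Im (y i) / h\<rfloor>)) I" for y :: "'a \<Rightarrow> complex"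
  have inB: "\<lfloor>r / h\<rfloor> \<in> B" if "\<bar>r\<bar> \<le> 2" for r
  proof -
    have "\<bar>r / h\<bar> \<le> 2 / h" using that h by (simp add: abs_divide divide_right_mono)
    moreover have "2 / h \<le> real_of_int \<lceil>2 / h\<rceil>" by (rule le_of_int_ceiling)
    ultimately have "\<lfloor>r / h\<rfloor> \<le> \<lceil>2 / h\<rceil>" "- \<lceil>2 / h\<rceil> - 1 \<le> \<lfloor>r / h\<rfloor>"
      unfolding floor_le_iff le_floor_iff by (simp_all add: abs_le_iff del: abs_divide) linarith+
    then show ?thesis unfolding B_def K_def by simp
  qed
  have sub: "\<phi> ` Y \<subseteq> PiE I (\<lambda>_. B \<times> B)"
  proof
    fix p assume "p \<in> \<phi> ` Y"
    then obtain y where y: "y \<in> Y" "p = \<phi> y" by blast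
    have "(\<lfloor>Re (y i) / h\<rfloor>, \<lfloor>Im (y i) / h\<rfloor>) \<in> B \<times> B" if "i \<in> I" for i
    proof -
      have "cmod (y i) \<le> 2" using cmod_le_cnrm[OF assms(1) that, of y] ball[OF y(1)] by simp
      then show ?thesis using inB abs_Re_le_cmod[of "y i"] abs_Im_le_cmod[of "y i"] by simp
    qed
    then show "p \<in> PiE I (\<lambda>_. B \<times> B)" by (auto simp: y(2) \<phi>_def)
  qed
  have inj: "inj_on \<phi> Y"
  proof (rule inj_onI, rule ccontr)
    fix x y assume xy: "x \<in> Y" "y \<in> Y" "\<phi> x = \<phi> y" "x \<noteq> y"
    have "cmod (x i - y i) \<le> 2 * h" if "i \<in> I" for i
    proof -
      have "\<phi> x i = \<phi> y i" using xy by simp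
      then have "\<bar>Re (x i) - Re (y i)\<bar> < h" "\<bar>Im (x i) - Im (y i)\<bar> < h"
        using that h by (auto simp: \<phi>_def intro: floor_eq_imp_diff_less)
      then show ?thesis using cmod_le[of "x i - y i"] by simp
    qed
    then have "cnrm I (\<lambda>i. x i - y i) \<le> (\<Sum>i\<in>I. 2 * h)"
      by (intro order_trans[OF cnrm_le_sum] sum_mono)
    also have "\<dots> = 2 * h * d" by (simp add: d_def)
    finally show False using sep xy h by (force simp: separated_def)
  qed
  have fin: "finite (PiE I (\<lambda>_. B \<times> B))" using assms(1) by (intro finite_PiE) (auto simp: B_def)
  have finY: "finite Y" using finite_imageD[OF finite_subset[OF sub fin] inj] .
  have "card Y \<le> card (PiE I (\<lambda>_. B \<times> B))" using card_inj_on_le[OF inj sub fin] .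
  moreover have "card (PiE I (\<lambda>_. B \<times> B)) = card B ^ (2 * card I)"
    using assms(1) by (simp add: card_PiE card_cartesian_product power_mult power2_eq_square)
  moreover have "real (card B) \<le> 36 * (d + 1) / \<delta>"
  proof -
    have "0 \<le> 2 / h" using h by simp
    then have "K \<ge> 0" unfolding K_def by linarith
    then have "real (card B) = 2 * real_of_int K + 1" by (simp add: B_def)
    also have "\<dots> \<le> 2 * (2 / h) + 5" unfolding K_def using of_int_ceiling_le_add_one[of "2/h"]
      by (simp only: of_int_add of_int_1 distrib_left)
    also have "\<dots> \<le> 9 / h" using h by (simp add: field_simps)
    also have "\<dots> = 36 * (d + 1) / \<delta>" by (simp add: h_def)
    finally show ?thesis .
  qed
  ultimately have "real (card Y) \<le> real (card B) ^ (2 * card I)" by (metis of_nat_le_iff of_nat_power)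
  also have "\<dots> \<le> (36 * (d + 1) / \<delta>) ^ (2 * card I)"
    by (rule power_mono) (use \<open>real (card B) \<le> _\<close> in auto)
  finally show ?thesis using finY by (simp add: d_def)
qed

text \<open>From \<open>M\<close> separated points one gets \<open>M ^ t\<close> points \<open>x\<^sub>0 + r x\<^sub>1 + r\<^sup>2 x\<^sub>2 + ...\<close> with \<open>r = s / 4\<close>: two of them that
  first differ in the \<open>j\<close>-th digit are at distance at least \<open>r ^ j * (s - r * 8 / 3) = r ^ j * s / 3\<close>, since the
  tails have norm at most \<open>4 / 3\<close>.\<close>

lemma separated_powers:
  fixes X :: "('i \<Rightarrow> complex) set"
  assumes "0 < s" "s \<le> 1" and ball: "\<And>x. x \<in> X \<Longrightarrow> cnrm I x \<le> 1" and sep: "separated I s X" and "finite X"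
  shows "\<exists>Y. finite Y \<and> card Y = card X ^ t \<and> (\<forall>y\<in>Y. cnrm I y \<le> 4/3) \<and> separated I (s / 3 * (s / 4) ^ t) Y"
proof (induction t)
  case 0
  show ?case by (rule exI[of _ "{\<lambda>_. 0}"]) (auto simp: separated_def)
next
  case (Suc t)
  then obtain Y where Y: "finite Y" "card Y = card X ^ t" "\<And>y. y \<in> Y \<Longrightarrow> cnrm I y \<le> 4/3"
    "separated I (s / 3 * (s / 4) ^ t) Y" by blast
  define r where "r = s / 4"
  have r: "0 < r" "r \<le> 1/4" using assms by (auto simp: r_def)
  define F where "F = (\<lambda>(x, y) (i::'i). x i + of_real r * y i :: complex)"
  have scl: "cnrm I (\<lambda>i. of_real r * f i) = r * cnrm I f" for f
    using r by (simp add: cnrm_scale)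
  have dist: "s / 3 * (s / 4) ^ Suc t \<le> cnrm I (\<lambda>i. F p i - F q i)"
    if "p \<in> X \<times> Y" "q \<in> X \<times> Y" "p \<noteq> q" for p q
  proof -
    obtain x y x' y' where pq: "p = (x, y)" "q = (x', y')" by fastforce
    show ?thesis
    proof (cases "x = x'")
      case True
      then have "s / 3 * (s / 4) ^ t \<le> cnrm I (\<lambda>i. y i - y' i)"
        using that Y(4) by (auto simp: separated_def pq)
      then have "r * (s / 3 * (s / 4) ^ t) \<le> r * cnrm I (\<lambda>i. y i - y' i)" using r by simp
      also have "\<dots> = cnrm I (\<lambda>i. F p i - F q i)"
        unfolding scl[symmetric] using True by (simp add: F_def pq algebra_simps)
      finally show ?thesis by (simp add: r_def mult_ac)
    next
      case False
      then have "s \<le> cnrm I (\<lambda>i. x i - x' i)" using that sep by (auto simp: separated_def pq)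
      also have "\<dots> = cnrm I (\<lambda>i. (F p i - F q i) - of_real r * (y i - y' i))"
        by (simp add: F_def pq algebra_simps)
      also have "\<dots> \<le> cnrm I (\<lambda>i. F p i - F q i) + r * cnrm I (\<lambda>i. y i - y' i)"
        by (rule order_trans[OF cnrm_diff_le]) (simp only: scl order_refl)
      also have "r * cnrm I (\<lambda>i. y i - y' i) \<le> r * (8/3)"
      proof -
        have "cnrm I (\<lambda>i. y i - y' i) \<le> 4/3 + 4/3"
          using cnrm_diff_le[of I y y'] Y(3)[of y] Y(3)[of y'] that by (auto simp: pq)
        then show ?thesis using r by simp
      qed
      finally have "s / 3 \<le> cnrm I (\<lambda>i. F p i - F q i)" by (simp add: r_def)
      moreover have "s / 3 * (s / 4) ^ Suc t \<le> s / 3 * 1"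
        using assms by (intro mult_left_mono power_le_one) auto
      ultimately show ?thesis by simp
    qed
  qed
  have pos: "0 < s / 3 * (s / 4) ^ Suc t" using assms by simp
  have inj: "inj_on F (X \<times> Y)"
  proof (rule inj_onI, rule ccontr)
    fix p q assume "p \<in> X \<times> Y" "q \<in> X \<times> Y" "F p = F q" "p \<noteq> q"
    with dist[of p q] pos show False by simp
  qed
  show ?case
  proof (intro exI[of _ "F ` (X \<times> Y)"] conjI ballI)
    show "finite (F ` (X \<times> Y))" using assms Y by simp
    show "card (F ` (X \<times> Y)) = card X ^ Suc t"
      using Y by (simp add: card_image[OF inj] card_cartesian_product)
    show "separated I (s / 3 * (s / 4) ^ Suc t) (F ` (X \<times> Y))"
      unfolding separated_def using dist by blast
    fix z assume "z \<in> F ` (X \<times> Y)"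
    then obtain x y where z: "x \<in> X" "y \<in> Y" "z = F (x, y)" by auto
    have "cnrm I z \<le> cnrm I x + r * cnrm I y"
      unfolding z F_def scl[symmetric] by simp (rule cnrm_triangle)
    also have "\<dots> \<le> 1 + 1/4 * (4/3)" using ball[OF z(1)] Y(3)[OF z(2)] r by (intro add_mono mult_mono) auto
    finally show "cnrm I z \<le> 4/3" by simp
  qed
qed

text \<open>The crude bound for the \<open>t\<close>-digit expansions, on letting \<open>t\<close> tend to infinity. This gives the volume bound
  without a measure.\<close>

lemma separated_card_le:
  assumes "finite I" "0 < s" "s \<le> 1" and ball: "\<And>x. x \<in> X \<Longrightarrow> cnrm I x \<le> 1" and sep: "separated I s X"
  shows "finite X \<and> real (card X) \<le> (4 / s) ^ (2 * card I)"
proof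
  have "\<And>x. x \<in> X \<Longrightarrow> cnrm I x \<le> 2" using ball by force
  then show fin: "finite X" using separated_card_crude[OF assms(1-3) _ sep] by blast
  define c where "c = 108 * (real (card I) + 1) / s"
  show "real (card X) \<le> (4 / s) ^ (2 * card I)"
  proof (rule le_of_power_le[of _ _ "c ^ (2 * card I)"])
    fix t
    obtain Y where Y: "finite Y" "card Y = card X ^ t" "\<forall>y\<in>Y. cnrm I y \<le> 4/3"
      "separated I (s / 3 * (s / 4) ^ t) Y" using separated_powers[OF assms(2,3) _ sep fin, of t] ball by blast
    have "s / 3 * (s / 4) ^ t \<le> 1 * 1" using assms by (intro mult_mono power_le_one) auto
    then have "real (card Y) \<le> (36 * (real (card I) + 1) / (s / 3 * (s / 4) ^ t)) ^ (2 * card I)"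
    proof (intro separated_card_crude[THEN conjunct2] assms(1) Y(4))
      show "cnrm I y \<le> 2" if "y \<in> Y" for y using Y(3) that by force
    qed (use assms(2) in auto)
    also have "36 * (real (card I) + 1) / (s / 3 * (s / 4) ^ t) = c * (4 / s) ^ t"
      using assms by (simp add: c_def power_divide field_simps)
    also have "(c * (4 / s) ^ t) ^ (2 * card I) = c ^ (2 * card I) * ((4 / s) ^ (2 * card I)) ^ t"
      by (simp only: power_mult_distrib power_mult[symmetric] mult.commute)
    finally show "real (card X) ^ t \<le> c ^ (2 * card I) * ((4 / s) ^ (2 * card I)) ^ t"
      using Y by simp
  qed (use assms(2) in auto)
qed

text \<open>The points of a cubic grid of mesh \<open>3 * t\<close> in the unit ball need distinct centres.\<close>

lemma cover_card_crude:
  assumes "finite I" "finite F" "0 < t" and cov: "\<And>v. cnrm I v \<le> 1 \<Longrightarrow> \<exists>c\<in>F. cnrm I (\<lambda>i. v i - c i) \<le> t"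
  shows "(1 / (12 * (real (card I) + 1)) / t) ^ (2 * card I) \<le> real (card F)"
proof -
  define d where "d = real (card I)"
  have d: "d \<ge> 0" by (simp add: d_def)
  define q where "q = 1 / (12 * (d + 1)) / t"
  have q0: "0 < q" using d assms by (simp add: q_def)
  have "F \<noteq> {}" using cov[of "\<lambda>_. 0"] by auto
  then have F1: "1 \<le> card F" using assms by (simp add: Suc_leI card_gt_0_iff)
  show ?thesis
  proof (cases "q \<le> 1")
    case True
    then have "q ^ (2 * card I) \<le> 1" using q0 by (intro power_le_one) auto
    then show ?thesis using F1 by (simp add: q_def d_def)
  next
    case False
    define J where "J = nat \<lfloor>2 * q\<rfloor>"
    define h where "h = 3 * t"
    have Jq: "q \<le> real J" "real J \<le> 2 * q" using False unfolding J_def by linarith+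
    define f where "f p i = of_real h * Complex (real (fst (p i))) (real (snd (p i)))" for p :: "'a \<Rightarrow> nat \<times> nat" and i
    define G where "G = PiE I (\<lambda>_. {..<J} \<times> {..<J})"
    have "cnrm I (f p) \<le> 1" if "p \<in> G" for p
    proof -
      have "cmod (f p i) \<le> h * (2 * J)" if "i \<in> I" for i
      proof -
        have "p i \<in> {..<J} \<times> {..<J}" using \<open>p \<in> G\<close> that by (auto simp: G_def PiE_def)
        then have "fst (p i) \<le> J" "snd (p i) \<le> J" by (auto simp: mem_Times_iff)
        then have "cmod (Complex (real (fst (p i))) (real (snd (p i)))) \<le> 2 * J"
          using cmod_le[of "Complex (real (fst (p i))) (real (snd (p i)))"] by simp
        then show ?thesis using assms(3) by (simp add: f_def norm_mult h_def)
      qed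
      then have "cnrm I (f p) \<le> (\<Sum>i\<in>I. h * (2 * J))" by (intro order_trans[OF cnrm_le_sum] sum_mono)
      also have "\<dots> = d * (h * (2 * J))" by (simp add: d_def)
      also have "\<dots> \<le> d * (h * (2 * (2 * q)))" using Jq d assms by (intro mult_left_mono) (auto simp: h_def)
      also have "h * (2 * (2 * q)) = 1 / (d + 1)" using assms d by (simp add: h_def q_def divide_simps)
      also have "d * (1 / (d + 1)) \<le> 1" using d by simp
      finally show ?thesis .
    qed
    then have "\<forall>p\<in>G. \<exists>c\<in>F. cnrm I (\<lambda>i. f p i - c i) \<le> t" using cov by blast
    then obtain c where c: "\<And>p. p \<in> G \<Longrightarrow> c p \<in> F \<and> cnrm I (\<lambda>i. f p i - c p i) \<le> t" by metis
    have "inj_on c G"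
    proof (rule inj_onI, rule ccontr)
      fix p p' assume pp: "p \<in> G" "p' \<in> G" "c p = c p'" "p \<noteq> p'"
      then obtain i where i: "i \<in> I" "p i \<noteq> p' i" unfolding G_def by (meson PiE_ext)
      have "cnrm I (\<lambda>i. f p i - f p' i) \<le> t + t"
        using cnrm_triangle_diff[of I "f p" "f p'" "c p"] c[OF pp(1)] c[OF pp(2)] pp(3)
          cnrm_diff_commute[of I "f p'" "c p'"] by simp
      moreover have "h \<le> cmod (f p i - f p' i)"
      proof -
        let ?z = "Complex (real (fst (p i))) (real (snd (p i))) - Complex (real (fst (p' i))) (real (snd (p' i)))"
        have "1 \<le> \<bar>Re ?z\<bar> \<or> 1 \<le> \<bar>Im ?z\<bar>" using i(2) by (auto simp: prod_eq_iff)
        then have "1 \<le> cmod ?z" using abs_Re_le_cmod[of ?z] abs_Im_le_cmod[of ?z] by linarith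
        moreover have "f p i - f p' i = of_real h * ?z" by (simp add: f_def algebra_simps)
        ultimately show ?thesis using assms by (simp add: norm_mult h_def del: minus_complex.sel)
      qed
      ultimately show False using cmod_le_cnrm[OF assms(1) i(1), of "\<lambda>i. f p i - f p' i"] assms(3)
        by (simp add: h_def)
    qed
    then have "card G \<le> card F" using c assms(2) by (intro card_inj_on_le) auto
    moreover have "card G = J ^ (2 * card I)"
      using assms(1) by (simp add: G_def card_PiE card_cartesian_product power_mult power2_eq_square)
    ultimately have "real J ^ (2 * card I) \<le> real (card F)" by (metis of_nat_le_iff of_nat_power)
    moreover have "q ^ (2 * card I) \<le> real J ^ (2 * card I)" using Jq q0 by (intro power_mono) auto
    ultimately have "q ^ (2 * card I) \<le> real (card F)" by linarith
    then show ?thesis by (simp add: q_def d_def)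
  qed
qed

text \<open>A ball of radius \<open>t\<close> is a scaled copy of the unit ball, so the covering can be iterated.\<close>

lemma cover_powers:
  fixes F :: "('i \<Rightarrow> complex) set"
  assumes "finite F" "0 < t" and cov: "\<And>v. cnrm I v \<le> 1 \<Longrightarrow> \<exists>c\<in>F. cnrm I (\<lambda>i. v i - c i) \<le> t"
  shows "\<exists>G. finite G \<and> card G \<le> card F ^ n \<and> (\<forall>v. cnrm I v \<le> 1 \<longrightarrow> (\<exists>c\<in>G. cnrm I (\<lambda>i. v i - c i) \<le> t ^ n))"
proof (induction n)
  case 0
  show ?case by (rule exI[of _ "{\<lambda>_. 0}"]) auto
next
  case (Suc n)
  then obtain G where G: "finite G" "card G \<le> card F ^ n"
    "\<And>v. cnrm I v \<le> 1 \<Longrightarrow> \<exists>c\<in>G. cnrm I (\<lambda>i. v i - c i) \<le> t ^ n" by blast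
  define \<phi> where "\<phi> = (\<lambda>(c, g) (i::'i). c i + of_real t * g i :: complex)"
  show ?case
  proof (intro exI[of _ "\<phi> ` (F \<times> G)"] conjI allI impI)
    show "finite (\<phi> ` (F \<times> G))" using assms G by simp
    have "card (\<phi> ` (F \<times> G)) \<le> card F * card G"
      using card_image_le[of "F \<times> G" \<phi>] assms G by (simp add: card_cartesian_product)
    also have "\<dots> \<le> card F ^ Suc n" using G by simp
    finally show "card (\<phi> ` (F \<times> G)) \<le> card F ^ Suc n" .
    fix v assume "cnrm I v \<le> 1"
    then obtain c where c: "c \<in> F" "cnrm I (\<lambda>i. v i - c i) \<le> t" using cov by blast
    define w where "w i = of_real (1 / t) * (v i - c i)" for i
    have "cnrm I w \<le> 1" unfolding w_def cnrm_scale using c assms by (simp add: norm_divide divide_le_eq)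
    then obtain g where g: "g \<in> G" "cnrm I (\<lambda>i. w i - g i) \<le> t ^ n" using G by blast
    have "(\<lambda>i. v i - \<phi> (c, g) i) = (\<lambda>i. of_real t * (w i - g i))"
      using assms by (auto simp: \<phi>_def w_def algebra_simps)
    then have "cnrm I (\<lambda>i. v i - \<phi> (c, g) i) = t * cnrm I (\<lambda>i. w i - g i)"
      using assms by (simp add: cnrm_scale)
    also have "\<dots> \<le> t ^ Suc n" using g assms by simp
    finally show "\<exists>c\<in>\<phi> ` (F \<times> G). cnrm I (\<lambda>i. v i - c i) \<le> t ^ Suc n" using c g by blast
  qed
qed

lemma cover_card_ge:
  assumes "finite I" "finite F" "0 < t" and cov: "\<And>v. cnrm I v \<le> 1 \<Longrightarrow> \<exists>c\<in>F. cnrm I (\<lambda>i. v i - c i) \<le> t"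
  shows "(1 / t) ^ (2 * card I) \<le> real (card F)"
proof -
  define q where "q = 12 * (real (card I) + 1)"
  have q: "q > 0" by (simp add: q_def)
  have "F \<noteq> {}" using cov[of "\<lambda>_. 0"] by auto
  then have F1: "0 < card F" using assms by (simp add: card_gt_0_iff)
  show ?thesis
  proof (rule le_of_power_le[of _ _ "q ^ (2 * card I)"])
    fix n
    obtain G where G: "finite G" "card G \<le> card F ^ n"
      "\<And>v. cnrm I v \<le> 1 \<Longrightarrow> \<exists>c\<in>G. cnrm I (\<lambda>i. v i - c i) \<le> t ^ n" using cover_powers[OF assms(2-4)] by blast
    have "(1 / q / t ^ n) ^ (2 * card I) \<le> real (card G)"
      unfolding q_def using G assms by (intro cover_card_crude) auto
    also have "\<dots> \<le> real (card F) ^ n" using G(2) by (metis of_nat_le_iff of_nat_power)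
    also have "1 / q / t ^ n = (1 / q) * (1 / t) ^ n" by (simp add: power_divide)
    finally have "(1 / q) ^ (2 * card I) * ((1 / t) ^ (2 * card I)) ^ n \<le> real (card F) ^ n"
      by (simp only: power_mult_distrib power_mult[symmetric] mult.commute)
    then have "q ^ (2 * card I) * ((1 / q) ^ (2 * card I) * ((1 / t) ^ (2 * card I)) ^ n) \<le> q ^ (2 * card I) * real (card F) ^ n"
      using q by (intro mult_left_mono) auto
    then show "((1 / t) ^ (2 * card I)) ^ n \<le> q ^ (2 * card I) * real (card F) ^ n"
      using q by (simp add: power_divide)
  qed (use F1 assms(3) in auto)
qed

lemma ex_maximal_pairwise_far:
  fixes far :: "'a \<Rightarrow> 'a \<Rightarrow> bool"
  assumes sym: "\<And>x y. far x y \<Longrightarrow> far y x" and irr: "\<And>x. \<not> far x x"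
    and bound: "\<And>X. X \<subseteq> S \<Longrightarrow> \<forall>x\<in>X. \<forall>y\<in>X. x \<noteq> y \<longrightarrow> far x y \<Longrightarrow> finite X \<and> real (card X) \<le> b"
  obtains X where "X \<subseteq> S" "finite X" "\<forall>x\<in>X. \<forall>y\<in>X. x \<noteq> y \<longrightarrow> far x y" "\<And>v. v \<in> S \<Longrightarrow> \<exists>x\<in>X. \<not> far v x"
proof -
  let ?Q = "\<lambda>X. X \<subseteq> S \<and> (\<forall>x\<in>X. \<forall>y\<in>X. x \<noteq> y \<longrightarrow> far x y)"
  have "\<exists>X. ?Q X \<and> (\<forall>Y. ?Q Y \<longrightarrow> card Y \<le> card X)"
  proof (rule ex_has_greatest_nat[where k = "{}" and b = "Suc (nat \<lceil>b\<rceil>)"])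
    have "card Y \<le> nat \<lceil>b\<rceil>" if "?Q Y" for Y
      using bound[of Y] that by (meson of_nat_le_iff order_trans real_nat_ceiling_ge)
    then show "\<forall>Y. ?Q Y \<longrightarrow> card Y < Suc (nat \<lceil>b\<rceil>)" by (simp add: less_Suc_eq_le)
  qed simp
  then obtain X where XX: "?Q X \<and> (\<forall>Y. ?Q Y \<longrightarrow> card Y \<le> card X)" ..
  then have X: "?Q X" by (rule conjunct1)
  have mx: "card Y \<le> card X" if "?Q Y" for Y by (rule mp[OF spec[OF conjunct2[OF XX], of Y] that])
  have fin: "finite X" using bound[of X] X by blast
  show thesis
  proof (rule that[of X])
    fix v assume v: "v \<in> S"
    show "\<exists>x\<in>X. \<not> far v x"
    proof (rule ccontr)
      assume "\<not> ?thesis"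
      then have f: "\<And>x. x \<in> X \<Longrightarrow> far v x" by blast
      then have "v \<notin> X" using irr by blast
      moreover have "?Q (insert v X)" using X v f sym by auto
      ultimately show False using mx[of "insert v X"] fin by simp
    qed
  qed (use X fin in auto)
qed

lemma ex_maximal_separated:
  assumes "finite I" "0 < s" "s \<le> 1" and ball: "\<And>x. x \<in> S \<Longrightarrow> cnrm I x \<le> 1"
  obtains X where "X \<subseteq> S" "finite X" "separated I s X" "\<And>v. v \<in> S \<Longrightarrow> \<exists>x\<in>X. cnrm I (\<lambda>i. v i - x i) < s"
proof -
  obtain X where "X \<subseteq> S" "finite X" "\<forall>x\<in>X. \<forall>y\<in>X. x \<noteq> y \<longrightarrow> s \<le> cnrm I (\<lambda>i. x i - y i)"
    "\<And>v. v \<in> S \<Longrightarrow> \<exists>x\<in>X. \<not> s \<le> cnrm I (\<lambda>i. v i - x i)"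
  proof (rule ex_maximal_pairwise_far[of "\<lambda>x y. s \<le> cnrm I (\<lambda>i. x i - y i)" S "(4 / s) ^ (2 * card I)"])
    fix X assume "X \<subseteq> S" "\<forall>x\<in>X. \<forall>y\<in>X. x \<noteq> y \<longrightarrow> s \<le> cnrm I (\<lambda>i. x i - y i)"
    then show "finite X \<and> real (card X) \<le> (4 / s) ^ (2 * card I)"
      by (intro separated_card_le assms(1-3)) (auto simp: separated_def intro: ball)
  next
    show "s \<le> cnrm I (\<lambda>i. y i - x i)" if "s \<le> cnrm I (\<lambda>i. x i - y i)" for x y
      using that cnrm_diff_commute[of I x y] by simp
  qed (use assms(2) in \<open>auto simp: not_le\<close>)
  then show thesis using that[of X] by (auto simp: separated_def not_le)
qed

text \<open>If every coordinate vector were in the span of the \<open>e b\<close>, computing the sum of all \<open>|e b l|\<^sup>2\<close> in both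
  orders would give \<open>j = card I\<close>.\<close>

lemma ex_unit_orthogonal:
  assumes "finite I" "ons I e {..<j}" "j < card I"
  obtains v where "cnrm I v = 1" "\<And>b. b < j \<Longrightarrow> cip I (e b) v = 0"
proof -
  define \<delta> where "\<delta> l = (\<lambda>i. if i = l then 1 else 0 :: complex)" for l :: 'a
  have "\<exists>l\<in>I. cnrm I (\<lambda>i. \<delta> l i - cproj I e {..<j} (\<delta> l) i) \<noteq> 0"
  proof (rule ccontr)
    assume n: "\<not> ?thesis"
    have one: "(\<Sum>a<j. (cmod (cip I (e a) (\<delta> l)))\<^sup>2) = 1" if "l \<in> I" for l
    proof -
      have "(cnrm I (\<delta> l))\<^sup>2 = (\<Sum>i\<in>I. if i = l then 1 else 0)"
        unfolding cnrm_sq \<delta>_def by (rule sum.cong) auto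
      then have "(cnrm I (\<delta> l))\<^sup>2 = 1" using assms(1) that by simp
      then show ?thesis using cnrm_pythagoras[of "{..<j}" I e "\<delta> l"] assms n that by simp
    qed
    have val: "cip I (e a) (\<delta> l) = cnj (e a l)" if "l \<in> I" for a l
    proof -
      have "cip I (e a) (\<delta> l) = (\<Sum>i\<in>I. if i = l then cnj (e a i) else 0)"
        unfolding cip_def \<delta>_def by (rule sum.cong) auto
      then show ?thesis using assms(1) that by simp
    qed
    have "real (card I) = (\<Sum>l\<in>I. \<Sum>a<j. (cmod (cip I (e a) (\<delta> l)))\<^sup>2)" using one by simp
    also have "\<dots> = (\<Sum>l\<in>I. \<Sum>a<j. (cmod (e a l))\<^sup>2)" using val by simp
    also have "\<dots> = (\<Sum>a<j. (cnrm I (e a))\<^sup>2)" by (subst sum.swap) (simp add: cnrm_sq)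
    also have "\<dots> = (\<Sum>a<j. 1)" using ons_norm_one[OF assms(2)] by simp
    finally show False using assms(3) by simp
  qed
  then obtain l where l: "cnrm I (\<lambda>i. \<delta> l i - cproj I e {..<j} (\<delta> l) i) \<noteq> 0" by blast
  define w where "w = (\<lambda>i. \<delta> l i - cproj I e {..<j} (\<delta> l) i)"
  show thesis
  proof (rule that[of "\<lambda>i. of_real (1 / cnrm I w) * w i"])
    show "cnrm I (\<lambda>i. of_real (1 / cnrm I w) * w i) = 1"
      unfolding cnrm_scale using l by (simp add: w_def norm_divide)
    fix b assume "b < j"
    then show "cip I (e b) (\<lambda>i. of_real (1 / cnrm I w) * w i) = 0"
      unfolding cip_scale_right w_def using cip_ons_residual[of "{..<j}" I e b] assms by simp
  qed
qed

text \<open>Take a maximal separated set \<open>X\<close> in the unit sphere of the orthogonal complement. Vectors \<open>p + m * s * x\<close> with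
  \<open>p\<close> from an \<open>s\<close>-net of the unit ball of the span of the \<open>e b\<close>, \<open>m * s \<le> 1\<close> and \<open>x\<close> in \<open>X\<close> or zero then cover the
  unit ball of the whole space within \<open>3 * s\<close>. Comparing the lower bound for such a cover with the upper bound
  for the net bounds \<open>card X\<close> from below, without choosing coordinates in the complement.\<close>

lemma separated_in_orthogonal_sphere:
  assumes "finite I" "ons I e {..<j}" "j < card I" "0 < s" "s \<le> 1/4"
  obtains X where "finite X" "\<And>x. x \<in> X \<Longrightarrow> cnrm I x = 1" "\<And>x b. x \<in> X \<Longrightarrow> b < j \<Longrightarrow> cip I (e b) x = 0"
    "separated I s X" "real (card X) \<le> (4 / s) ^ (2 * card I)"
    "(1 / 12) ^ (2 * card I) * (1 / s) ^ (2 * (card I - j)) * s / 4 \<le> real (card X)"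
proof -
  define d where "d = card I"
  let ?S = "{x. cnrm I x = 1 \<and> (\<forall>b<j. cip I (e b) x = 0)}"
  have s1: "s \<le> 1" using assms by simp
  obtain X where X: "X \<subseteq> ?S" "finite X" "separated I s X" "\<And>v. v \<in> ?S \<Longrightarrow> \<exists>x\<in>X. cnrm I (\<lambda>i. v i - x i) < s"
    by (rule ex_maximal_separated[OF assms(1) \<open>0 < s\<close> s1, of ?S]) auto
  obtain N where N: "N \<subseteq> {c. cnrm {..<j} c \<le> 1}" "finite N" "separated {..<j} s N"
    "\<And>v. v \<in> {c. cnrm {..<j} c \<le> 1} \<Longrightarrow> \<exists>x\<in>N. cnrm {..<j} (\<lambda>i. v i - x i) < s"
    by (rule ex_maximal_separated[OF finite_lessThan \<open>0 < s\<close> s1, of "{c. cnrm {..<j} c \<le> 1}"]) auto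
  have cN: "real (card N) \<le> (4 / s) ^ (2 * j)"
    using separated_card_le[of "{..<j}" s N] N assms by auto
  define q where "q = nat \<lfloor>1 / s\<rfloor>"
  have q: "real q \<le> 1 / s" "1 / s < real q + 1" using assms unfolding q_def by (auto simp: of_nat_nat)
  define comb where "comb = (\<lambda>(c, m, x) (i::'a). (\<Sum>b<j. c b * e b i) + of_real (real m * s) * x i :: complex)"
  \<comment> \<open>The zero vector covers the case that the component in the complement vanishes.\<close>
  define X0 where "X0 = insert (\<lambda>_. 0) X"
  define F where "F = comb ` (N \<times> {..q} \<times> X0)"
  obtain x0 where x0: "x0 \<in> ?S" using ex_unit_orthogonal[OF assms(1-3)] by blast
  have Xne: "X \<noteq> {}" using X(4)[OF x0] by blast
  have cov: "\<exists>c\<in>F. cnrm I (\<lambda>i. v i - c i) \<le> 3 * s" if v: "cnrm I v \<le> 1" for v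
  proof -
    define p where "p = cproj I e {..<j} v"
    define w where "w = (\<lambda>i. v i - p i)"
    have py: "(cnrm I v)\<^sup>2 = (cnrm {..<j} (\<lambda>a. cip I (e a) v))\<^sup>2 + (cnrm I w)\<^sup>2"
      using cnrm_pythagoras[OF finite_lessThan assms(2), of v] by (simp add: cnrm_sq w_def p_def)
    have v2: "(cnrm I v)\<^sup>2 \<le> 1" using v by (simp add: power_le_one)
    have "(cnrm {..<j} (\<lambda>a. cip I (e a) v))\<^sup>2 \<le> 1\<^sup>2" using py v2 by (smt (verit) zero_le_power2 one_power2)
    then have "cnrm {..<j} (\<lambda>a. cip I (e a) v) \<le> 1" by (rule power2_le_imp_le) simp
    then obtain c where c: "c \<in> N" "cnrm {..<j} (\<lambda>i. cip I (e i) v - c i) < s" using N(4) by blast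
    have "(cnrm I w)\<^sup>2 \<le> 1\<^sup>2" using py v2 by (smt (verit) zero_le_power2 one_power2)
    then have w1: "cnrm I w \<le> 1" by (rule power2_le_imp_le) simp
    have "(\<lambda>i. p i - (\<Sum>b<j. c b * e b i)) = (\<lambda>i. \<Sum>b<j. (cip I (e b) v - c b) * e b i)"
      by (auto simp: p_def cproj_def sum_subtractf algebra_simps)
    then have sq: "(cnrm I (\<lambda>i. p i - (\<Sum>b<j. c b * e b i)))\<^sup>2 = (cnrm {..<j} (\<lambda>i. cip I (e i) v - c i))\<^sup>2"
      using cnrm_ons_comb[OF finite_lessThan assms(2)] by (simp add: cnrm_sq)
    have "cnrm I (\<lambda>i. p i - (\<Sum>b<j. c b * e b i)) = cnrm {..<j} (\<lambda>i. cip I (e i) v - c i)"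
      by (rule power2_eq_imp_eq[OF sq]) simp_all
    then have pc: "cnrm I (\<lambda>i. p i - (\<Sum>b<j. c b * e b i)) < s" using c(2) by simp
    have "\<exists>m\<le>q. \<exists>x\<in>X0. cnrm I (\<lambda>i. w i - of_real (real m * s) * x i) \<le> 2 * s"
    proof (cases "cnrm I w = 0")
      case True
      then show ?thesis using assms by (intro exI[of _ 0]) (auto simp: X0_def)
    next
      case False
      then have wpos: "0 < cnrm I w" using cnrm_nonneg[of I w] by linarith
      define y where "y = (\<lambda>i. of_real (1 / cnrm I w) * w i)"
      have "cnrm I y = 1" unfolding y_def cnrm_scale using wpos by (simp add: norm_divide)
      moreover have "cip I (e b) y = 0" if "b < j" for b
        unfolding y_def cip_scale_right w_def p_def using cip_ons_residual[OF finite_lessThan assms(2), of b] that by simp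
      ultimately obtain x where x: "x \<in> X" "cnrm I (\<lambda>i. y i - x i) < s" using X(4)[of y] by blast
      define m where "m = nat \<lfloor>cnrm I w / s\<rfloor>"
      have m: "real m \<le> cnrm I w / s" "cnrm I w / s < real m + 1"
        using wpos assms by (simp_all add: m_def)
      have "cnrm I w / s \<le> 1 / s" using w1 assms by (intro divide_right_mono) auto
      then have mq: "m \<le> q" unfolding m_def q_def by (intro nat_mono floor_mono)
      have ms: "real m * s \<le> cnrm I w" "cnrm I w < real m * s + s"
        using m assms by (simp_all add: field_simps)
      have wy: "w i = of_real (cnrm I w) * y i" for i using wpos by (simp add: y_def)
      have "(\<lambda>i. w i - of_real (real m * s) * x i)
        = (\<lambda>i. of_real (cnrm I w - real m * s) * y i + of_real (real m * s) * (y i - x i))"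
        by (rule ext) (subst wy, simp add: algebra_simps)
      then have "cnrm I (\<lambda>i. w i - of_real (real m * s) * x i)
         \<le> \<bar>cnrm I w - real m * s\<bar> * cnrm I y + \<bar>real m * s\<bar> * cnrm I (\<lambda>i. y i - x i)"
        using cnrm_triangle[of I "\<lambda>i. of_real (cnrm I w - real m * s) * y i" "\<lambda>i. of_real (real m * s) * (y i - x i)"]
        by (simp only: cnrm_scale norm_of_real)
      also have "\<dots> \<le> s * 1 + 1 * s"
        using ms w1 x \<open>cnrm I y = 1\<close> assms by (intro add_mono mult_mono) (auto simp: abs_mult)
      finally show ?thesis using mq x by (auto simp: X0_def)
    qed
    then obtain m x where mx: "m \<le> q" "x \<in> X0" "cnrm I (\<lambda>i. w i - of_real (real m * s) * x i) \<le> 2 * s" by blast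
    have "(\<lambda>i. v i - comb (c, m, x) i) = (\<lambda>i. (p i - (\<Sum>b<j. c b * e b i)) + (w i - of_real (real m * s) * x i))"
      by (auto simp: comb_def w_def)
    then have "cnrm I (\<lambda>i. v i - comb (c, m, x) i) \<le> s + 2 * s"
      using cnrm_triangle[of I "\<lambda>i. p i - (\<Sum>b<j. c b * e b i)" "\<lambda>i. w i - of_real (real m * s) * x i"] pc mx(3) by simp
    then show ?thesis using c mx unfolding F_def by (intro bexI[of _ "comb (c, m, x)"]) auto
  qed
  have finF: "finite F" using N X by (simp add: F_def X0_def)
  have "(1 / (3 * s)) ^ (2 * d) \<le> real (card F)"
    unfolding d_def using cover_card_ge[OF assms(1) finF _ cov] assms(4) by simp
  also have "card F \<le> card N * (Suc q * card X0)"
    unfolding F_def by (rule order_trans[OF card_image_le]) (use N X in \<open>auto simp: X0_def card_cartesian_product\<close>)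
  also have "real (card N * (Suc q * card X0)) = real (card N) * (real (Suc q) * real (card X0))" by (simp only: of_nat_mult)
  also have "\<dots> \<le> (4 / s) ^ (2 * j) * ((2 / s) * (2 * real (card X)))"
  proof -
    have "1 \<le> 1 / s" using assms by simp
    then have "real (Suc q) \<le> 2 / s" using q by simp
    moreover have "1 \<le> card X" using Xne X by (simp add: Suc_leI card_gt_0_iff)
    then have "real (card X0) \<le> 2 * real (card X)" using X card_insert_le_m1 by (simp add: X0_def card_insert_if)
    ultimately show ?thesis using cN assms by (intro mult_mono) auto
  qed
  finally have main: "(1 / (3 * s)) ^ (2 * d) \<le> (4 / s) ^ (2 * j) * ((2 / s) * (2 * real (card X)))" by simp
  have jd: "j \<le> d" using assms by (simp add: d_def)
  have "(1 / (3 * s)) ^ (2 * d) = (1 / 3) ^ (2 * d) * (1 / s) ^ (2 * (d - j)) * (1 / s) ^ (2 * j)"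
  proof -
    have "2 * d = 2 * (d - j) + 2 * j" using jd by simp
    then have "(1 / s) ^ (2 * d) = (1 / s) ^ (2 * (d - j)) * (1 / s) ^ (2 * j)" by (metis power_add)
    then show ?thesis by (simp add: power_divide power_mult_distrib)
  qed
  moreover have "(4 / s) ^ (2 * j) = 4 ^ (2 * j) * (1 / s) ^ (2 * j)" by (simp add: power_divide)
  ultimately have "((1 / 3) ^ (2 * d) * (1 / s) ^ (2 * (d - j))) * (1 / s) ^ (2 * j)
      \<le> (4 ^ (2 * j) * ((2 / s) * (2 * real (card X)))) * (1 / s) ^ (2 * j)"
    using main by (simp add: mult_ac)
  then have "(1 / 3) ^ (2 * d) * (1 / s) ^ (2 * (d - j)) \<le> 4 ^ (2 * j) * ((2 / s) * (2 * real (card X)))"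
    by (rule mult_right_le_imp_le) (use assms in simp)
  also have "\<dots> \<le> 4 ^ (2 * d) * ((2 / s) * (2 * real (card X)))"
    using jd assms by (intro mult_right_mono power_increasing) auto
  finally have "(1 / 4) ^ (2 * d) * s / 4 * ((1 / 3) ^ (2 * d) * (1 / s) ^ (2 * (d - j)))
     \<le> (1 / 4) ^ (2 * d) * s / 4 * (4 ^ (2 * d) * ((2 / s) * (2 * real (card X))))"
    using assms by (intro mult_left_mono) auto
  also have "\<dots> = real (card X)" using assms by (simp add: power_divide field_simps)
  also have "(1 / 4) ^ (2 * d) * s / 4 * ((1 / 3) ^ (2 * d) * (1 / s) ^ (2 * (d - j)))
    = (1 / 12) ^ (2 * d) * (1 / s) ^ (2 * (d - j)) * s / 4"
    by (simp add: power_mult_distrib[symmetric] mult_ac del: power_mult power_divide)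
  finally have low: "(1 / 12) ^ (2 * card I) * (1 / s) ^ (2 * (card I - j)) * s / 4 \<le> real (card X)"
    by (simp add: d_def)
  show thesis
  proof (rule that[of X])
    show "real (card X) \<le> (4 / s) ^ (2 * card I)"
    proof (rule separated_card_le[OF assms(1) assms(4) s1 _ X(3), THEN conjunct2])
      show "cnrm I x \<le> 1" if "x \<in> X" for x using X(1) that by auto
    qed
  qed (use X low in auto)
qed

section \<open>Separated orthonormal frames\<close>

text \<open>Frames are built column by column: each partial frame \<open>us\<close> is extended by all \<open>x\<close> in a separated set of unit
  vectors orthogonal to it. A frame close to a given one in all columns outside \<open>J\<close> is determined by its
  columns in \<open>J\<close>, because a separated set has at most one element within \<open>s / 2\<close> of a given vector; so there
  are at most \<open>B ^ card J\<close> of them. This count is carried through the induction.\<close>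

lemma frame_tree:
  fixes I :: "'i set"
  assumes "finite I" "0 < s" "s \<le> 1/4" "j \<le> card I"
  shows "\<exists>T :: ('i \<Rightarrow> complex) list set. finite T \<and> (\<forall>us\<in>T. length us = j \<and> ons I (\<lambda>a. us ! a) {..<j}) \<and>
    (\<Prod>i<j. (1 / 12) ^ (2 * card I) * (1 / s) ^ (2 * (card I - i)) * s / 4) \<le> real (card T) \<and>
    (\<forall>u0 J. real (card {us\<in>T. \<forall>i<j. i \<notin> J \<longrightarrow> cnrm I (\<lambda>a. (us ! i) a - u0 i a) < s / 2})
       \<le> ((4 / s) ^ (2 * card I)) ^ card (J \<inter> {..<j}))"
  using assms(4)
proof (induction j)
  case 0
  have "card {us \<in> {[]}. \<forall>i<0. i \<notin> J \<longrightarrow> cnrm I (\<lambda>a. (us ! i) a - u0 i a) < s / 2} = 1"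
    for u0 :: "nat \<Rightarrow> 'i \<Rightarrow> complex" and J by simp
  then show ?case by (intro exI[of _ "{[]}"]) (auto simp: ons_def)
next
  case (Suc j)
  define B where "B = (4 / s) ^ (2 * card I)"
  define lb where "lb i = (1 / 12) ^ (2 * card I) * (1 / s) ^ (2 * (card I - i)) * s / 4" for i
  have B0: "0 \<le> B" using assms by (simp add: B_def)
  from Suc obtain T where T: "finite T" "\<And>us. us \<in> T \<Longrightarrow> length us = j \<and> ons I (\<lambda>a. us ! a) {..<j}"
    "(\<Prod>i<j. lb i) \<le> real (card T)"
    "\<And>u0 J. real (card {us\<in>T. \<forall>i<j. i \<notin> J \<longrightarrow> cnrm I (\<lambda>a. (us ! i) a - u0 i a) < s / 2}) \<le> B ^ card (J \<inter> {..<j})"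
    unfolding lb_def B_def by (auto simp: Suc_le_eq less_imp_le)
  have "\<forall>us\<in>T. \<exists>X. finite X \<and> (\<forall>x\<in>X. cnrm I x = 1) \<and> (\<forall>x\<in>X. \<forall>b<j. cip I (us ! b) x = 0) \<and>
     separated I s X \<and> real (card X) \<le> B \<and> lb j \<le> real (card X)"
  proof
    fix us assume "us \<in> T"
    then have "ons I (\<lambda>a. us ! a) {..<j}" using T(2) by blast
    moreover have "j < card I" using Suc.prems by simp
    ultimately show "\<exists>X. finite X \<and> (\<forall>x\<in>X. cnrm I x = 1) \<and> (\<forall>x\<in>X. \<forall>b<j. cip I (us ! b) x = 0) \<and>
     separated I s X \<and> real (card X) \<le> B \<and> lb j \<le> real (card X)"
      unfolding B_def lb_def
      by (rule separated_in_orthogonal_sphere[OF assms(1) _ _ assms(2,3)]) blast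
  qed
  then obtain X where "\<forall>us\<in>T. finite (X us) \<and> (\<forall>x\<in>X us. cnrm I x = 1) \<and> (\<forall>x\<in>X us. \<forall>b<j. cip I (us ! b) x = 0) \<and>
     separated I s (X us) \<and> real (card (X us)) \<le> B \<and> lb j \<le> real (card (X us))"
    using bchoice[of T "\<lambda>us X. finite X \<and> (\<forall>x\<in>X. cnrm I x = 1) \<and> (\<forall>x\<in>X. \<forall>b<j. cip I (us ! b) x = 0) \<and>
     separated I s X \<and> real (card X) \<le> B \<and> lb j \<le> real (card X)"] by blast
  then have X: "\<And>us. us \<in> T \<Longrightarrow> finite (X us)" "\<And>us x. us \<in> T \<Longrightarrow> x \<in> X us \<Longrightarrow> cnrm I x = 1"
    "\<And>us x b. us \<in> T \<Longrightarrow> x \<in> X us \<Longrightarrow> b < j \<Longrightarrow> cip I (us ! b) x = 0"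
    "\<And>us. us \<in> T \<Longrightarrow> separated I s (X us)" "\<And>us. us \<in> T \<Longrightarrow> real (card (X us)) \<le> B"
    "\<And>us. us \<in> T \<Longrightarrow> lb j \<le> real (card (X us))" by blast+
  define ap where "ap = (\<lambda>(us, x). us @ [x] :: ('i \<Rightarrow> complex) list)"
  define T' where "T' = ap ` (Sigma T X)"
  have inj: "inj_on ap S" for S by (auto simp: inj_on_def ap_def)
  have cardSig: "real (card (ap ` (Sigma S Y))) = (\<Sum>us\<in>S. real (card (Y us)))"
    if "finite S" "\<And>us. us \<in> S \<Longrightarrow> finite (Y us)" for S Y
    using that by (simp add: card_image[OF inj] card_SigmaI)
  show ?case
  proof (intro exI[of _ T'] conjI ballI allI)
    show "finite T'" using T X by (auto simp: T'_def)
    fix vs assume "vs \<in> T'"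
    then obtain us x where vs: "us \<in> T" "x \<in> X us" "vs = us @ [x]" by (auto simp: T'_def ap_def)
    have len: "length us = j" and o: "ons I (\<lambda>a. us ! a) {..<j}" using T(2) vs by auto
    show "length vs = Suc j" using len vs by simp
    show "ons I (\<lambda>a. vs ! a) {..<Suc j}"
      unfolding ons_def
    proof (intro ballI)
      fix a b assume ab: "a \<in> {..<Suc j}" "b \<in> {..<Suc j}"
      have xx: "cip I x x = 1" using X(2)[OF vs(1,2)] by (simp add: cip_self)
      have ux: "cip I (us ! b) x = 0" "cip I x (us ! b) = 0" if "b < j" for b
        using X(3)[OF vs(1,2) that] cip_cnj[of I x "us ! b"] by auto
      show "cip I (vs ! a) (vs ! b) = (if a = b then 1 else 0)"
        using ab o xx ux len by (auto simp: vs(3) nth_append ons_def less_Suc_eq)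
    qed
  next
    have "(\<Prod>i<Suc j. lb i) = (\<Prod>i<j. lb i) * lb j" by simp
    also have "\<dots> \<le> real (card T) * lb j"
      using T(3) assms by (intro mult_right_mono) (auto simp: lb_def)
    also have "\<dots> = (\<Sum>us\<in>T. lb j)" by simp
    also have "\<dots> \<le> (\<Sum>us\<in>T. real (card (X us)))" using X by (intro sum_mono) auto
    also have "\<dots> = real (card T')" unfolding T'_def using cardSig[OF T(1) X(1)] by simp
    finally show "(\<Prod>i<Suc j. (1 / 12) ^ (2 * card I) * (1 / s) ^ (2 * (card I - i)) * s / 4) \<le> real (card T')"
      by (simp add: lb_def)
  next
    fix u0 :: "nat \<Rightarrow> 'i \<Rightarrow> complex" and J :: "nat set"
    define S where "S = {us\<in>T. \<forall>i<j. i \<notin> J \<longrightarrow> cnrm I (\<lambda>a. (us ! i) a - u0 i a) < s / 2}"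
    define Y where "Y us = {x \<in> X us. j \<notin> J \<longrightarrow> cnrm I (\<lambda>a. x a - u0 j a) < s / 2}" for us
    have finS: "finite S" and ST: "S \<subseteq> T" using T(1) by (auto simp: S_def)
    have finY: "finite (Y us)" if "us \<in> S" for us using X(1) ST that by (auto simp: Y_def)
    have eq: "{vs\<in>T'. \<forall>i<Suc j. i \<notin> J \<longrightarrow> cnrm I (\<lambda>a. (vs ! i) a - u0 i a) < s / 2} = ap ` Sigma S Y"
    proof -
      have *: "(\<forall>i<Suc j. i \<notin> J \<longrightarrow> cnrm I (\<lambda>a. ((us @ [x]) ! i) a - u0 i a) < s / 2) \<longleftrightarrow>
        (\<forall>i<j. i \<notin> J \<longrightarrow> cnrm I (\<lambda>a. (us ! i) a - u0 i a) < s / 2) \<and> (j \<notin> J \<longrightarrow> cnrm I (\<lambda>a. x a - u0 j a) < s / 2)"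
        if "us \<in> T" for us x
        using T(2)[OF that] by (auto simp: less_Suc_eq nth_append)
      show ?thesis
      proof (intro equalityI subsetI)
        fix vs assume "vs \<in> {vs\<in>T'. \<forall>i<Suc j. i \<notin> J \<longrightarrow> cnrm I (\<lambda>a. (vs ! i) a - u0 i a) < s / 2}"
        then obtain us x where "us \<in> T" "x \<in> X us" "vs = us @ [x]"
          "\<forall>i<Suc j. i \<notin> J \<longrightarrow> cnrm I (\<lambda>a. ((us @ [x]) ! i) a - u0 i a) < s / 2" by (auto simp: T'_def ap_def)
        then have "(us, x) \<in> Sigma S Y" using *[of us x] by (simp add: S_def Y_def)
        then show "vs \<in> ap ` Sigma S Y" using \<open>vs = us @ [x]\<close> by (force simp: ap_def)
      next
        fix vs assume "vs \<in> ap ` Sigma S Y"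
        then obtain us x where u: "us \<in> S" "x \<in> Y us" "vs = us @ [x]" by (auto simp: ap_def)
        then have "us \<in> T" "x \<in> X us" by (auto simp: S_def Y_def)
        then have "us @ [x] \<in> T'" by (force simp: T'_def ap_def)
        then show "vs \<in> {vs\<in>T'. \<forall>i<Suc j. i \<notin> J \<longrightarrow> cnrm I (\<lambda>a. (vs ! i) a - u0 i a) < s / 2}"
          using *[OF \<open>us \<in> T\<close>, of x] u by (simp add: S_def Y_def)
      qed
    qed
    have "real (card (ap ` Sigma S Y)) = (\<Sum>us\<in>S. real (card (Y us)))" by (rule cardSig[OF finS finY])
    also have "\<dots> \<le> B ^ card (J \<inter> {..<Suc j})"
    proof (cases "j \<in> J")
      case True
      have "(\<Sum>us\<in>S. real (card (Y us))) \<le> (\<Sum>us\<in>S. B)"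
        using X(5) ST True by (intro sum_mono) (auto simp: Y_def)
      also have "\<dots> = real (card S) * B" by simp
      also have "\<dots> \<le> B ^ card (J \<inter> {..<j}) * B" using T(4) B0 unfolding S_def by (intro mult_right_mono) auto
      also have "J \<inter> {..<Suc j} = insert j (J \<inter> {..<j})" using True by auto
      then have "B ^ card (J \<inter> {..<j}) * B = B ^ card (J \<inter> {..<Suc j})" by simp
      finally show ?thesis .
    next
      case False
      have "real (card (Y us)) \<le> 1" if "us \<in> S" for us
      proof -
        have "x = y" if "x \<in> Y us" "y \<in> Y us" for x y
        proof (rule ccontr)
          assume "x \<noteq> y"
          then have "s \<le> cnrm I (\<lambda>a. x a - y a)" using X(4)[of us] ST \<open>us \<in> S\<close> that by (auto simp: separated_def Y_def)
          moreover have "cnrm I (\<lambda>a. x a - y a) < s / 2 + s / 2"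
            using cnrm_triangle_diff[of I x y "u0 j"] cnrm_diff_commute[of I "u0 j" y] that False by (auto simp: Y_def)
          ultimately show False by simp
        qed
        then have "card (Y us) \<le> Suc 0" using card_le_Suc0_iff_eq[OF finY[OF that]] by blast
        then show ?thesis by simp
      qed
      then have "(\<Sum>us\<in>S. real (card (Y us))) \<le> (\<Sum>us\<in>S. 1)" by (intro sum_mono)
      also have "\<dots> = real (card S)" by simp
      also have "\<dots> \<le> B ^ card (J \<inter> {..<j})" using T(4) unfolding S_def by blast
      also have "J \<inter> {..<j} = J \<inter> {..<Suc j}" using False by (auto simp: less_Suc_eq)
      finally show ?thesis .
    qed
    finally show "real (card {vs\<in>T'. \<forall>i<Suc j. i \<notin> J \<longrightarrow> cnrm I (\<lambda>a. (vs ! i) a - u0 i a) < s / 2})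
      \<le> ((4 / s) ^ (2 * card I)) ^ card (J \<inter> {..<Suc j})" unfolding eq B_def .
  qed
qed

lemma sum_two_diffs: "(\<Sum>i<k. 2 * (k - i)) = k * k + (k::nat)"
proof -
  have "(\<Sum>i<k. 2 * (k - i)) = (\<Sum>i<k. 2 * Suc (k - Suc i))" by (intro sum.cong refl) auto
  also have "\<dots> = (\<Sum>i<k. 2 * Suc i)" by (rule sum.nat_diff_reindex[of "\<lambda>i. 2 * Suc i"])
  also have "\<dots> = k * k + k" by (induction k) auto
  finally show ?thesis .
qed

text \<open>A maximal separated set \<open>M\<close> in the tree of frames. The frames near a given one differ from it by \<open>s / 2\<close> or more
  in at most \<open>\<gamma> * k\<close> columns; summing the bound of \<open>frame_tree\<close> over the sets of such columns bounds their
  number. The exponents \<open>2 * (k - i)\<close> of the column counts add up to \<open>k\<^sup>2 + k\<close>, and the factors \<open>s\<close> remove the \<open>k\<close>.\<close>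

lemma many_separated_frames:
  fixes I :: "'i set"
  assumes "finite I" "card I = k" "1 \<le> k" "0 < s" "s \<le> 1/4" "0 < \<gamma>"
  shows "\<exists>M :: ('i \<Rightarrow> complex) list set. finite M \<and> (\<forall>us\<in>M. length us = k \<and> ons I (\<lambda>a. us ! a) {..<k}) \<and>
    (\<forall>us\<in>M. \<forall>vs\<in>M. us \<noteq> vs \<longrightarrow> \<gamma> * k * (s / 2)\<^sup>2 \<le> (\<Sum>i<k. (cnrm I (\<lambda>a. (us ! i) a - (vs ! i) a))\<^sup>2)) \<and>
    (1 / (576 * s)) ^ (k * k) \<le> real (card M) * (2 ^ k * (4 / s) powr (2 * \<gamma> * k\<^sup>2))"
proof -
  define c where "c = \<gamma> * k * (s / 2)\<^sup>2"
  define D where "D us vs = (\<Sum>i<k. (cnrm I (\<lambda>a. (us ! i) a - (vs ! i) a))\<^sup>2)" for us vs :: "('i \<Rightarrow> complex) list"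
  have c0: "0 < c" using assms by (simp add: c_def)
  obtain T :: "('i \<Rightarrow> complex) list set" where T: "finite T" "\<And>us. us \<in> T \<Longrightarrow> length us = k \<and> ons I (\<lambda>a. us ! a) {..<k}"
    "(\<Prod>i<k. (1 / 12) ^ (2 * k) * (1 / s) ^ (2 * (k - i)) * s / 4) \<le> real (card T)"
    "\<And>u0 J. real (card {us\<in>T. \<forall>i<k. i \<notin> J \<longrightarrow> cnrm I (\<lambda>a. (us ! i) a - u0 i a) < s / 2})
       \<le> ((4 / s) ^ (2 * k)) ^ card (J \<inter> {..<k})"
    using frame_tree[OF assms(1,4,5), of k] unfolding assms(2) by blast
  have Dsym: "D us vs = D vs us" for us vs
    unfolding D_def by (subst cnrm_diff_commute) simp
  have Drefl: "D us us = 0" for us by (simp add: D_def)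
  obtain M where MT: "M \<subseteq> T" and finM: "finite M" and far: "\<forall>us\<in>M. \<forall>vs\<in>M. us \<noteq> vs \<longrightarrow> c \<le> D us vs"
    and near: "\<And>v. v \<in> T \<Longrightarrow> \<exists>m\<in>M. \<not> c \<le> D v m"
  proof (rule ex_maximal_pairwise_far[of "\<lambda>us vs. c \<le> D us vs" T "real (card T)"])
    show "finite X \<and> real (card X) \<le> real (card T)" if "X \<subseteq> T" for X
      using that T(1) finite_subset card_mono by auto
  qed (use Dsym Drefl c0 in \<open>auto simp: not_le\<close>)
  define C where "C m = {us\<in>T. D us m < c}" for m
  have cover: "T \<subseteq> (\<Union>m\<in>M. C m)" using near by (force simp: C_def not_le)
  have B1: "1 \<le> 4 / s" using assms by simp
  have cC: "real (card (C m)) \<le> 2 ^ k * (4 / s) powr (2 * \<gamma> * k\<^sup>2)" for m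
  proof -
    let ?J = "{J. J \<subseteq> {..<k} \<and> real (card J) \<le> \<gamma> * k}"
    let ?E = "\<lambda>J. {us\<in>T. \<forall>i<k. i \<notin> J \<longrightarrow> cnrm I (\<lambda>a. (us ! i) a - (m ! i) a) < s / 2}"
    have finJ: "finite ?J" by (rule finite_subset[of _ "Pow {..<k}"]) auto
    have "C m \<subseteq> (\<Union>J\<in>?J. ?E J)"
    proof
      fix us assume us: "us \<in> C m"
      define J where "J = {i. i < k \<and> s / 2 \<le> cnrm I (\<lambda>a. (us ! i) a - (m ! i) a)}"
      have "real (card J) * (s / 2)\<^sup>2 = (\<Sum>i\<in>J. (s / 2)\<^sup>2)" by simp
      also have "\<dots> \<le> (\<Sum>i\<in>J. (cnrm I (\<lambda>a. (us ! i) a - (m ! i) a))\<^sup>2)"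
        using assms by (intro sum_mono power_mono) (auto simp: J_def)
      also have "\<dots> \<le> D us m" unfolding D_def by (rule sum_mono2) (auto simp: J_def)
      also have "\<dots> \<le> \<gamma> * k * (s / 2)\<^sup>2" using us by (simp add: C_def c_def)
      finally have "real (card J) \<le> \<gamma> * k" using assms by simp
      then have "J \<in> ?J" by (auto simp: J_def)
      moreover have "us \<in> ?E J" using us by (auto simp: J_def C_def)
      ultimately show "us \<in> (\<Union>J\<in>?J. ?E J)" by blast
    qed
    then have "card (C m) \<le> card (\<Union>J\<in>?J. ?E J)" using finJ T(1) by (intro card_mono) auto
    also have "\<dots> \<le> (\<Sum>J\<in>?J. card (?E J))" by (rule card_UN_le[OF finJ])
    finally have "real (card (C m)) \<le> real (\<Sum>J\<in>?J. card (?E J))" by (simp only: of_nat_le_iff)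
    also have "\<dots> = (\<Sum>J\<in>?J. real (card (?E J)))" by (rule of_nat_sum)
    also have "\<dots> \<le> (\<Sum>J\<in>?J. (4 / s) powr (2 * \<gamma> * k\<^sup>2))"
    proof (rule sum_mono)
      fix J assume J: "J \<in> ?J"
      then have "J \<inter> {..<k} = J" by auto
      then have "real (card (?E J)) \<le> ((4 / s) ^ (2 * k)) ^ card J" using T(4)[where J=J and ?u0.0="\<lambda>i. m ! i"] by simp
      also have "\<dots> = (4 / s) powr (real (2 * k * card J))"
        unfolding power_mult[symmetric] using assms by (subst powr_realpow) auto
      also have "\<dots> \<le> (4 / s) powr (2 * \<gamma> * k\<^sup>2)"
      proof (rule powr_mono)
        have "real k * real (card J) \<le> real k * (\<gamma> * k)" using J by (intro mult_left_mono) auto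
        then show "real (2 * k * card J) \<le> 2 * \<gamma> * k\<^sup>2" by (simp add: power2_eq_square mult_ac)
      qed (use B1 in simp)
      finally show "real (card (?E J)) \<le> (4 / s) powr (2 * \<gamma> * k\<^sup>2)" .
    qed
    also have "\<dots> = real (card ?J) * (4 / s) powr (2 * \<gamma> * k\<^sup>2)" by simp
    also have "card ?J \<le> card (Pow {..<k})" by (rule card_mono) auto
    then have "card ?J \<le> 2 ^ k" by (simp add: card_Pow)
    then have "real (card ?J) \<le> 2 ^ k" by (metis of_nat_le_iff of_nat_numeral of_nat_power)
    then have "real (card ?J) * (4 / s) powr (2 * \<gamma> * k\<^sup>2) \<le> 2 ^ k * (4 / s) powr (2 * \<gamma> * k\<^sup>2)"
      by (rule mult_right_mono) simp
    finally show ?thesis .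
  qed
  have "card T \<le> card (\<Union>m\<in>M. C m)" using cover finM T(1) by (intro card_mono) (auto simp: C_def)
  also have "\<dots> \<le> (\<Sum>m\<in>M. card (C m))" by (rule card_UN_le[OF finM])
  finally have "real (card T) \<le> real (\<Sum>m\<in>M. card (C m))" by (simp only: of_nat_le_iff)
  also have "\<dots> = (\<Sum>m\<in>M. real (card (C m)))" by (rule of_nat_sum)
  also have "\<dots> \<le> (\<Sum>m\<in>M. 2 ^ k * (4 / s) powr (2 * \<gamma> * k\<^sup>2))" by (intro sum_mono cC)
  finally have cT: "real (card T) \<le> real (card M) * (2 ^ k * (4 / s) powr (2 * \<gamma> * k\<^sup>2))" by simp
  have "(\<Prod>i<k. (1 / 12) ^ (2 * k) * (1 / s) ^ (2 * (k - i)) * s / 4)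
     = (\<Prod>i<k. ((1 / 144) ^ k * (s / 4)) * (1 / s) ^ (2 * (k - i)))"
    by (intro prod.cong refl) (simp add: power_mult power_divide)
  also have "\<dots> = ((1 / 144) ^ k * (s / 4)) ^ k * (1 / s) ^ (k * k + k)"
    by (subst prod.distrib) (simp only: power_sum[symmetric] sum_two_diffs prod_constant card_lessThan)
  also have "\<dots> = (1 / 144) ^ (k * k) * ((s / 4) ^ k * (1 / s) ^ k) * (1 / s) ^ (k * k)"
    by (simp only: power_mult_distrib power_mult power_add mult_ac)
  also have "(s / 4) ^ k * (1 / s) ^ k = (1 / 4) ^ k"
    unfolding power_mult_distrib[symmetric] using assms by simp
  also have "(1 / 144) ^ (k * k) * (1 / 4) ^ k * (1 / s) ^ (k * k)
      \<ge> (1 / 144) ^ (k * k) * (1 / 4) ^ (k * k) * (1 / s) ^ (k * k)"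
    using assms by (intro mult_right_mono mult_left_mono power_decreasing) auto
  also have "(1 / 144) ^ (k * k) * (1 / 4) ^ (k * k) * (1 / s) ^ (k * k) = (1 / (576 * s)) ^ (k * k)"
    unfolding power_mult_distrib[symmetric] by simp
  finally have "(1 / (576 * s)) ^ (k * k) \<le> real (card M) * (2 ^ k * (4 / s) powr (2 * \<gamma> * k\<^sup>2))"
    using T(3) cT by linarith
  then show ?thesis using MT far T(2) finM by (intro exI[of _ M]) (auto simp: c_def D_def)
qed

section \<open>The subspace on which a quadratic form is small\<close>

definition capply :: "'i set \<Rightarrow> ('q \<Rightarrow> 'i \<Rightarrow> complex) \<Rightarrow> ('i \<Rightarrow> complex) \<Rightarrow> 'q \<Rightarrow> complex" where
  "capply I m v = (\<lambda>q. \<Sum>i\<in>I. m q i * v i)"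

lemma capply_add: "capply I m (\<lambda>i. u i + v i) = (\<lambda>q. capply I m u q + capply I m v q)"
  by (auto simp: capply_def algebra_simps sum.distrib)
lemma capply_scale: "capply I m (\<lambda>i. c * v i) = (\<lambda>q. c * capply I m v q)"
  by (auto simp: capply_def algebra_simps sum_distrib_left)
lemma capply_sum: "capply I m (\<lambda>i. \<Sum>a\<in>S. v a i) = (\<lambda>q. \<Sum>a\<in>S. capply I m (v a) q)"
  unfolding capply_def by (rule ext, subst sum.swap) (simp add: sum_distrib_left)

lemma finite_coordinate_subsequence:
  fixes v :: "nat \<Rightarrow> 'i \<Rightarrow> complex"
  assumes "finite I" and bd: "\<And>n i. i \<in> I \<Longrightarrow> cmod (v n i) \<le> B"
  shows "\<exists>r l. strict_mono (r :: nat \<Rightarrow> nat) \<and> (\<forall>i\<in>I. (\<lambda>n. v (r n) i) \<longlonglongrightarrow> l i)"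
  using assms
proof (induction I rule: finite_induct)
  case empty
  then show ?case using strict_mono_id by blast
next
  case (insert i I)
  then obtain r l where r: "strict_mono (r :: nat \<Rightarrow> nat)" "\<forall>j\<in>I. (\<lambda>n. v (r n) j) \<longlonglongrightarrow> l j" by auto
  have bnd: "bounded (range (\<lambda>n. v (r n) i))" using insert.prems by (auto simp: bounded_iff)
  then obtain z r' where r': "strict_mono (r' :: nat \<Rightarrow> nat)" "((\<lambda>n. v (r n) i) \<circ> r') \<longlonglongrightarrow> z"
    using bounded_imp_convergent_subsequence[OF bnd] by blast
  have "(\<lambda>n. v ((r \<circ> r') n) j) \<longlonglongrightarrow> (l(i := z)) j" if "j \<in> insert i I" for j
  proof (cases "j = i")
    case True
    then show ?thesis using r'(2) by (simp add: o_def)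
  next
    case False
    then show ?thesis using that r(2) LIMSEQ_subseq_LIMSEQ[OF _ r'(1), of "\<lambda>n. v (r n) j" "l j"] by (simp add: o_def)
  qed
  then show ?case using strict_mono_o[OF r(1) r'(1)] by blast
qed

lemma tendsto_cip: "(\<And>i. i \<in> I \<Longrightarrow> (\<lambda>n. v n i) \<longlonglongrightarrow> l i) \<Longrightarrow> (\<lambda>n. cip I e (v n)) \<longlonglongrightarrow> cip I e l"
  unfolding cip_def by (intro tendsto_sum tendsto_mult tendsto_const) auto

lemma tendsto_cnrm: "(\<And>i. i \<in> I \<Longrightarrow> (\<lambda>n. v n i) \<longlonglongrightarrow> l i) \<Longrightarrow> (\<lambda>n. cnrm I (v n)) \<longlonglongrightarrow> cnrm I l"
  unfolding cnrm_def L2_set_def by (intro tendsto_intros) auto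

lemma tendsto_capply: "(\<And>i. i \<in> I \<Longrightarrow> (\<lambda>n. v n i) \<longlonglongrightarrow> l i) \<Longrightarrow> (\<lambda>n. capply I m (v n) q) \<longlonglongrightarrow> capply I m l q"
  unfolding capply_def by (intro tendsto_sum tendsto_mult tendsto_const) auto

lemma real_quadratic_nonneg_imp_zero:
  fixes b c :: real
  assumes "\<And>t. 0 \<le> 2 * t * b + t\<^sup>2 * c"
  shows "b = 0"
proof (rule ccontr)
  assume "b \<noteq> 0"
  define e where "e = \<bar>c\<bar> + 1"
  have e: "e > 0" "c < 2 * e" by (auto simp: e_def)
  have "2 * (- b / e) * b + (- b / e)\<^sup>2 * c = (b\<^sup>2 / e\<^sup>2) * (c - 2 * e)"
    using e by (simp add: field_simps power2_eq_square)
  also have "\<dots> < 0" using e \<open>b \<noteq> 0\<close> by (intro mult_pos_neg) auto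
  finally show False using assms[of "- b / e"] by simp
qed

text \<open>A minimiser \<open>u\<close> of the norm of \<open>m u\<close> on the unit sphere of a subspace, which exists by compactness. Perturbing
  \<open>u\<close> to \<open>u + t * v\<close> and to \<open>u + t * \<i> * v\<close> with \<open>v\<close> orthogonal to \<open>u\<close> shows that \<open>m u\<close> is orthogonal to \<open>m v\<close>.\<close>

lemma ex_minimal_direction:
  fixes m :: "'q \<Rightarrow> 'i \<Rightarrow> complex" and e :: "nat \<Rightarrow> 'i \<Rightarrow> complex"
  assumes "finite I" "finite Q" and v0: "cnrm I v0 = 1" "\<And>b. b < w \<Longrightarrow> cip I (e b) v0 = 0"
  obtains u where "cnrm I u = 1" "\<And>b. b < w \<Longrightarrow> cip I (e b) u = 0"
    "cnrm Q (capply I m u) \<le> cnrm Q (capply I m v0)"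
    "\<And>v. (\<And>b. b < w \<Longrightarrow> cip I (e b) v = 0) \<Longrightarrow> cip I u v = 0 \<Longrightarrow> cip Q (capply I m u) (capply I m v) = 0"
proof -
  define G where "G v = cnrm Q (capply I m v)" for v
  define S where "S = {v. cnrm I v = 1 \<and> (\<forall>b<w. cip I (e b) v = 0)}"
  have v0S: "v0 \<in> S" using v0 by (simp add: S_def)
  have bb: "bdd_below (G ` S)" by (rule bdd_belowI2[of _ 0]) (simp add: G_def)
  define g where "g = Inf (G ` S)"
  have low: "g \<le> G v" if "v \<in> S" for v unfolding g_def using bb that by (rule cINF_lower)
  have "\<exists>v\<in>S. G v < g + 1 / real (Suc n)" for n
    using cINF_less_iff[of S G "g + 1 / real (Suc n)"] bb v0S by (auto simp: g_def)
  then obtain v where v: "\<And>n. v n \<in> S" "\<And>n. G (v n) < g + 1 / real (Suc n)" by metis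
  have "cmod (v n i) \<le> 1" if "i \<in> I" for n i
    using cmod_le_cnrm[OF assms(1) that, of "v n"] v(1)[of n] by (simp add: S_def)
  then obtain r u where r: "strict_mono (r :: nat \<Rightarrow> nat)" "\<And>i. i \<in> I \<Longrightarrow> (\<lambda>n. v (r n) i) \<longlonglongrightarrow> u i"
    using finite_coordinate_subsequence[OF assms(1), of v 1] by blast
  have "(\<lambda>n. cnrm I (v (r n))) \<longlonglongrightarrow> cnrm I u" by (rule tendsto_cnrm[OF r(2)])
  then have u1: "cnrm I u = 1" using v(1) by (simp add: S_def LIMSEQ_const_iff)
  have u2: "cip I (e b) u = 0" if "b < w" for b
  proof -
    have "(\<lambda>n. cip I (e b) (v (r n))) \<longlonglongrightarrow> cip I (e b) u" by (rule tendsto_cip[OF r(2)])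
    then show ?thesis using v(1) that by (simp add: S_def LIMSEQ_const_iff)
  qed
  have uS: "u \<in> S" using u1 u2 by (simp add: S_def)
  have lim: "(\<lambda>n. G (v (r n))) \<longlonglongrightarrow> G u"
    unfolding G_def by (intro tendsto_cnrm tendsto_capply r(2))
  have "G u \<le> g"
  proof (rule LIMSEQ_le[OF lim])
    have "(\<lambda>n. g + 1 / real (Suc n)) \<longlonglongrightarrow> g + 0" by (intro tendsto_intros LIMSEQ_Suc lim_1_over_n)
    then have "(\<lambda>n. g + 1 / real (Suc (r n))) \<longlonglongrightarrow> g + 0"
      using LIMSEQ_subseq_LIMSEQ[OF _ r(1)] by (force simp: o_def)
    then show "(\<lambda>n. g + 1 / real (Suc (r n))) \<longlonglongrightarrow> g" by simp
  qed (use v(2) less_imp_le in blast)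
  then have gu: "G u = g" using low[OF uS] by simp
  have re: "Re (cip Q (capply I m u) (capply I m v)) = 0"
    if v: "\<And>b. b < w \<Longrightarrow> cip I (e b) v = 0" "cip I u v = 0" for v
  proof (rule real_quadratic_nonneg_imp_zero)
    fix t :: real
    define x where "x = (\<lambda>i. u i + of_real t * v i)"
    have nx: "(cnrm I x)\<^sup>2 = 1 + t\<^sup>2 * (cnrm I v)\<^sup>2"
      unfolding x_def cnrm_add_sq cnrm_scale cip_scale_right using u1 that by (simp add: power_mult_distrib)
    then have "0 < (cnrm I x)\<^sup>2" by (smt (verit) zero_le_power2 mult_nonneg_nonneg)
    then have px: "0 < cnrm I x" using cnrm_nonneg[of I x] by (metis less_eq_real_def power_zero_numeral less_irrefl)
    define y where "y = (\<lambda>i. of_real (1 / cnrm I x) * x i)"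
    have "y \<in> S" unfolding S_def y_def mem_Collect_eq cnrm_scale cip_scale_right
      using px u2 v by (simp add: norm_divide x_def cip_add_right cip_scale_right)
    then have "g \<le> G y" by (rule low)
    also have "G y = G x / cnrm I x" unfolding G_def y_def capply_scale cnrm_scale using px by (simp add: norm_divide)
    finally have "g * cnrm I x \<le> G x" using px by (simp add: field_simps)
    moreover have "0 \<le> g" using gu by (simp add: G_def flip: gu)
    ultimately have "(g * cnrm I x)\<^sup>2 \<le> (G x)\<^sup>2" using px by (intro power_mono) auto
    then have le: "g\<^sup>2 * (1 + t\<^sup>2 * (cnrm I v)\<^sup>2) \<le> (G x)\<^sup>2" by (simp add: power_mult_distrib nx)
    have "(G x)\<^sup>2 = g\<^sup>2 + t\<^sup>2 * (G v)\<^sup>2 + 2 * (t * Re (cip Q (capply I m u) (capply I m v)))"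
      unfolding gu[symmetric] G_def x_def capply_add capply_scale cnrm_add_sq cnrm_scale cip_scale_right
      by (simp add: power_mult_distrib)
    then show "0 \<le> 2 * t * Re (cip Q (capply I m u) (capply I m v)) + t\<^sup>2 * ((G v)\<^sup>2 - g\<^sup>2 * (cnrm I v)\<^sup>2)"
      using le by (simp add: algebra_simps)
  qed
  show thesis
  proof (rule that[of u])
    show "cnrm Q (capply I m u) \<le> cnrm Q (capply I m v0)" using low[OF v0S] gu by (simp add: G_def)
    fix v assume v: "\<And>b. b < w \<Longrightarrow> cip I (e b) v = 0" "cip I u v = 0"
    have "Re (cip Q (capply I m u) (capply I m (\<lambda>i. \<i> * v i))) = 0"
      by (rule re) (use v in \<open>simp_all add: cip_scale_right\<close>)
    then have "Im (cip Q (capply I m u) (capply I m v)) = 0"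
      unfolding capply_scale cip_scale_right by simp
    then show "cip Q (capply I m u) (capply I m v) = 0" using re[OF v] by (simp add: complex_eq_iff)
  qed (use u1 u2 in auto)
qed

text \<open>Successive minimisers are the eigenvectors of \<open>m\<^sup>* m\<close> in increasing order. Stop at the first one with value
  above \<open>\<theta>\<close>, which happens within \<open>L\<close> steps. The orthogonality of the images lets the component of \<open>v\<close> outside their
  span be estimated by \<open>m v\<close> alone, with no loss depending on the dimension of the span.\<close>

lemma spectral_subspace:
  fixes m :: "'q \<Rightarrow> 'i \<Rightarrow> complex"
  assumes "finite I" "finite Q" "0 < \<theta>"
    and small: "\<And>w (e :: nat \<Rightarrow> 'i \<Rightarrow> complex). ons I e {..<w} \<Longrightarrow> (\<And>b. b < w \<Longrightarrow> cnrm Q (capply I m (e b)) \<le> \<theta>) \<Longrightarrow> real w \<le> L"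
  obtains w and e :: "nat \<Rightarrow> 'i \<Rightarrow> complex" where "ons I e {..<w}" "real w \<le> L"
    "\<And>v. \<theta> * cnrm I (\<lambda>i. v i - cproj I e {..<w} v i) \<le> cnrm Q (capply I m v)"
proof -
  define Good where "Good w e \<longleftrightarrow> ons I e {..<w} \<and> (\<forall>b<w. cnrm Q (capply I m (e b)) \<le> \<theta>) \<and>
     (\<forall>b<w. \<forall>v. (\<forall>a\<le>b. cip I (e a) v = 0) \<longrightarrow> cip Q (capply I m (e b)) (capply I m v) = 0)"
    for w and e :: "nat \<Rightarrow> 'i \<Rightarrow> complex"
  have "\<exists>w. (\<exists>e. Good w e) \<and> (\<forall>w'. (\<exists>e. Good w' e) \<longrightarrow> w' \<le> w)"
  proof (rule ex_has_greatest_nat[where P = "\<lambda>w. \<exists>e. Good w e" and k = 0 and b = "Suc (nat \<lceil>L\<rceil>)" and f = "\<lambda>w. w"])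
    show "\<exists>e. Good 0 e" by (auto simp: Good_def ons_def)
    show "\<forall>w'. (\<exists>e. Good w' e) \<longrightarrow> w' < Suc (nat \<lceil>L\<rceil>)"
    proof (intro allI impI, elim exE)
      fix w e assume "Good w e"
      then have "real w \<le> L" using small[of e w] by (auto simp: Good_def)
      then show "w < Suc (nat \<lceil>L\<rceil>)" by linarith
    qed
  qed
  then obtain w e where we: "Good w e" and mx: "\<And>w' e'. Good w' e' \<Longrightarrow> w' \<le> w" by blast
  have o: "ons I e {..<w}" and sm: "\<And>b. b < w \<Longrightarrow> cnrm Q (capply I m (e b)) \<le> \<theta>"
    and orth: "\<And>b v. b < w \<Longrightarrow> (\<And>a. a \<le> b \<Longrightarrow> cip I (e a) v = 0) \<Longrightarrow> cip Q (capply I m (e b)) (capply I m v) = 0"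
    using we by (auto simp: Good_def)
  have big: "\<theta> * cnrm I v \<le> cnrm Q (capply I m v)" if v: "\<And>b. b < w \<Longrightarrow> cip I (e b) v = 0" for v
  proof (rule ccontr)
    assume neg: "\<not> ?thesis"
    then have "0 < \<theta> * cnrm I v" using cnrm_nonneg[of Q "capply I m v"] by linarith
    then have pv: "0 < cnrm I v" using \<open>0 < \<theta>\<close> by (simp add: zero_less_mult_iff)
    define v0 where "v0 = (\<lambda>i. of_real (1 / cnrm I v) * v i)"
    have v01: "cnrm I v0 = 1" unfolding v0_def cnrm_scale using pv by (simp add: norm_divide)
    have v02: "cip I (e b) v0 = 0" if "b < w" for b unfolding v0_def cip_scale_right using v that by simp
    have v03: "cnrm Q (capply I m v0) \<le> \<theta>"
      unfolding v0_def capply_scale cnrm_scale using pv neg by (simp add: norm_divide divide_le_eq)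
    obtain u where u: "cnrm I u = 1" "\<And>b. b < w \<Longrightarrow> cip I (e b) u = 0"
      "cnrm Q (capply I m u) \<le> cnrm Q (capply I m v0)"
      "\<And>v. (\<And>b. b < w \<Longrightarrow> cip I (e b) v = 0) \<Longrightarrow> cip I u v = 0 \<Longrightarrow> cip Q (capply I m u) (capply I m v) = 0"
      by (rule ex_minimal_direction[OF assms(1,2) v01 v02, where m = m]) blast+
    define e' where "e' = e(w := u)"
    have "Good (Suc w) e'"
      unfolding Good_def
    proof (intro conjI allI impI)
      have uu: "cip I u u = 1" using u(1) by (simp add: cip_self)
      have eu: "cip I u (e b) = 0" if "b < w" for b using u(2)[OF that] cip_cnj[of I u "e b"] by simp
      show "ons I e' {..<Suc w}"
        unfolding ons_def
      proof (intro ballI)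
        fix a b assume ab: "a \<in> {..<Suc w}" "b \<in> {..<Suc w}"
        show "cip I (e' a) (e' b) = (if a = b then 1 else 0)"
          using ab o uu eu u(2) by (auto simp: e'_def ons_def less_Suc_eq)
      qed
      fix b assume b: "b < Suc w"
      show "cnrm Q (capply I m (e' b)) \<le> \<theta>" using b sm u(3) v03 by (auto simp: e'_def less_Suc_eq)
      fix x assume x: "\<forall>a\<le>b. cip I (e' a) x = 0"
      show "cip Q (capply I m (e' b)) (capply I m x) = 0"
      proof (cases "b = w")
        case True
        have "cip I (e a) x = 0" if "a < w" for a
          using x[rule_format, of a] that True by (auto simp: e'_def)
        moreover have "cip I u x = 0" using x[rule_format, of w] True by (simp add: e'_def)
        ultimately show ?thesis using u(4)[of x] True by (simp add: e'_def)
      next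
        case False
        then have bw: "b < w" using b by simp
        have "cip I (e a) x = 0" if "a \<le> b" for a
          using x[rule_format, of a] that bw by (auto simp: e'_def)
        then show ?thesis using orth[OF bw, of x] bw by (simp add: e'_def)
      qed
    qed
    then show False using mx[of "Suc w" e'] by simp
  qed
  show thesis
  proof (rule that[OF o])
    show "real w \<le> L" using small[OF o sm] .
    fix v
    define p where "p = cproj I e {..<w} v"
    define z where "z = (\<lambda>i. v i - p i)"
    have z0: "cip I (e b) z = 0" if "b < w" for b
      unfolding z_def p_def using cip_ons_residual[OF finite_lessThan o, of b] that by simp
    have "cip Q (capply I m p) (capply I m z) = (\<Sum>a<w. cnj (cip I (e a) v) * cip Q (capply I m (e a)) (capply I m z))"
      unfolding p_def cproj_def capply_sum capply_scale cip_sum_left cip_scale_left ..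
    also have "\<dots> = 0" using orth z0 by (intro sum.neutral) auto
    finally have "(cnrm Q (capply I m (\<lambda>i. p i + z i)))\<^sup>2 = (cnrm Q (capply I m p))\<^sup>2 + (cnrm Q (capply I m z))\<^sup>2"
      unfolding capply_add cnrm_add_sq by simp
    then have "(cnrm Q (capply I m z))\<^sup>2 \<le> (cnrm Q (capply I m v))\<^sup>2" by (simp add: z_def)
    then have "cnrm Q (capply I m z) \<le> cnrm Q (capply I m v)" by (rule power2_le_imp_le) simp
    then show "\<theta> * cnrm I (\<lambda>i. v i - cproj I e {..<w} v i) \<le> cnrm Q (capply I m v)"
      using big[OF z0] by (simp add: z_def p_def)
  qed
qed

section \<open>Noncommutative polynomials as linear combinations of words\<close>

text \<open>Evaluation in the algebra and the linear extension of a function on words to polynomials are both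
  instances.\<close>

definition word_comb :: "('c::zero \<Rightarrow> 'b \<Rightarrow> 'b) \<Rightarrow> ('w \<Rightarrow> 'b::comm_monoid_add) \<Rightarrow> ('w \<Rightarrow>\<^sub>0 'c) \<Rightarrow> 'b" where
  "word_comb smul f p = (\<Sum>w\<in>Poly_Mapping.keys p. smul (Poly_Mapping.lookup p w) (f w))"

lemma word_comb_zero [simp]: "word_comb smul f 0 = 0"
  by (simp add: word_comb_def)

lemma word_comb_superset:
  assumes "vector_space smul" "finite S" "Poly_Mapping.keys p \<subseteq> S"
  shows "word_comb smul f p = (\<Sum>w\<in>S. smul (Poly_Mapping.lookup p w) (f w))"
proof -
  interpret vector_space smul by fact
  show ?thesis unfolding word_comb_def
    by (rule sum.mono_neutral_left) (use assms in \<open>auto simp: in_keys_iff\<close>)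
qed

lemma word_comb_add:
  assumes "vector_space smul"
  shows "word_comb smul f (p + q) = word_comb smul f p + word_comb smul f q"
proof -
  interpret vector_space smul by fact
  let ?S = "Poly_Mapping.keys p \<union> Poly_Mapping.keys q"
  have "word_comb smul f (p + q) = (\<Sum>w\<in>?S. smul (Poly_Mapping.lookup (p + q) w) (f w))"
    by (rule word_comb_superset[OF assms]) (use Poly_Mapping.keys_add[of p q] in auto)
  also have "\<dots> = (\<Sum>w\<in>?S. smul (Poly_Mapping.lookup p w) (f w)) + (\<Sum>w\<in>?S. smul (Poly_Mapping.lookup q w) (f w))"
    by (simp add: lookup_add scale_left_distrib sum.distrib)
  also have "\<dots> = word_comb smul f p + word_comb smul f q"
    by (simp add: word_comb_superset[OF assms, of ?S])
  finally show ?thesis .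
qed

lemma word_comb_sum:
  assumes "vector_space smul"
  shows "word_comb smul f (\<Sum>i\<in>S. p i) = (\<Sum>i\<in>S. word_comb smul f (p i))"
  by (induction S rule: infinite_finite_induct) (auto simp: word_comb_add[OF assms])

lemma word_comb_single:
  assumes "vector_space smul"
  shows "word_comb smul f (Poly_Mapping.single w c) = smul c (f w)"
  by (subst word_comb_superset[OF assms, of "{w}"]) auto

lemma vector_space_complex_mult: "vector_space ((*) :: complex \<Rightarrow> complex \<Rightarrow> complex)"
  by standard (auto simp: algebra_simps)

text \<open>The convolution product over concatenation of words.\<close>

definition nc_mult :: "'n ncpoly \<Rightarrow> 'n ncpoly \<Rightarrow> 'n ncpoly" where
  "nc_mult p q = (\<Sum>v\<in>Poly_Mapping.keys p. \<Sum>w\<in>Poly_Mapping.keys q.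
     Poly_Mapping.single (v @ w) (Poly_Mapping.lookup p v * Poly_Mapping.lookup q w))"

definition nc_star :: "'n ncpoly \<Rightarrow> 'n ncpoly" where
  "nc_star p = (\<Sum>v\<in>Poly_Mapping.keys p. Poly_Mapping.single (rev v) (cnj (Poly_Mapping.lookup p v)))"

definition nc_scale :: "complex \<Rightarrow> 'n ncpoly \<Rightarrow> 'n ncpoly" where
  "nc_scale c p = nc_mult (Poly_Mapping.single [] c) p"

abbreviation cword_comb :: "('w \<Rightarrow> complex) \<Rightarrow> ('w \<Rightarrow>\<^sub>0 complex) \<Rightarrow> complex" where
  "cword_comb \<equiv> word_comb (*)"

abbreviation word_prod :: "('n \<Rightarrow> 'a::unital_cstar_algebra) \<Rightarrow> 'n list \<Rightarrow> 'a" where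
  "word_prod x w \<equiv> prod_list (map x w)"

lemma ncpoly_eval_eq: "ncpoly_eval p x = word_comb scaleC (word_prod x) p"
  by (simp add: ncpoly_eval_def word_comb_def)

lemma cword_comb_mult:
  "cword_comb f (nc_mult p q) = (\<Sum>v\<in>Poly_Mapping.keys p. \<Sum>w\<in>Poly_Mapping.keys q.
     Poly_Mapping.lookup p v * Poly_Mapping.lookup q w * f (v @ w))"
  by (simp add: nc_mult_def word_comb_sum[OF vector_space_complex_mult] word_comb_single[OF vector_space_complex_mult])

lemma cword_comb_star:
  "cword_comb f (nc_star p) = (\<Sum>v\<in>Poly_Mapping.keys p. cnj (Poly_Mapping.lookup p v) * f (rev v))"
  by (simp add: nc_star_def word_comb_sum[OF vector_space_complex_mult] word_comb_single[OF vector_space_complex_mult])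

lemma cword_comb_star_mult:
  "cword_comb f (nc_mult (nc_star p) q) = (\<Sum>v\<in>Poly_Mapping.keys p. \<Sum>w\<in>Poly_Mapping.keys q.
     cnj (Poly_Mapping.lookup p v) * Poly_Mapping.lookup q w * f (rev v @ w))"
proof -
  have "cword_comb f (nc_mult r q) = cword_comb (\<lambda>v. \<Sum>w\<in>Poly_Mapping.keys q. Poly_Mapping.lookup q w * f (v @ w)) r" for r
    unfolding cword_comb_mult by (simp add: word_comb_def sum_distrib_left mult.assoc)
  then show ?thesis by (simp add: cword_comb_star sum_distrib_left mult.assoc)
qed

lemma ncpoly_eval_add: "ncpoly_eval (p + q) x = ncpoly_eval p x + ncpoly_eval q x"
  by (simp add: ncpoly_eval_eq word_comb_add[OF complex_vector.vector_space_axioms])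

lemma ncpoly_eval_single: "ncpoly_eval (Poly_Mapping.single w c) x = c *\<^sub>C word_prod x w"
  by (simp add: ncpoly_eval_eq word_comb_single[OF complex_vector.vector_space_axioms])

lemma ncpoly_eval_mult: "ncpoly_eval (nc_mult p q) x = ncpoly_eval p x * ncpoly_eval q x"
proof -
  have "ncpoly_eval (nc_mult p q) x = (\<Sum>v\<in>Poly_Mapping.keys p. \<Sum>w\<in>Poly_Mapping.keys q.
     (Poly_Mapping.lookup p v * Poly_Mapping.lookup q w) *\<^sub>C (word_prod x v * word_prod x w))"
    by (simp add: ncpoly_eval_eq nc_mult_def word_comb_sum[OF complex_vector.vector_space_axioms] word_comb_single[OF complex_vector.vector_space_axioms])
  also have "\<dots> = (\<Sum>v\<in>Poly_Mapping.keys p. Poly_Mapping.lookup p v *\<^sub>C word_prod x v) *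
     (\<Sum>w\<in>Poly_Mapping.keys q. Poly_Mapping.lookup q w *\<^sub>C word_prod x w)"
    by (simp add: sum_product scaleC_mult_left scaleC_mult_right scaleC_scaleC mult.commute)
  finally show ?thesis by (simp add: ncpoly_eval_def)
qed

lemma ncpoly_eval_scale: "ncpoly_eval (nc_scale c p) x = c *\<^sub>C ncpoly_eval p x"
  by (simp add: nc_scale_def ncpoly_eval_mult ncpoly_eval_single scaleC_mult_left)

lemma cword_comb_scale: "cword_comb f (nc_scale c p) = c * cword_comb f p"
proof (cases "c = 0")
  case False
  then show ?thesis
    unfolding nc_scale_def cword_comb_mult by (simp add: word_comb_def sum_distrib_left mult.assoc)
qed (simp add: nc_scale_def cword_comb_mult)

section \<open>Tracial states from word moments\<close>

lemma cstar_zero [simp]: "cstar (0 :: 'a::unital_cstar_algebra) = 0"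
  using cstar_add[of "0 :: 'a" 0] by simp

lemma cstar_sum: "cstar (\<Sum>i\<in>S. f i) = (\<Sum>i\<in>S. cstar (f i :: 'a::unital_cstar_algebra))"
  by (induction S rule: infinite_finite_induct) (auto simp: cstar_add)

lemma cstar_one [simp]: "cstar (1 :: 'a::unital_cstar_algebra) = 1"
  by (metis cstar_cstar cstar_mult mult.right_neutral)

lemma scaleC_one [simp]: "1 *\<^sub>C a = (a :: 'a::unital_cstar_algebra)"
  by (rule complex_vector.scale_one)

lemma cstar_diff: "cstar (a - b) = cstar a - cstar (b :: 'a::unital_cstar_algebra)"
  by (metis add_diff_cancel_right' cstar_add diff_add_cancel)

lemma norm_cstar: "norm (cstar a) = norm (a :: 'a::unital_cstar_algebra)"
proof -
  have le: "norm a \<le> norm (cstar a)" for a :: 'a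
  proof (cases "a = 0")
    case False
    have "norm a * norm a \<le> norm (cstar a) * norm a"
      using norm_cstar_mult_self[of a] norm_mult_ineq[of "cstar a" a] by (simp add: power2_eq_square)
    then show ?thesis using False by simp
  qed simp
  show ?thesis using le[of a] le[of "cstar a"] by (simp add: cstar_cstar)
qed

lemma tendsto_cstar [tendsto_intros]: "(f \<longlongrightarrow> a) F \<Longrightarrow> ((\<lambda>n. cstar (f n)) \<longlongrightarrow> cstar (a :: 'a::unital_cstar_algebra)) F"
  unfolding tendsto_iff dist_norm by (simp add: norm_cstar flip: cstar_diff)

lemma tendsto_scaleC [tendsto_intros]: "(f \<longlongrightarrow> a) F \<Longrightarrow> ((\<lambda>n. c *\<^sub>C f n) \<longlongrightarrow> c *\<^sub>C (a :: 'a::unital_cstar_algebra)) F"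
proof -
  assume f: "(f \<longlongrightarrow> a) F"
  have "((\<lambda>n. cmod c * norm (f n - a)) \<longlongrightarrow> cmod c * 0) F"
    using f by (intro tendsto_intros) (simp add: tendsto_norm_zero LIM_zero)
  then have "((\<lambda>n. norm (c *\<^sub>C f n - c *\<^sub>C a)) \<longlongrightarrow> 0) F"
    by (simp add: norm_scaleC flip: complex_vector.scale_right_diff_distrib)
  then show ?thesis by (simp add: tendsto_norm_zero_iff LIM_zero_iff)
qed

lemma tendsto_scaleC_left: "(c \<longlongrightarrow> l) F \<Longrightarrow> ((\<lambda>n. c n *\<^sub>C (a :: 'a::unital_cstar_algebra)) \<longlongrightarrow> l *\<^sub>C a) F"
proof -
  assume f: "(c \<longlongrightarrow> l) F"
  have "((\<lambda>n. cmod (c n - l) * norm a) \<longlongrightarrow> 0 * norm a) F"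
    using f by (intro tendsto_intros) (simp add: tendsto_norm_zero LIM_zero)
  then have "((\<lambda>n. norm (c n *\<^sub>C a - l *\<^sub>C a)) \<longlongrightarrow> 0) F"
    by (simp add: norm_scaleC flip: complex_vector.scale_left_diff_distrib)
  then show ?thesis by (simp add: tendsto_norm_zero_iff LIM_zero_iff)
qed

lemma ncpoly_eval_star:
  assumes "\<And>i. cstar (x i) = x i"
  shows "ncpoly_eval (nc_star p) x = cstar (ncpoly_eval p x)"
proof -
  have w: "cstar (word_prod x w) = word_prod x (rev w)" for w
    using assms by (induction w) (auto simp: cstar_mult)
  show ?thesis
    by (simp add: ncpoly_eval_eq nc_star_def word_comb_sum[OF complex_vector.vector_space_axioms] word_comb_single[OF complex_vector.vector_space_axioms])
      (simp add: word_comb_def cstar_sum cstar_scaleC w)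
qed

text \<open>The closure of the set of values of polynomials is a closed *-subalgebra containing the generators.\<close>

lemma ncpoly_eval_dense:
  fixes x :: "'n \<Rightarrow> 'a::unital_cstar_algebra"
  assumes sa: "\<And>i. cstar (x i) = x i" and gen: "generates_cstar (range x)"
  obtains p where "(\<lambda>n. ncpoly_eval (p n) x) \<longlonglongrightarrow> a"
proof -
  let ?Q = "range (\<lambda>p. ncpoly_eval p x)"
  have seq: "a \<in> closure ?Q \<longleftrightarrow> (\<exists>p. (\<lambda>n. ncpoly_eval (p n) x) \<longlonglongrightarrow> a)" for a
  proof
    assume "a \<in> closure ?Q"
    then obtain f where f: "\<And>n. f n \<in> ?Q" "f \<longlonglongrightarrow> a" unfolding closure_sequential by blast
    then have "\<forall>n. \<exists>p. f n = ncpoly_eval p x" by blast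
    then obtain p where "\<And>n. f n = ncpoly_eval (p n) x" by metis
    then show "\<exists>p. (\<lambda>n. ncpoly_eval (p n) x) \<longlonglongrightarrow> a" using f(2) by (intro exI[of _ p]) presburger
  next
    assume "\<exists>p. (\<lambda>n. ncpoly_eval (p n) x) \<longlonglongrightarrow> a"
    then obtain p where "(\<lambda>n. ncpoly_eval (p n) x) \<longlonglongrightarrow> a" ..
    then show "a \<in> closure ?Q" unfolding closure_sequential
      by (intro exI[of _ "\<lambda>n. ncpoly_eval (p n) x"]) auto
  qed
  have "closed_star_subalgebra (closure ?Q)"
    unfolding closed_star_subalgebra_def complex_vector.subspace_def
  proof (intro conjI ballI allI)
    have "ncpoly_eval 0 x = 0" by (simp add: ncpoly_eval_eq)
    then show "0 \<in> closure ?Q" using closure_subset[of ?Q] by (metis rangeI subsetD)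
    have "ncpoly_eval (Poly_Mapping.single [] 1) x = 1" by (simp add: ncpoly_eval_single)
    then show "1 \<in> closure ?Q" using closure_subset[of ?Q] by (metis rangeI subsetD)
    show "closed (closure ?Q)" by simp
    fix a assume "a \<in> closure ?Q"
    then obtain p where p: "(\<lambda>n. ncpoly_eval (p n) x) \<longlonglongrightarrow> a" using seq by blast
    show "cstar a \<in> closure ?Q"
      unfolding seq by (rule exI[of _ "\<lambda>n. nc_star (p n)"]) (auto simp: ncpoly_eval_star[OF sa] intro: tendsto_intros p)
    show "c *\<^sub>C a \<in> closure ?Q" for c
      unfolding seq by (rule exI[of _ "\<lambda>n. nc_scale c (p n)"]) (auto simp: ncpoly_eval_scale intro: tendsto_intros p)
    fix b assume "b \<in> closure ?Q"
    then obtain q where q: "(\<lambda>n. ncpoly_eval (q n) x) \<longlonglongrightarrow> b" using seq by blast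
    show "a * b \<in> closure ?Q"
      unfolding seq by (rule exI[of _ "\<lambda>n. nc_mult (p n) (q n)"]) (auto simp: ncpoly_eval_mult intro: tendsto_intros p q)
    show "a + b \<in> closure ?Q"
      unfolding seq by (rule exI[of _ "\<lambda>n. p n + q n"]) (auto simp: ncpoly_eval_add intro: tendsto_intros p q)
  qed
  moreover have "range x \<subseteq> closure ?Q"
  proof
    fix y assume "y \<in> range x"
    then obtain i where "y = x i" by blast
    then have "ncpoly_eval (Poly_Mapping.single [i] 1) x = y" by (simp add: ncpoly_eval_single)
    then show "y \<in> closure ?Q" using closure_subset[of ?Q] by (metis rangeI subsetD)
  qed
  ultimately have "closure ?Q = UNIV" using gen by (simp add: generates_cstar_def)
  then show thesis using seq[of a] that by auto
qed

text \<open>The bound makes the value of \<open>L\<close> at a polynomial depend only on its value in the algebra, and Lipschitz in it.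
  Hence \<open>L\<close> extends to the closure, and linearity, positivity and the trace property pass to limits.\<close>

lemma ex_tracial_state_of_word_functional:
  fixes x :: "'n \<Rightarrow> 'a::unital_cstar_algebra" and L :: "'n list \<Rightarrow> complex"
  assumes sa: "\<And>i. cstar (x i) = x i" and gen: "generates_cstar (range x)"
    and L1: "L [] = 1"
    and bd: "\<And>p. cmod (cword_comb L p) \<le> norm (ncpoly_eval p x)"
    and pos: "\<And>p. 0 \<le> cword_comb L (nc_mult (nc_star p) p)"
    and tr: "\<And>i w. L (i # w) = L (w @ [i])"
  shows "\<exists>\<tau>. tracial_state \<tau> \<and> (\<forall>w. \<tau> (word_prod x w) = L w) \<and> (\<forall>a. cmod (\<tau> a) \<le> norm a)"
proof -
  let ?e = "\<lambda>p. ncpoly_eval p x"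
  let ?l = "\<lambda>p. cword_comb L p"
  have diff: "cmod (?l p - ?l q) \<le> norm (?e p - ?e q)" for p q
  proof -
    have "?l (p + nc_scale (-1) q) = ?l p - ?l q" by (simp add: word_comb_add[OF vector_space_complex_mult] cword_comb_scale)
    moreover have "?e (p + nc_scale (-1) q) = ?e p - ?e q" by (simp add: ncpoly_eval_add ncpoly_eval_scale)
    ultimately show ?thesis using bd[of "p + nc_scale (-1) q"] by simp
  qed
  have "\<forall>a. \<exists>p. (\<lambda>n. ?e (p n)) \<longlonglongrightarrow> a" using ncpoly_eval_dense[OF sa gen] by metis
  then obtain P where P: "\<And>a. (\<lambda>n. ?e (P a n)) \<longlonglongrightarrow> a" by metis
  have conv: "convergent (\<lambda>n. ?l (P a n))" for a
  proof -
    have "Cauchy (\<lambda>n. ?e (P a n))" using P[of a] LIMSEQ_imp_Cauchy by blast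
    then have "Cauchy (\<lambda>n. ?l (P a n))"
      unfolding Cauchy_def dist_norm using diff by (meson le_less_trans)
    then show ?thesis by (rule Cauchy_convergent)
  qed
  define \<tau> where "\<tau> a = lim (\<lambda>n. ?l (P a n))" for a
  have lim: "(\<lambda>n. ?l (P a n)) \<longlonglongrightarrow> \<tau> a" for a
    using conv[of a] by (simp add: \<tau>_def convergent_LIMSEQ_iff)
  have near: "cmod (\<tau> a - ?l p) \<le> norm (a - ?e p)" for a p
  proof (rule LIMSEQ_le)
    show "(\<lambda>n. cmod (?l (P a n) - ?l p)) \<longlonglongrightarrow> cmod (\<tau> a - ?l p)" by (intro tendsto_intros lim)
    show "(\<lambda>n. norm (?e (P a n) - ?e p)) \<longlonglongrightarrow> norm (a - ?e p)" by (intro tendsto_intros P)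
  qed (use diff in blast)
  have val: "\<tau> (?e p) = ?l p" for p using near[of "?e p" p] by simp
  have lip: "cmod (\<tau> a - \<tau> b) \<le> norm (a - b)" for a b
  proof (rule LIMSEQ_le)
    show "(\<lambda>n. cmod (\<tau> a - ?l (P b n))) \<longlonglongrightarrow> cmod (\<tau> a - \<tau> b)" by (intro tendsto_intros lim)
    show "(\<lambda>n. norm (a - ?e (P b n))) \<longlonglongrightarrow> norm (a - b)" by (intro tendsto_intros P)
  qed (use near in blast)
  have cont: "(\<lambda>n. \<tau> (f n)) \<longlonglongrightarrow> \<tau> a" if "f \<longlonglongrightarrow> a" for f a
  proof (rule LIM_zero_cancel, rule tendsto_0_le[of "\<lambda>n. f n - a" _ _ 1])
    show "(\<lambda>n. f n - a) \<longlonglongrightarrow> 0" using that by (rule LIM_zero)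
  qed (use lip in auto)
  have add: "\<tau> (a + b) = \<tau> a + \<tau> b" for a b
  proof (rule LIMSEQ_unique)
    show "(\<lambda>n. \<tau> (?e (P a n) + ?e (P b n))) \<longlonglongrightarrow> \<tau> (a + b)" by (intro cont tendsto_intros P)
    have "(\<lambda>n. ?l (P a n) + ?l (P b n)) \<longlonglongrightarrow> \<tau> a + \<tau> b" by (intro tendsto_intros lim)
    then show "(\<lambda>n. \<tau> (?e (P a n) + ?e (P b n))) \<longlonglongrightarrow> \<tau> a + \<tau> b"
      by (simp add: val word_comb_add[OF vector_space_complex_mult] flip: ncpoly_eval_add)
  qed
  have scale: "\<tau> (c *\<^sub>C a) = c * \<tau> a" for c a
  proof (rule LIMSEQ_unique)
    show "(\<lambda>n. \<tau> (c *\<^sub>C ?e (P a n))) \<longlonglongrightarrow> \<tau> (c *\<^sub>C a)" by (intro cont tendsto_intros P)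
    have "(\<lambda>n. c * ?l (P a n)) \<longlonglongrightarrow> c * \<tau> a" by (intro tendsto_intros lim)
    then show "(\<lambda>n. \<tau> (c *\<^sub>C ?e (P a n))) \<longlonglongrightarrow> c * \<tau> a"
      by (simp add: val cword_comb_scale flip: ncpoly_eval_scale)
  qed
  have Lcomm: "L (v @ w) = L (w @ v)" for v w
  proof (induction v arbitrary: w)
    case (Cons i v)
    have "L ((i # v) @ w) = L (v @ (w @ [i]))" using tr[of i "v @ w"] by simp
    also have "\<dots> = L ((w @ [i]) @ v)" by (rule Cons.IH)
    finally show ?case by simp
  qed simp
  have lcomm: "?l (nc_mult p q) = ?l (nc_mult q p)" for p q
    unfolding cword_comb_mult by (subst sum.swap) (simp add: mult.commute Lcomm)
  have trace: "\<tau> (a * b) = \<tau> (b * a)" for a b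
  proof (rule LIMSEQ_unique)
    show "(\<lambda>n. \<tau> (?e (P a n) * ?e (P b n))) \<longlonglongrightarrow> \<tau> (a * b)" by (intro cont tendsto_intros P)
    have "(\<lambda>n. \<tau> (?e (P b n) * ?e (P a n))) \<longlonglongrightarrow> \<tau> (b * a)" by (intro cont tendsto_intros P)
    then show "(\<lambda>n. \<tau> (?e (P a n) * ?e (P b n))) \<longlonglongrightarrow> \<tau> (b * a)"
      by (simp add: val lcomm flip: ncpoly_eval_mult)
  qed
  have positive: "0 \<le> \<tau> (cstar a * a)" for a
  proof -
    have l: "(\<lambda>n. \<tau> (cstar (?e (P a n)) * ?e (P a n))) \<longlonglongrightarrow> \<tau> (cstar a * a)"
      by (intro cont tendsto_intros P)
    have p: "0 \<le> \<tau> (cstar (?e (P a n)) * ?e (P a n))" for n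
      using pos[of "P a n"] by (simp add: val flip: ncpoly_eval_star[OF sa] ncpoly_eval_mult)
    have "0 \<le> Re (\<tau> (cstar a * a))"
      by (rule LIMSEQ_le_const[OF tendsto_Re[OF l]]) (use p in \<open>auto simp: less_eq_complex_def\<close>)
    moreover have "Im (\<tau> (cstar a * a)) = 0"
    proof (rule LIMSEQ_unique[OF tendsto_Im[OF l]])
      show "(\<lambda>n. Im (\<tau> (cstar (?e (P a n)) * ?e (P a n)))) \<longlonglongrightarrow> 0"
        using p by (simp add: less_eq_complex_def)
    qed
    ultimately show ?thesis by (simp add: less_eq_complex_def)
  qed
  have word: "\<tau> (word_prod x w) = L w" for w
    using val[of "Poly_Mapping.single w 1"] by (simp add: ncpoly_eval_single word_comb_single[OF vector_space_complex_mult])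
  have "tracial_state \<tau>"
    unfolding tracial_state_def using add scale positive trace word[of "[]"] L1 by simp
  moreover have "cmod (\<tau> a) \<le> norm a" for a
    using lip[of a 0] scale[of 0 0] by simp
  ultimately show ?thesis using word by blast
qed

text \<open>Rounding the coefficients gives rational polynomials supported on the same finite set of words.\<close>

lemma rational_approximation:
  fixes x :: "'n \<Rightarrow> 'a::unital_cstar_algebra" and p :: "'n ncpoly"
  obtains q where "\<And>n. q n \<in> rational_ncpolys" "(\<lambda>n. ncpoly_eval (q n) x) \<longlonglongrightarrow> ncpoly_eval p x"
    "\<And>f. (\<lambda>n. cword_comb f (q n)) \<longlonglongrightarrow> cword_comb f p"
proof -
  define fl where "fl n r = of_int \<lfloor>real (Suc n) * r\<rfloor> / real (Suc n)" for n r
  have fl: "(\<lambda>n. fl n r) \<longlonglongrightarrow> r" for r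
  proof (rule LIM_zero_cancel, rule tendsto_0_le[of "\<lambda>n. 1 / real (Suc n)" _ _ 1])
    show "(\<lambda>n. 1 / real (Suc n)) \<longlonglongrightarrow> 0" by (intro LIMSEQ_Suc lim_1_over_n)
    have "norm (fl n r - r) \<le> norm (1 / real (Suc n)) * 1" for n
    proof -
      have "fl n r - r = (of_int \<lfloor>real (Suc n) * r\<rfloor> - real (Suc n) * r) / real (Suc n)"
        by (simp add: fl_def field_simps)
      moreover have "\<bar>of_int \<lfloor>real (Suc n) * r\<rfloor> - real (Suc n) * r\<bar> \<le> 1" by linarith
      ultimately show ?thesis by (simp add: divide_right_mono)
    qed
    then show "\<forall>\<^sub>F n in sequentially. norm (fl n r - r) \<le> norm (1 / real (Suc n)) * 1" by simp
  qed
  define g where "g n z = Complex (fl n (Re z)) (fl n (Im z))" for n z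
  have g0: "g n 0 = 0" for n by (simp add: g_def fl_def complex_eq_iff)
  have g: "(\<lambda>n. g n z) \<longlonglongrightarrow> z" for z
    using tendsto_Complex[OF fl[of "Re z"] fl[of "Im z"]] by (simp add: g_def)
  define q where "q n = Poly_Mapping.map (g n) p" for n
  have look: "Poly_Mapping.lookup (q n) w = g n (Poly_Mapping.lookup p w)" for n w
    by (simp add: q_def Poly_Mapping.map.rep_eq g0 when_def)
  have keys: "Poly_Mapping.keys (q n) \<subseteq> Poly_Mapping.keys p" for n
    by (auto simp: in_keys_iff look g0)
  show thesis
  proof (rule that[of q])
    have "fl n r \<in> \<rat>" for n r by (simp add: fl_def)
    then show "q n \<in> rational_ncpolys" for n by (simp add: rational_ncpolys_def look g_def)
    show "(\<lambda>n. ncpoly_eval (q n) x) \<longlonglongrightarrow> ncpoly_eval p x"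
      unfolding ncpoly_eval_eq word_comb_superset[OF complex_vector.vector_space_axioms finite_keys keys]
        word_comb_def[of _ _ p] look
      by (intro tendsto_sum tendsto_scaleC_left g)
    show "(\<lambda>n. cword_comb f (q n)) \<longlonglongrightarrow> cword_comb f p" for f
      unfolding word_comb_superset[OF vector_space_complex_mult finite_keys keys]
        word_comb_def[of _ _ p] look
      by (intro tendsto_intros g)
  qed
qed

text \<open>Every subsequence of the moments has a further subsequence that converges on all words, the words being
  countable. Its limit extends to a tracial state, which must be \<open>\<tau>\<close>. The norm bound is only assumed for
  rational polynomials, and passes to all polynomials in the limit. Since \<open>\<tau>\<close> arises as such an extension, it is
  contractive as well.\<close>

lemma moments_converge_to_unique_trace:
  fixes x :: "'n::finite \<Rightarrow> 'a::unital_cstar_algebra" and m :: "nat \<Rightarrow> 'n list \<Rightarrow> complex"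
  assumes sa: "\<And>i. cstar (x i) = x i" and gen: "generates_cstar (range x)"
    and uniq: "\<exists>!\<tau> :: 'a \<Rightarrow> complex. tracial_state \<tau>" and \<tau>: "tracial_state \<tau>"
    and m1: "\<And>s. m s [] = 1"
    and mb: "\<And>s w. cmod (m s w) \<le> K ^ length w"
    and bd: "\<And>p. p \<in> rational_ncpolys \<Longrightarrow> \<exists>N. N \<longlonglongrightarrow> norm (ncpoly_eval p x) \<and> (\<forall>\<^sub>F s in sequentially. cmod (cword_comb (m s) p) \<le> N s)"
    and pos: "\<And>s p. 0 \<le> cword_comb (m s) (nc_mult (nc_star p) p)"
    and tr: "\<And>i w. (\<lambda>s. m s (i # w) - m s (w @ [i])) \<longlonglongrightarrow> 0"
  shows "(\<lambda>s. m s w) \<longlonglongrightarrow> \<tau> (word_prod x w)" and "cmod (\<tau> a) \<le> norm a"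
proof -
  have sub: "\<exists>k. strict_mono k \<and> (\<forall>w. (\<lambda>s. m (r (k s)) w) \<longlonglongrightarrow> \<tau> (word_prod x w)) \<and> (\<forall>a. cmod (\<tau> a) \<le> norm a)"
    if r: "strict_mono r" for r :: "nat \<Rightarrow> nat"
  proof -
    \<comment> \<open>Scaling by the length of the word makes the moments uniformly bounded, so that a diagonal subsequence exists.\<close>
    define f where "f s w = m (r s) w / of_real ((\<bar>K\<bar> + 1) ^ length w)" for s w
    have f1: "cmod (f s w) \<le> 1" for s w
    proof -
      have "cmod (m (r s) w) \<le> (\<bar>K\<bar> + 1) ^ length w"
        by (rule order_trans[OF mb]) (metis abs_ge_self abs_le_D1 abs_of_nonneg add.commute add_increasing le_add_same_cancel1 order_trans power_abs power_mono abs_ge_zero zero_le_one)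
      then show ?thesis by (simp add: f_def norm_divide norm_power divide_le_eq)
    qed
    obtain k where k: "strict_mono (k :: nat \<Rightarrow> nat)" "\<And>w. \<exists>l. (\<lambda>s. f (k s) w) \<longlonglongrightarrow> l"
    proof (rule function_convergent_subsequence[of "UNIV :: 'n list set" f 1])
      show "countable (UNIV :: 'n list set)" by (rule countableI_type)
    qed (use f1 in auto)
    then obtain l where l: "\<And>w. (\<lambda>s. f (k s) w) \<longlonglongrightarrow> l w" by metis
    define L where "L w = l w * of_real ((\<bar>K\<bar> + 1) ^ length w)" for w
    have lim: "(\<lambda>s. m (r (k s)) w) \<longlonglongrightarrow> L w" for w
    proof -
      have "(\<lambda>s. f (k s) w * of_real ((\<bar>K\<bar> + 1) ^ length w)) \<longlonglongrightarrow> L w"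
        unfolding L_def by (intro tendsto_intros l)
      moreover have "\<bar>K\<bar> + 1 \<noteq> 0" by linarith
      then have "f (k s) w * of_real ((\<bar>K\<bar> + 1) ^ length w) = m (r (k s)) w" for s
        by (simp add: f_def flip: of_real_power)
      ultimately show ?thesis by simp
    qed
    have rk: "strict_mono (r \<circ> k)" using r k(1) by (rule strict_mono_o)
    have limp: "(\<lambda>s. cword_comb (m (r (k s))) p) \<longlonglongrightarrow> cword_comb L p" for p
      unfolding word_comb_def by (intro tendsto_intros lim)
    have bd1: "cmod (cword_comb L p) \<le> norm (ncpoly_eval p x)" if pr: "p \<in> rational_ncpolys" for p
    proof -
      obtain N where N: "N \<longlonglongrightarrow> norm (ncpoly_eval p x)" "\<forall>\<^sub>F s in sequentially. cmod (cword_comb (m s) p) \<le> N s"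
        using bd[OF pr] by blast
      have N': "(\<lambda>s. N (r (k s))) \<longlonglongrightarrow> norm (ncpoly_eval p x)"
        using LIMSEQ_subseq_LIMSEQ[OF N(1) rk] by (simp add: o_def)
      have "\<forall>\<^sub>F s in sequentially. cmod (cword_comb (m (r (k s))) p) \<le> N (r (k s))"
        using eventually_subseq[OF rk N(2)] by simp
      then show ?thesis using tendsto_le[OF _ N' tendsto_norm[OF limp]] by simp
    qed
    have bd2: "cmod (cword_comb L p) \<le> norm (ncpoly_eval p x)" for p
    proof -
      obtain q where q: "\<And>n. q n \<in> rational_ncpolys" "(\<lambda>n. ncpoly_eval (q n) x) \<longlonglongrightarrow> ncpoly_eval p x"
        "\<And>f. (\<lambda>n. cword_comb f (q n)) \<longlonglongrightarrow> cword_comb f p" by (rule rational_approximation[of x p]) (rule that)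
      show ?thesis by (rule LIMSEQ_le[OF tendsto_norm[OF q(3)] tendsto_norm[OF q(2)]]) (use bd1 q(1) in blast)
    qed
    have "L [] = 1" using lim[of "[]"] m1 by (simp add: LIMSEQ_const_iff)
    moreover have "0 \<le> cword_comb L (nc_mult (nc_star p) p)" for p
    proof -
      let ?p = "nc_mult (nc_star p) p"
      have "0 \<le> Re (cword_comb L ?p)"
        by (rule LIMSEQ_le_const[OF tendsto_Re[OF limp[of ?p]]]) (use pos in \<open>auto simp: less_eq_complex_def\<close>)
      moreover have "Im (cword_comb L ?p) = 0"
        by (rule LIMSEQ_unique[OF tendsto_Im[OF limp[of ?p]]]) (use pos in \<open>simp add: less_eq_complex_def\<close>)
      ultimately show ?thesis by (simp add: less_eq_complex_def)
    qed
    moreover have "L (i # w) = L (w @ [i])" for i w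
    proof -
      have "(\<lambda>s. m (r (k s)) (i # w) - m (r (k s)) (w @ [i])) \<longlonglongrightarrow> L (i # w) - L (w @ [i])"
        by (intro tendsto_intros lim)
      moreover have "(\<lambda>s. m (r (k s)) (i # w) - m (r (k s)) (w @ [i])) \<longlonglongrightarrow> 0"
        using LIMSEQ_subseq_LIMSEQ[OF tr[of i w] rk] by (simp add: o_def)
      ultimately show ?thesis using LIMSEQ_unique by fastforce
    qed
    ultimately obtain \<tau>' where "tracial_state \<tau>'" "\<forall>w. \<tau>' (word_prod x w) = L w" "\<forall>a. cmod (\<tau>' a) \<le> norm a"
      using ex_tracial_state_of_word_functional[OF sa gen _ bd2] by blast
    moreover have "\<tau>' = \<tau>" using uniq \<tau> calculation(1) by blast
    ultimately show ?thesis using k(1) lim by auto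
  qed
  show "cmod (\<tau> a) \<le> norm a" using sub[OF strict_mono_id] by blast
  show "(\<lambda>s. m s w) \<longlonglongrightarrow> \<tau> (word_prod x w)"
  proof (rule ccontr)
    assume "\<not> ?thesis"
    then obtain e where e: "e > 0" "\<And>N. \<exists>s\<ge>N. e \<le> dist (m s w) (\<tau> (word_prod x w))"
      unfolding lim_sequentially by (meson not_less)
    then have "\<exists>\<^sub>F s in sequentially. e \<le> dist (m s w) (\<tau> (word_prod x w))"
      by (auto simp: frequently_sequentially)
    then obtain r :: "nat \<Rightarrow> nat" where r: "strict_mono r" "\<And>s. e \<le> dist (m (r s) w) (\<tau> (word_prod x w))"
      using infinite_enumerate[of "{s. e \<le> dist (m s w) (\<tau> (word_prod x w))}"]
      by (auto simp: frequently_cofinite[symmetric] cofinite_eq_sequentially[symmetric])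
    obtain k where "strict_mono k" "(\<lambda>s. m (r (k s)) w) \<longlonglongrightarrow> \<tau> (word_prod x w)" using sub[OF r(1)] by blast
    then have "\<forall>\<^sub>F s in sequentially. dist (m (r (k s)) w) (\<tau> (word_prod x w)) < e" using e(1) by (simp add: tendsto_iff)
    then show False using r(2) by (metis (mono_tags, lifting) eventually_sequentially not_less order_refl)
  qed
qed

section \<open>Orthonormal systems for a faithful trace\<close>

lemma tracial_state_diff: "tracial_state \<tau> \<Longrightarrow> \<tau> (a - b) = \<tau> a - \<tau> b"
  unfolding tracial_state_def by (metis add_diff_cancel_right' diff_add_cancel)

lemma tracial_state_sum: "tracial_state \<tau> \<Longrightarrow> \<tau> (\<Sum>i\<in>S. f i) = (\<Sum>i\<in>S. \<tau> (f i))"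
proof (induction S rule: infinite_finite_induct)
  case (infinite S)
  then show ?case using tracial_state_diff[of \<tau> 0 0] by simp
next
  case empty
  then show ?case using tracial_state_diff[of \<tau> 0 0] by simp
next
  case (insert a S)
  have "\<tau> (f a + sum f S) = \<tau> (f a) + \<tau> (sum f S)" using insert.prems by (auto simp: tracial_state_def)
  then show ?case using insert by simp
qed

text \<open>The Cauchy-Schwarz argument in the degenerate case: \<open>\<tau> ((y + c a)\<^sup>* (y + c a))\<close> has no term quadratic in \<open>c\<close>
  and is nonnegative, so its linear part vanishes.\<close>

lemma tracial_state_null:
  assumes \<tau>: "tracial_state \<tau>" and a: "\<tau> (cstar a * a) = 0"
  shows "\<tau> (b * a) = 0"
proof -
  have add: "\<And>a b. \<tau> (a + b) = \<tau> a + \<tau> b" and sc: "\<And>c a. \<tau> (c *\<^sub>C a) = c * \<tau> a"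
    and pos: "\<And>a. 0 \<le> \<tau> (cstar a * a)" using \<tau> by (auto simp: tracial_state_def)
  define y where "y = cstar b"
  define z where "z = \<tau> (cstar y * a)"
  define z' where "z' = \<tau> (cstar a * y)"
  have exp: "\<tau> (cstar (y + c *\<^sub>C a) * (y + c *\<^sub>C a)) = \<tau> (cstar y * y) + c * z + cnj c * z'" for c
    by (simp add: z_def z'_def cstar_add cstar_scaleC algebra_simps add sc a scaleC_mult_left scaleC_mult_right)
  have real: "0 \<le> Re (\<tau> (cstar y * y) + c * z + cnj c * z')" "Im (\<tau> (cstar y * y) + c * z + cnj c * z') = 0" for c
    using pos[of "y + c *\<^sub>C a"] unfolding exp by (auto simp: less_eq_complex_def)
  have y0: "Im (\<tau> (cstar y * y)) = 0" using pos[of y] by (simp add: less_eq_complex_def)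
  have i1: "Im z + Im z' = 0" and i2: "Re z - Re z' = 0"
    using real(2)[of 1] real(2)[of \<i>] y0 by auto
  have r1: "2 * Re z = 0"
  proof (rule ccontr)
    assume n: "2 * Re z \<noteq> 0"
    show False using real(1)[of "of_real (- (Re (\<tau> (cstar y * y)) + 1) / (2 * Re z))"] i2 n by (simp add: field_simps)
  qed
  have r2: "2 * Im z = 0"
  proof (rule ccontr)
    assume n: "2 * Im z \<noteq> 0"
    have "Im z' = - Im z" using i1 by simp
    then have "0 \<le> Re (\<tau> (cstar y * y)) - 2 * t * Im z" for t
      using real(1)[of "\<i> * of_real t"] by (simp add: algebra_simps)
    from this[of "(Re (\<tau> (cstar y * y)) + 1) / (2 * Im z)"] show False using n by simp
  qed
  have "z = 0" using r1 r2 by (simp add: complex_eq_iff)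
  then show ?thesis by (simp add: z_def y_def cstar_cstar)
qed

text \<open>The \<open>a\<close> with \<open>\<tau> (b * a) = 0\<close> for all \<open>b\<close> form a closed two-sided ideal that does not contain \<open>1\<close>.\<close>

lemma tracial_state_faithful:
  fixes \<tau> :: "'a::unital_cstar_algebra \<Rightarrow> complex"
  assumes \<tau>: "tracial_state \<tau>" and bd: "\<And>a. cmod (\<tau> a) \<le> norm a" and simple: "simple_cstar TYPE('a)"
    and a: "\<tau> (cstar a * a) = 0"
  shows "a = 0"
proof -
  define I where "I = {a. \<forall>b. \<tau> (b * a) = 0}"
  have add: "\<And>a b. \<tau> (a + b) = \<tau> a + \<tau> b" and sc: "\<And>c a. \<tau> (c *\<^sub>C a) = c * \<tau> a"
    and one: "\<tau> 1 = 1" and comm: "\<And>a b. \<tau> (a * b) = \<tau> (b * a)" using \<tau> by (auto simp: tracial_state_def)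
  have "closed I"
    unfolding closed_sequential_limits
  proof (intro allI impI, elim conjE)
    fix f l assume f: "\<forall>n. f n \<in> I" "f \<longlonglongrightarrow> l"
    have "\<tau> (b * l) = 0" for b
    proof -
      have "(\<lambda>n. \<tau> (b * f n) - \<tau> (b * l)) \<longlonglongrightarrow> 0"
      proof (rule tendsto_0_le[of "\<lambda>n. b * f n - b * l" _ _ 1])
        show "(\<lambda>n. b * f n - b * l) \<longlonglongrightarrow> 0" by (intro LIM_zero tendsto_intros f)
        show "\<forall>\<^sub>F n in sequentially. norm (\<tau> (b * f n) - \<tau> (b * l)) \<le> norm (b * f n - b * l) * 1"
          using bd by (simp flip: tracial_state_diff[OF \<tau>])
      qed
      then show ?thesis using f(1) by (simp add: I_def LIMSEQ_const_iff)
    qed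
    then show "l \<in> I" by (simp add: I_def)
  qed
  moreover have "complex_vector.subspace I"
    unfolding complex_vector.subspace_def I_def
    using sc[of 0 0] by (auto simp: distrib_left add scaleC_mult_right sc)
  moreover have "c * b \<in> I \<and> b * c \<in> I" if "b \<in> I" for b c
  proof -
    have "\<tau> (d * (c * b)) = 0" for d using that by (simp add: I_def flip: mult.assoc)
    moreover have "\<tau> (d * (b * c)) = 0" for d
    proof -
      have "\<tau> (d * (b * c)) = \<tau> (c * (d * b))" using comm[of "d * b" c] by (simp add: mult.assoc)
      also have "\<dots> = 0" using that by (simp add: I_def flip: mult.assoc)
      finally show ?thesis .
    qed
    ultimately show ?thesis by (simp add: I_def)
  qed
  ultimately have "closed_ideal I" by (simp add: closed_ideal_def)
  then have "I = {0} \<or> I = UNIV" using simple by (simp add: simple_cstar_def)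
  moreover have "1 \<notin> I" using one by (auto simp: I_def intro!: exI[of _ 1])
  moreover have "a \<in> I" using tracial_state_null[OF \<tau> a] by (simp add: I_def)
  ultimately show ?thesis by auto
qed

text \<open>Gram-Schmidt: the new vector is nonzero since finitely many elements do not span, and has positive length
  since \<open>\<tau>\<close> is faithful.\<close>

lemma ex_trace_orthonormal:
  fixes \<tau> :: "'a::unital_cstar_algebra \<Rightarrow> complex"
  assumes \<tau>: "tracial_state \<tau>" and bd: "\<And>a. cmod (\<tau> a) \<le> norm a" and simple: "simple_cstar TYPE('a)"
    and inf: "infinite_dimensional TYPE('a)"
  shows "\<exists>a :: nat \<Rightarrow> 'a. \<forall>i<m. \<forall>j<m. \<tau> (cstar (a i) * a j) = (if i = j then 1 else 0)"
proof (induction m)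
  case (Suc m)
  have add: "\<And>a b. \<tau> (a + b) = \<tau> a + \<tau> b" and sc: "\<And>c a. \<tau> (c *\<^sub>C a) = c * \<tau> a"
    and pos: "\<And>a. 0 \<le> \<tau> (cstar a * a)" using \<tau> by (auto simp: tracial_state_def)
  from Suc obtain a :: "nat \<Rightarrow> 'a" where a: "\<And>i j. i < m \<Longrightarrow> j < m \<Longrightarrow> \<tau> (cstar (a i) * a j) = (if i = j then 1 else 0)" by blast
  have "complex_vector.span (a ` {..<m}) \<noteq> UNIV" using inf unfolding infinite_dimensional_def by blast
  then obtain b where b: "b \<notin> complex_vector.span (a ` {..<m})" by blast
  define c where "c = b - (\<Sum>i<m. \<tau> (cstar (a i) * b) *\<^sub>C a i)"
  have "(\<Sum>i<m. \<tau> (cstar (a i) * b) *\<^sub>C a i) \<in> complex_vector.span (a ` {..<m})"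
    by (intro complex_vector.span_sum complex_vector.span_scale complex_vector.span_base) auto
  then have "c \<noteq> 0" using b by (auto simp: c_def)
  then have "\<tau> (cstar c * c) \<noteq> 0" using tracial_state_faithful[OF \<tau> bd simple] by blast
  then obtain t where t: "\<tau> (cstar c * c) = of_real t" "0 < t"
    using pos[of c] by (metis complex_is_Real_iff less_eq_complex_def less_eq_real_def of_real_0 Reals_cases zero_complex.simps(1) zero_complex.simps(2) Re_complex_of_real)
  have orth: "\<tau> (cstar (a i) * c) = 0" if "i < m" for i
  proof -
    have "\<tau> (cstar (a i) * c) = \<tau> (cstar (a i) * b) - (\<Sum>j<m. \<tau> (cstar (a j) * b) * \<tau> (cstar (a i) * a j))"
      by (simp add: c_def right_diff_distrib tracial_state_diff[OF \<tau>] sum_distrib_left tracial_state_sum[OF \<tau>] scaleC_mult_right sc)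
    also have "(\<Sum>j<m. \<tau> (cstar (a j) * b) * \<tau> (cstar (a i) * a j)) = (\<Sum>j<m. if j = i then \<tau> (cstar (a j) * b) else 0)"
      using a that by (intro sum.cong refl) auto
    finally show ?thesis using that by simp
  qed
  have conj: "\<tau> (cstar u) = cnj (\<tau> u)" if "\<And>d. 0 \<le> \<tau> (cstar (u + d *\<^sub>C 1) * (u + d *\<^sub>C 1))" for u
  proof -
    have e: "\<tau> (cstar (u + d *\<^sub>C 1) * (u + d *\<^sub>C 1)) = \<tau> (cstar u * u) + d * \<tau> (cstar u) + cnj d * \<tau> u + cnj d * d" for d
      using \<tau> by (simp add: cstar_add cstar_scaleC algebra_simps add sc scaleC_mult_left scaleC_mult_right tracial_state_def)
    have "Im (\<tau> (cstar u * u) + d * \<tau> (cstar u) + cnj d * \<tau> u + cnj d * d) = 0" for d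
      using pos[of "u + d *\<^sub>C 1"] unfolding e by (simp add: less_eq_complex_def)
    from this[of 0] this[of 1] this[of \<i>] show ?thesis by (simp add: complex_eq_iff)
  qed
  have orth': "\<tau> (cstar c * a i) = 0" if "i < m" for i
    using conj[OF pos, of "cstar (a i) * c"] orth[OF that] by (simp add: cstar_mult cstar_cstar)
  define a' where "a' = a(m := of_real (1 / sqrt t) *\<^sub>C c)"
  have st: "complex_of_real (sqrt t) * complex_of_real (sqrt t) = of_real t"
    using t(2) by (simp flip: of_real_mult)
  show ?case
  proof (intro exI[of _ a'] allI impI)
    fix i j assume ij: "i < Suc m" "j < Suc m"
    show "\<tau> (cstar (a' i) * a' j) = (if i = j then 1 else 0)"
      using ij a orth orth' t st
      by (auto simp: a'_def less_Suc_eq cstar_scaleC scaleC_mult_left scaleC_mult_right sc)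
  qed
qed simp

section \<open>Frobenius and operator norms of matrices\<close>

definition sq :: "nat \<Rightarrow> (nat \<times> nat) set" where "sq k = {..<k} \<times> {..<k}"

abbreviation fip :: "nat \<Rightarrow> complex mat \<Rightarrow> complex mat \<Rightarrow> complex" where
  "fip k X Y \<equiv> cip (sq k) (($$) X) (($$) Y)"

abbreviation fnorm :: "nat \<Rightarrow> complex mat \<Rightarrow> real" where
  "fnorm k X \<equiv> cnrm (sq k) (($$) X)"

lemma finite_sq [simp]: "finite (sq k)" by (simp add: sq_def)

lemma sum_sq: "(\<Sum>p\<in>sq k. f p) = (\<Sum>i<k. \<Sum>j<k. f (i, j))"
  by (simp add: sq_def sum.cartesian_product)

lemma mat_mult_index:
  assumes "X \<in> carrier_mat k k" "Y \<in> carrier_mat k k" "i < k" "j < k"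
  shows "(X * Y) $$ (i, j) = (\<Sum>l<k. X $$ (i, l) * Y $$ (l, j))"
  using assms by (auto simp: scalar_prod_def lessThan_atLeast0 intro!: sum.cong)

lemma mat_adjoint_dim [simp]: "dim_row (mat_adjoint A) = dim_col A" "dim_col (mat_adjoint A) = dim_row A"
  by (simp_all add: mat_adjoint_def)

lemma mat_adjoint_carrier: "A \<in> carrier_mat n m \<Longrightarrow> mat_adjoint A \<in> carrier_mat m n"
  by (intro carrier_matI) auto

lemma mat_adjoint_index:
  fixes A :: "complex mat"
  shows "i < dim_col A \<Longrightarrow> j < dim_row A \<Longrightarrow> mat_adjoint A $$ (i, j) = cnj (A $$ (j, i))"
  by (simp add: mat_adjoint_def mat_of_rows_index)

lemma mat_adjoint_adjoint: "mat_adjoint (mat_adjoint A) = (A :: complex mat)"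
  by (rule eq_matI) (auto simp: mat_adjoint_index)

lemma mat_adjoint_one: "mat_adjoint (1\<^sub>m k) = (1\<^sub>m k :: complex mat)"
  by (rule eq_matI) (auto simp: mat_adjoint_index)

lemma mat_adjoint_mult:
  fixes X Y :: "complex mat"
  assumes "X \<in> carrier_mat k k" "Y \<in> carrier_mat k k"
  shows "mat_adjoint (X * Y) = mat_adjoint Y * mat_adjoint X"
proof (rule eq_matI)
  fix i j assume "i < dim_row (mat_adjoint Y * mat_adjoint X)" "j < dim_col (mat_adjoint Y * mat_adjoint X)"
  then have ij: "i < k" "j < k" using assms by auto
  have "mat_adjoint (X * Y) $$ (i, j) = cnj ((X * Y) $$ (j, i))" using assms ij by (intro mat_adjoint_index) auto
  also have "\<dots> = (\<Sum>l<k. mat_adjoint Y $$ (i, l) * mat_adjoint X $$ (l, j))"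
    unfolding mat_mult_index[OF assms ij(2,1)] cnj_sum
    using assms ij by (intro sum.cong refl) (auto simp: mat_adjoint_index mult.commute)
  also have "\<dots> = (mat_adjoint Y * mat_adjoint X) $$ (i, j)"
    using assms ij by (intro mat_mult_index[symmetric] mat_adjoint_carrier) auto
  finally show "mat_adjoint (X * Y) $$ (i, j) = (mat_adjoint Y * mat_adjoint X) $$ (i, j)" .
qed (use assms in auto)

lemma fip_mult_left:
  assumes "A \<in> carrier_mat k k" "X \<in> carrier_mat k k" "Y \<in> carrier_mat k k"
  shows "fip k (A * X) Y = fip k X (mat_adjoint A * Y)"
proof -
  have "fip k (A * X) Y = (\<Sum>i<k. \<Sum>j<k. \<Sum>l<k. cnj (A $$ (i, l)) * cnj (X $$ (l, j)) * Y $$ (i, j))"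
    unfolding cip_def sum_sq using assms by (intro sum.cong refl) (simp add: mat_mult_index cnj_sum sum_distrib_right del: index_mult_mat)
  also have "\<dots> = (\<Sum>i<k. \<Sum>l<k. \<Sum>j<k. cnj (A $$ (i, l)) * cnj (X $$ (l, j)) * Y $$ (i, j))"
    by (intro sum.cong refl sum.swap)
  also have "\<dots> = (\<Sum>l<k. \<Sum>i<k. \<Sum>j<k. cnj (A $$ (i, l)) * cnj (X $$ (l, j)) * Y $$ (i, j))"
    by (rule sum.swap)
  also have "\<dots> = (\<Sum>l<k. \<Sum>j<k. \<Sum>i<k. cnj (A $$ (i, l)) * cnj (X $$ (l, j)) * Y $$ (i, j))"
    by (intro sum.cong refl sum.swap)
  also have "\<dots> = fip k X (mat_adjoint A * Y)"
    unfolding cip_def sum_sq using assms mat_adjoint_carrier[OF assms(1)]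
    by (intro sum.cong refl) (simp add: mat_mult_index mat_adjoint_index sum_distrib_left mult_ac del: index_mult_mat)
  finally show ?thesis .
qed

lemma fip_mult_right:
  assumes "A \<in> carrier_mat k k" "X \<in> carrier_mat k k" "Y \<in> carrier_mat k k"
  shows "fip k (X * A) Y = fip k X (Y * mat_adjoint A)"
proof -
  have "fip k (X * A) Y = (\<Sum>i<k. \<Sum>j<k. \<Sum>l<k. cnj (X $$ (i, l)) * cnj (A $$ (l, j)) * Y $$ (i, j))"
    unfolding cip_def sum_sq using assms by (intro sum.cong refl) (simp add: mat_mult_index cnj_sum sum_distrib_right del: index_mult_mat)
  also have "\<dots> = (\<Sum>i<k. \<Sum>l<k. \<Sum>j<k. cnj (X $$ (i, l)) * cnj (A $$ (l, j)) * Y $$ (i, j))"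
    by (intro sum.cong refl sum.swap)
  also have "\<dots> = fip k X (Y * mat_adjoint A)"
    unfolding cip_def sum_sq using assms mat_adjoint_carrier[OF assms(1)]
    by (intro sum.cong refl) (simp add: mat_mult_index mat_adjoint_index sum_distrib_left mult_ac del: index_mult_mat)
  finally show ?thesis .
qed

lemma fnorm_adjoint:
  assumes "X \<in> carrier_mat k k"
  shows "fnorm k (mat_adjoint X) = fnorm k X"
proof -
  have "(fnorm k (mat_adjoint X))\<^sup>2 = (\<Sum>i<k. \<Sum>j<k. (cmod (X $$ (j, i)))\<^sup>2)"
    unfolding cnrm_sq sum_sq using assms by (intro sum.cong refl) (simp add: mat_adjoint_index)
  also have "\<dots> = (fnorm k X)\<^sup>2" unfolding cnrm_sq sum_sq by (rule sum.swap)
  finally show ?thesis by (rule power2_eq_imp_eq) simp_all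
qed

lemma index_diff_sq:
  assumes "X \<in> carrier_mat k k" "Y \<in> carrier_mat k k" "p \<in> sq k"
  shows "(X - Y) $$ p = X $$ p - Y $$ p"
  using assms by (cases p) (auto simp: sq_def)

lemma fnorm_diff:
  assumes "X \<in> carrier_mat k k" "Y \<in> carrier_mat k k"
  shows "fnorm k (X - Y) = cnrm (sq k) (\<lambda>p. X $$ p - Y $$ p)"
  by (rule cnrm_cong) (rule index_diff_sq[OF assms])

lemma fnorm_minus_commute:
  assumes "X \<in> carrier_mat k k" "Y \<in> carrier_mat k k"
  shows "fnorm k (X - Y) = fnorm k (Y - X)"
  unfolding fnorm_diff[OF assms] fnorm_diff[OF assms(2,1)] by (rule cnrm_diff_commute)

lemma fnorm_triangle_diff:
  assumes "X \<in> carrier_mat k k" "Y \<in> carrier_mat k k" "Z \<in> carrier_mat k k"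
  shows "fnorm k (X - Z) \<le> fnorm k (X - Y) + fnorm k (Y - Z)"
  unfolding fnorm_diff[OF assms(1,3)] fnorm_diff[OF assms(1,2)] fnorm_diff[OF assms(2,3)]
  by (rule cnrm_triangle_diff)

lemma fip_diff_right:
  assumes "X \<in> carrier_mat k k" "Y \<in> carrier_mat k k"
  shows "fip k V (X - Y) = fip k V X - fip k V Y"
  unfolding cip_diff_right[symmetric] by (rule cip_cong) (auto simp: index_diff_sq[OF assms])

lemma fip_diff_left:
  assumes "X \<in> carrier_mat k k" "Y \<in> carrier_mat k k"
  shows "fip k (X - Y) V = fip k X V - fip k Y V"
  unfolding cip_diff_left[symmetric] by (rule cip_cong) (auto simp: index_diff_sq[OF assms])

lemma l2_norm_vec_eq: "l2_norm_vec v = cnrm {..<dim_vec v} (($) v)"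
  by (simp add: l2_norm_vec_def cnrm_def L2_set_def)

lemma l2_norm_vec_scale: "l2_norm_vec (c \<cdot>\<^sub>v v) = cmod c * l2_norm_vec v"
  unfolding l2_norm_vec_eq cnrm_scale[symmetric] index_smult_vec(2) by (rule cnrm_cong) simp

lemma mult_mat_vec_index:
  assumes "A \<in> carrier_mat k k" "v \<in> carrier_vec k" "i < k"
  shows "(A *\<^sub>v v) $ i = (\<Sum>l<k. A $$ (i, l) * v $ l)"
  using assms by (auto simp: scalar_prod_def lessThan_atLeast0 intro!: sum.cong)

lemma l2_mult_le_fnorm:
  assumes "A \<in> carrier_mat k k" "v \<in> carrier_vec k"
  shows "l2_norm_vec (A *\<^sub>v v) \<le> fnorm k A * l2_norm_vec v"
proof -
  have dims: "dim_vec (A *\<^sub>v v) = k" "dim_vec v = k" using assms by auto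
  have "(l2_norm_vec (A *\<^sub>v v))\<^sup>2 = (\<Sum>i<k. (cmod (\<Sum>l<k. A $$ (i, l) * v $ l))\<^sup>2)"
    unfolding l2_norm_vec_eq dims cnrm_sq using assms by (intro sum.cong refl) (simp only: lessThan_iff mult_mat_vec_index)
  also have "\<dots> \<le> (\<Sum>i<k. (cnrm {..<k} (\<lambda>l. cnj (A $$ (i, l))))\<^sup>2 * (cnrm {..<k} (($) v))\<^sup>2)"
  proof (rule sum_mono)
    fix i
    have "cmod (\<Sum>l<k. A $$ (i, l) * v $ l) \<le> cnrm {..<k} (\<lambda>l. cnj (A $$ (i, l))) * cnrm {..<k} (($) v)"
      using cip_CS[of "{..<k}" "\<lambda>l. cnj (A $$ (i, l))" "($) v"] by (simp add: cip_def)
    then have "(cmod (\<Sum>l<k. A $$ (i, l) * v $ l))\<^sup>2 \<le> (cnrm {..<k} (\<lambda>l. cnj (A $$ (i, l))) * cnrm {..<k} (($) v))\<^sup>2"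
      by (rule power_mono) simp
    then show "(cmod (\<Sum>l<k. A $$ (i, l) * v $ l))\<^sup>2 \<le> (cnrm {..<k} (\<lambda>l. cnj (A $$ (i, l))))\<^sup>2 * (cnrm {..<k} (($) v))\<^sup>2"
      by (simp add: power_mult_distrib)
  qed
  also have "\<dots> = (fnorm k A)\<^sup>2 * (l2_norm_vec v)\<^sup>2"
    unfolding l2_norm_vec_eq dims by (simp add: cnrm_sq sum_sq sum_distrib_right)
  also have "\<dots> = (fnorm k A * l2_norm_vec v)\<^sup>2" by (simp add: power_mult_distrib)
  finally show ?thesis by (rule power2_le_imp_le) (simp add: l2_norm_vec_eq)
qed

lemma opnorm_bdd_above:
  assumes "A \<in> carrier_mat k k"
  shows "bdd_above ((\<lambda>v. l2_norm_vec (A *\<^sub>v v)) ` {v \<in> carrier_vec (dim_col A). l2_norm_vec v \<le> 1})"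
proof (rule bdd_aboveI2)
  fix v assume v: "v \<in> {v \<in> carrier_vec (dim_col A). l2_norm_vec v \<le> 1}"
  then have "l2_norm_vec (A *\<^sub>v v) \<le> fnorm k A * l2_norm_vec v" using assms by (intro l2_mult_le_fnorm) auto
  also have "\<dots> \<le> fnorm k A * 1" using v by (intro mult_left_mono) auto
  finally show "l2_norm_vec (A *\<^sub>v v) \<le> fnorm k A" by simp
qed

lemma opnorm_bound:
  assumes "A \<in> carrier_mat k k" "v \<in> carrier_vec k"
  shows "l2_norm_vec (A *\<^sub>v v) \<le> opnorm A * l2_norm_vec v"
proof (cases "l2_norm_vec v = 0")
  case True
  then show ?thesis using l2_mult_le_fnorm[OF assms] by simp
next
  case False
  then have pos: "0 < l2_norm_vec v" by (simp add: l2_norm_vec_eq order_less_le)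
  define u where "u = of_real (1 / l2_norm_vec v) \<cdot>\<^sub>v v"
  have "l2_norm_vec u = 1" unfolding u_def l2_norm_vec_scale using pos by (simp add: norm_divide)
  then have "l2_norm_vec (A *\<^sub>v u) \<le> opnorm A"
    unfolding opnorm_def using assms by (intro cSUP_upper opnorm_bdd_above[OF assms(1)]) (auto simp: u_def)
  moreover have "A *\<^sub>v u = of_real (1 / l2_norm_vec v) \<cdot>\<^sub>v (A *\<^sub>v v)"
    unfolding u_def using assms by (simp add: mult_mat_vec)
  ultimately have "l2_norm_vec (A *\<^sub>v v) / l2_norm_vec v \<le> opnorm A"
    using pos by (simp add: l2_norm_vec_scale norm_divide)
  then show ?thesis using pos by (simp add: field_simps)
qed

lemma opnorm_leI:
  assumes "A \<in> carrier_mat k k" and "\<And>v. v \<in> carrier_vec k \<Longrightarrow> l2_norm_vec v \<le> 1 \<Longrightarrow> l2_norm_vec (A *\<^sub>v v) \<le> c"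
  shows "opnorm A \<le> c"
  unfolding opnorm_def
proof (rule cSUP_least)
  have "0\<^sub>v (dim_col A) \<in> {v \<in> carrier_vec (dim_col A). l2_norm_vec v \<le> 1}" by (simp add: l2_norm_vec_def)
  then show "{v \<in> carrier_vec (dim_col A). l2_norm_vec v \<le> 1} \<noteq> {}" by blast
qed (use assms in auto)

lemma opnorm_nonneg:
  assumes "A \<in> carrier_mat k k"
  shows "0 \<le> opnorm A"
proof -
  have "l2_norm_vec (A *\<^sub>v 0\<^sub>v (dim_col A)) \<le> opnorm A"
    unfolding opnorm_def using assms by (intro cSUP_upper opnorm_bdd_above[OF assms(1)]) (auto simp: l2_norm_vec_def)
  then show ?thesis by (rule order_trans[rotated]) (simp add: l2_norm_vec_eq)
qed

lemma fnorm_eq_columns: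
  assumes "X \<in> carrier_mat k k"
  shows "(fnorm k X)\<^sup>2 = (\<Sum>j<k. (l2_norm_vec (col X j))\<^sup>2)"
proof -
  have "(fnorm k X)\<^sup>2 = (\<Sum>j<k. \<Sum>i<k. (cmod (X $$ (i, j)))\<^sup>2)"
    unfolding cnrm_sq sum_sq by (rule sum.swap)
  also have "\<dots> = (\<Sum>j<k. (l2_norm_vec (col X j))\<^sup>2)"
    unfolding l2_norm_vec_eq cnrm_sq using assms by (intro sum.cong refl) (auto intro!: sum.cong)
  finally show ?thesis .
qed

text \<open>Multiplication from the left acts on each column separately.\<close>

lemma fnorm_mult_le:
  assumes X: "X \<in> carrier_mat k k" and Y: "Y \<in> carrier_mat k k"
  shows "fnorm k (X * Y) \<le> opnorm X * fnorm k Y"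
proof -
  have "(fnorm k (X * Y))\<^sup>2 = (\<Sum>j<k. (l2_norm_vec (X *\<^sub>v col Y j))\<^sup>2)"
    using X Y by (subst fnorm_eq_columns) (auto simp: col_mult2[OF X Y] intro!: sum.cong)
  also have "\<dots> \<le> (\<Sum>j<k. (opnorm X * l2_norm_vec (col Y j))\<^sup>2)"
    using Y by (intro sum_mono power_mono opnorm_bound[OF X]) (auto simp: l2_norm_vec_eq)
  also have "\<dots> = (opnorm X * fnorm k Y)\<^sup>2"
    unfolding power_mult_distrib fnorm_eq_columns[OF Y] by (simp add: sum_distrib_left)
  finally show ?thesis by (rule power2_le_imp_le) (simp add: opnorm_nonneg[OF X])
qed

lemma fnorm_one: "fnorm k (1\<^sub>m k) = sqrt k"
proof -
  have "(fnorm k (1\<^sub>m k))\<^sup>2 = (\<Sum>i<k. \<Sum>j<k. if i = j then 1 else 0)"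
    unfolding cnrm_sq sum_sq by (intro sum.cong refl) auto
  then have "(fnorm k (1\<^sub>m k))\<^sup>2 = k" by simp
  then show ?thesis by (metis cnrm_nonneg real_sqrt_unique)
qed

lemma fnorm_le_opnorm:
  assumes "X \<in> carrier_mat k k"
  shows "fnorm k X \<le> sqrt k * opnorm X"
  using fnorm_mult_le[OF assms one_carrier_mat] assms by (simp add: fnorm_one mult.commute)

section \<open>Unitary conjugation\<close>

definition unitary_mat :: "nat \<Rightarrow> complex mat \<Rightarrow> bool" where
  "unitary_mat k U \<longleftrightarrow> U \<in> carrier_mat k k \<and> mat_adjoint U * U = 1\<^sub>m k"

lemma unitary_carrier: "unitary_mat k U \<Longrightarrow> U \<in> carrier_mat k k"
  by (simp add: unitary_mat_def)

lemma unitary_right: "unitary_mat k U \<Longrightarrow> U * mat_adjoint U = 1\<^sub>m k"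
  unfolding unitary_mat_def using mat_mult_left_right_inverse mat_adjoint_carrier by blast

lemma unitary_adjoint: "unitary_mat k U \<Longrightarrow> unitary_mat k (mat_adjoint U)"
  using unitary_right[of k U] by (simp add: unitary_mat_def mat_adjoint_adjoint mat_adjoint_carrier)

lemma fnorm_unitary_left:
  assumes "unitary_mat k U" "X \<in> carrier_mat k k"
  shows "fnorm k (U * X) = fnorm k X"
proof -
  have U: "U \<in> carrier_mat k k" "mat_adjoint U \<in> carrier_mat k k" "mat_adjoint U * U = 1\<^sub>m k"
    using assms by (auto simp: unitary_mat_def mat_adjoint_carrier)
  have "fip k (U * X) (U * X) = fip k X (mat_adjoint U * (U * X))"
    using U assms by (intro fip_mult_left) auto
  also have "mat_adjoint U * (U * X) = X"
    using U assms by (simp flip: assoc_mult_mat[of "mat_adjoint U" k k U k X k])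
  finally have "(fnorm k (U * X))\<^sup>2 = (fnorm k X)\<^sup>2" unfolding cip_self using of_real_eq_iff by blast
  then show ?thesis by (rule power2_eq_imp_eq) simp_all
qed

lemma fnorm_unitary_right:
  assumes "unitary_mat k U" "X \<in> carrier_mat k k"
  shows "fnorm k (X * U) = fnorm k X"
proof -
  have "fnorm k (X * U) = fnorm k (mat_adjoint (X * U))"
    using assms by (intro fnorm_adjoint[symmetric]) (auto simp: unitary_mat_def)
  also have "\<dots> = fnorm k (mat_adjoint U * mat_adjoint X)"
    using assms by (simp add: mat_adjoint_mult[of _ k] unitary_carrier)
  also have "\<dots> = fnorm k (mat_adjoint X)"
    using assms by (intro fnorm_unitary_left unitary_adjoint mat_adjoint_carrier)
  finally show ?thesis using assms by (simp add: fnorm_adjoint)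
qed

text \<open>Place \<open>v\<close> in the first column of a matrix that vanishes elsewhere.\<close>

lemma l2_unitary:
  assumes "unitary_mat k U" "v \<in> carrier_vec k"
  shows "l2_norm_vec (U *\<^sub>v v) = l2_norm_vec v"
proof -
  have U: "U \<in> carrier_mat k k" using assms(1) by (rule unitary_carrier)
  define M where "M = mat k k (\<lambda>(i, j). if j = 0 then v $ i else 0)"
  show ?thesis
  proof (cases k)
    case 0
    then show ?thesis using assms U by (simp add: l2_norm_vec_eq cnrm_def)
  next
    case (Suc k')
    then have "0 < k" by simp
    have M: "M \<in> carrier_mat k k" by (simp add: M_def)
    have c0: "col M 0 = v" using assms Suc by (auto simp: M_def)
    have cj: "col M j = 0\<^sub>v k" if "0 < j" "j < k" for j using that by (auto simp: M_def)
    have z: "l2_norm_vec (0\<^sub>v k) = 0" by (simp add: l2_norm_vec_def)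
    have "(fnorm k M)\<^sup>2 = (\<Sum>j<k. if j = 0 then (l2_norm_vec v)\<^sup>2 else 0)"
      unfolding fnorm_eq_columns[OF M] by (intro sum.cong refl) (use c0 cj z in auto)
    moreover have "(fnorm k (U * M))\<^sup>2 = (\<Sum>j<k. if j = 0 then (l2_norm_vec (U *\<^sub>v v))\<^sup>2 else 0)"
    proof -
      have "U *\<^sub>v 0\<^sub>v k = 0\<^sub>v k" using U by auto
      then have "l2_norm_vec (U *\<^sub>v col M j) = (if j = 0 then l2_norm_vec (U *\<^sub>v v) else 0)" if "j < k" for j
        using c0 cj[OF _ that] z by auto
      then have "(\<Sum>j<k. (l2_norm_vec (U *\<^sub>v col M j))\<^sup>2) = (\<Sum>j<k. if j = 0 then (l2_norm_vec (U *\<^sub>v v))\<^sup>2 else 0)"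
        by (intro sum.cong refl) auto
      then show ?thesis
        unfolding fnorm_eq_columns[OF mult_carrier_mat[OF U M]] by (simp add: col_mult2[OF U M])
    qed
    ultimately have "(l2_norm_vec (U *\<^sub>v v))\<^sup>2 = (l2_norm_vec v)\<^sup>2"
      using fnorm_unitary_left[OF assms(1) M] \<open>0 < k\<close> by simp
    then show ?thesis by (rule power2_eq_imp_eq) (simp_all add: l2_norm_vec_eq)
  qed
qed

lemma conj_carrier: "unitary_mat k U \<Longrightarrow> X \<in> carrier_mat k k \<Longrightarrow> U * X * mat_adjoint U \<in> carrier_mat k k"
  using unitary_carrier[of k U] mat_adjoint_carrier[of U k k] by auto

lemma opnorm_conj_le:
  assumes "unitary_mat k U" "X \<in> carrier_mat k k"
  shows "opnorm (U * X * mat_adjoint U) \<le> opnorm X"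
proof (rule opnorm_leI[OF conj_carrier[OF assms]])
  fix v :: "complex vec" assume v: "v \<in> carrier_vec k" "l2_norm_vec v \<le> 1"
  have U: "U \<in> carrier_mat k k" "mat_adjoint U \<in> carrier_mat k k"
    using assms unitary_carrier mat_adjoint_carrier by blast+
  have w: "mat_adjoint U *\<^sub>v v \<in> carrier_vec k" using U v by simp
  have "(U * X * mat_adjoint U) *\<^sub>v v = U *\<^sub>v (X *\<^sub>v (mat_adjoint U *\<^sub>v v))"
    using U v assms(2) w by (simp add: assoc_mult_mat_vec[of _ k k _ k])
  then have "l2_norm_vec ((U * X * mat_adjoint U) *\<^sub>v v) = l2_norm_vec (X *\<^sub>v (mat_adjoint U *\<^sub>v v))"
    using l2_unitary[OF assms(1)] assms(2) w by simp
  also have "\<dots> \<le> opnorm X * l2_norm_vec (mat_adjoint U *\<^sub>v v)" by (rule opnorm_bound[OF assms(2) w])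
  also have "\<dots> \<le> opnorm X * 1"
    using l2_unitary[OF unitary_adjoint[OF assms(1)] v(1)] v(2) opnorm_nonneg[OF assms(2)] by (intro mult_left_mono) auto
  finally show "l2_norm_vec ((U * X * mat_adjoint U) *\<^sub>v v) \<le> opnorm X" by simp
qed

lemma conj_mult:
  assumes "unitary_mat k U" "X \<in> carrier_mat k k" "Y \<in> carrier_mat k k"
  shows "(U * X * mat_adjoint U) * (U * Y * mat_adjoint U) = U * (X * Y) * mat_adjoint U"
proof -
  have U: "U \<in> carrier_mat k k" "mat_adjoint U \<in> carrier_mat k k" "mat_adjoint U * U = 1\<^sub>m k"
    using assms by (auto simp: unitary_mat_def mat_adjoint_carrier)
  have "(U * X * mat_adjoint U) * (U * Y * mat_adjoint U) = U * X * (mat_adjoint U * (U * (Y * mat_adjoint U)))"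
    using U assms by (simp add: assoc_mult_mat[of _ k k _ k _ k])
  also have "mat_adjoint U * (U * (Y * mat_adjoint U)) = (mat_adjoint U * U) * (Y * mat_adjoint U)"
    using U(1,2) assms(2,3) by (simp add: assoc_mult_mat[of _ k k _ k _ k])
  also have "\<dots> = Y * mat_adjoint U" using U assms by simp
  also have "U * X * (Y * mat_adjoint U) = U * (X * Y) * mat_adjoint U"
    using U assms by (simp add: assoc_mult_mat[of _ k k _ k _ k])
  finally show ?thesis .
qed

lemma conj_conj:
  assumes "unitary_mat k U" "X \<in> carrier_mat k k"
  shows "mat_adjoint U * (U * X * mat_adjoint U) * U = X"
proof -
  have U: "U \<in> carrier_mat k k" "mat_adjoint U \<in> carrier_mat k k" "mat_adjoint U * U = 1\<^sub>m k"
    using assms by (auto simp: unitary_mat_def mat_adjoint_carrier)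
  have "mat_adjoint U * (U * X * mat_adjoint U) * U = (mat_adjoint U * U) * (X * (mat_adjoint U * U))"
    using U(1,2) assms(2) by (simp add: assoc_mult_mat[of _ k k _ k _ k])
  then show ?thesis using U assms by simp
qed

lemma opnorm_conj:
  assumes "unitary_mat k U" "X \<in> carrier_mat k k"
  shows "opnorm (U * X * mat_adjoint U) = opnorm X"
proof (rule antisym[OF opnorm_conj_le[OF assms]])
  show "opnorm X \<le> opnorm (U * X * mat_adjoint U)"
    using opnorm_conj_le[OF unitary_adjoint[OF assms(1)] conj_carrier[OF assms]] conj_conj[OF assms]
    by (simp add: mat_adjoint_adjoint)
qed

lemma mat_adjoint_conj:
  assumes "unitary_mat k U" "X \<in> carrier_mat k k"
  shows "mat_adjoint (U * X * mat_adjoint U) = U * mat_adjoint X * mat_adjoint U"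
proof -
  have U: "U \<in> carrier_mat k k" "mat_adjoint U \<in> carrier_mat k k" "mat_adjoint X \<in> carrier_mat k k"
    using assms by (auto simp: unitary_mat_def mat_adjoint_carrier)
  have "mat_adjoint (U * X * mat_adjoint U) = mat_adjoint (mat_adjoint U) * mat_adjoint (U * X)"
    using U assms by (intro mat_adjoint_mult) auto
  also have "\<dots> = U * (mat_adjoint X * mat_adjoint U)"
    using U assms by (simp add: mat_adjoint_adjoint mat_adjoint_mult[of _ k])
  finally show ?thesis using U by (simp add: assoc_mult_mat[of _ k k _ k _ k])
qed

section \<open>Words and polynomials in matrices\<close>

lemma mat_word_Nil [simp]: "mat_word k A [] = 1\<^sub>m k" by (simp add: mat_word_def)
lemma mat_word_Cons [simp]: "mat_word k A (i # w) = A i * mat_word k A w" by (simp add: mat_word_def)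

lemma mat_word_carrier [simp]: "(\<And>i. A i \<in> carrier_mat k k) \<Longrightarrow> mat_word k A w \<in> carrier_mat k k"
  by (induction w) (auto intro: mult_carrier_mat)

lemma mat_word_append:
  assumes "\<And>i. A i \<in> carrier_mat k k"
  shows "mat_word k A (v @ w) = mat_word k A v * mat_word k A w"
proof (induction v)
  case Nil
  have "mat_word k A w \<in> carrier_mat k k" by (rule mat_word_carrier[OF assms])
  then show ?case by simp
next
  case (Cons i v)
  then show ?case using mat_word_carrier[OF assms] assms by (simp add: assoc_mult_mat[of _ k k _ k _ k])
qed

lemma mat_adjoint_word:
  assumes "\<And>i. A i \<in> carrier_mat k k" "\<And>i. mat_adjoint (A i) = A i"
  shows "mat_adjoint (mat_word k A w) = mat_word k A (rev w)"
proof (induction w)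
  case (Cons i w)
  have "mat_adjoint (mat_word k A (i # w)) = mat_word k A (rev w) * A i"
    using assms mat_word_carrier[OF assms(1)] Cons by (simp add: mat_adjoint_mult[of _ k])
  then show ?case using right_mult_one_mat[OF assms(1)] by (simp add: mat_word_append[OF assms(1)])
qed (simp add: mat_adjoint_one)

lemma fnorm_word_mult_le:
  assumes "\<And>i. A i \<in> carrier_mat k k" "\<And>i. opnorm (A i) \<le> R" "Y \<in> carrier_mat k k"
  shows "fnorm k (mat_word k A w * Y) \<le> R ^ length w * fnorm k Y"
proof (induction w)
  case (Cons i w)
  have R: "0 \<le> R" using opnorm_nonneg[OF assms(1)] assms(2) order_trans by blast
  have W: "mat_word k A w * Y \<in> carrier_mat k k" using assms mat_word_carrier[OF assms(1)] by (intro mult_carrier_mat) auto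
  have "mat_word k A (i # w) * Y = A i * (mat_word k A w * Y)"
    using assms mat_word_carrier[OF assms(1)] by (simp add: assoc_mult_mat[of _ k k _ k _ k])
  then have "fnorm k (mat_word k A (i # w) * Y) \<le> opnorm (A i) * fnorm k (mat_word k A w * Y)"
    using fnorm_mult_le[OF assms(1) W] by simp
  also have "\<dots> \<le> R * (R ^ length w * fnorm k Y)"
    using Cons assms(2) R by (intro mult_mono) auto
  finally show ?case by (simp add: mult.assoc)
qed (use assms in simp)

lemma ncpoly_eval_mat_carrier [simp]: "ncpoly_eval_mat k p A \<in> carrier_mat k k"
  by (simp add: ncpoly_eval_mat_def)

lemma ncpoly_eval_mat_index:
  "i < k \<Longrightarrow> j < k \<Longrightarrow> ncpoly_eval_mat k p A $$ (i, j) = (\<Sum>w\<in>Poly_Mapping.keys p. Poly_Mapping.lookup p w * mat_word k A w $$ (i, j))"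
  by (simp add: ncpoly_eval_mat_def)

lemma ncpoly_eval_mat_mult_index:
  assumes "\<And>i. A i \<in> carrier_mat k k" "Y \<in> carrier_mat k k" "q \<in> sq k"
  shows "(ncpoly_eval_mat k p A * Y) $$ q = (\<Sum>w\<in>Poly_Mapping.keys p. Poly_Mapping.lookup p w * (mat_word k A w * Y) $$ q)"
proof -
  obtain i j where q: "q = (i, j)" "i < k" "j < k" using assms(3) by (auto simp: sq_def)
  have "(ncpoly_eval_mat k p A * Y) $$ (i, j) =
     (\<Sum>l<k. \<Sum>w\<in>Poly_Mapping.keys p. Poly_Mapping.lookup p w * (mat_word k A w $$ (i, l) * Y $$ (l, j)))"
    using q by (subst mat_mult_index[OF ncpoly_eval_mat_carrier assms(2)])
      (auto simp: ncpoly_eval_mat_index sum_distrib_right mult.assoc)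
  also have "\<dots> = (\<Sum>w\<in>Poly_Mapping.keys p. Poly_Mapping.lookup p w * (mat_word k A w * Y) $$ (i, j))"
    using q by (subst sum.swap) (simp add: mat_mult_index[OF mat_word_carrier[OF assms(1)] assms(2)] sum_distrib_left del: index_mult_mat)
  finally show ?thesis using q by simp
qed

lemma mat_word_conj:
  assumes U: "unitary_mat k U" and A: "\<And>i. A i \<in> carrier_mat k k"
  shows "mat_word k (\<lambda>i. U * A i * mat_adjoint U) w = U * mat_word k A w * mat_adjoint U"
proof (induction w)
  case Nil
  show ?case using unitary_right[OF U] unitary_carrier[OF U] by simp
next
  case (Cons i w)
  then show ?case using conj_mult[OF U A mat_word_carrier[OF A]] by simp
qed

lemma ncpoly_eval_mat_conj:
  assumes U: "unitary_mat k U" and A: "\<And>i. A i \<in> carrier_mat k k"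
  shows "ncpoly_eval_mat k p (\<lambda>i. U * A i * mat_adjoint U) = U * ncpoly_eval_mat k p A * mat_adjoint U"
proof -
  let ?c = "\<lambda>w. Poly_Mapping.lookup p w" and ?K = "Poly_Mapping.keys p"
  have Uc: "U \<in> carrier_mat k k" "mat_adjoint U \<in> carrier_mat k k"
    using U by (auto simp: unitary_mat_def mat_adjoint_carrier)
  have W: "mat_word k A w \<in> carrier_mat k k" for w using mat_word_carrier[OF A] .
  show ?thesis
  proof (rule eq_matI)
    fix i j assume "i < dim_row (U * ncpoly_eval_mat k p A * mat_adjoint U)" "j < dim_col (U * ncpoly_eval_mat k p A * mat_adjoint U)"
    then have ij: "i < k" "j < k" using Uc by auto
    have N: "ncpoly_eval_mat k p A * mat_adjoint U \<in> carrier_mat k k" using Uc by (intro mult_carrier_mat) auto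
    have "(U * ncpoly_eval_mat k p A * mat_adjoint U) $$ (i, j) = (U * (ncpoly_eval_mat k p A * mat_adjoint U)) $$ (i, j)"
      using Uc by (simp add: assoc_mult_mat[of _ k k _ k _ k] del: index_mult_mat)
    also have "\<dots> = (\<Sum>l<k. U $$ (i, l) * (\<Sum>w\<in>?K. ?c w * (mat_word k A w * mat_adjoint U) $$ (l, j)))"
      unfolding mat_mult_index[OF Uc(1) N ij] using ij
      by (intro sum.cong refl) (simp add: ncpoly_eval_mat_mult_index[OF A Uc(2)] sq_def del: index_mult_mat)
    also have "\<dots> = (\<Sum>w\<in>?K. ?c w * (\<Sum>l<k. U $$ (i, l) * (mat_word k A w * mat_adjoint U) $$ (l, j)))"
      unfolding sum_distrib_left by (subst sum.swap) (simp add: mult_ac del: index_mult_mat)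
    also have "\<dots> = (\<Sum>w\<in>?K. ?c w * mat_word k (\<lambda>i. U * A i * mat_adjoint U) w $$ (i, j))"
    proof (rule sum.cong[OF refl])
      fix w
      have "mat_word k A w * mat_adjoint U \<in> carrier_mat k k" using W Uc by (intro mult_carrier_mat) auto
      then have "(\<Sum>l<k. U $$ (i, l) * (mat_word k A w * mat_adjoint U) $$ (l, j)) = (U * (mat_word k A w * mat_adjoint U)) $$ (i, j)"
        using Uc ij by (intro mat_mult_index[symmetric]) auto
      also have "\<dots> = mat_word k (\<lambda>i. U * A i * mat_adjoint U) w $$ (i, j)"
        unfolding mat_word_conj[OF U A] using W Uc by (simp add: assoc_mult_mat[of _ k k _ k _ k] del: index_mult_mat)
      finally show "?c w * (\<Sum>l<k. U $$ (i, l) * (mat_word k A w * mat_adjoint U) $$ (l, j)) = ?c w * mat_word k (\<lambda>i. U * A i * mat_adjoint U) w $$ (i, j)"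
        by simp
    qed
    finally show "ncpoly_eval_mat k p (\<lambda>i. U * A i * mat_adjoint U) $$ (i, j) = (U * ncpoly_eval_mat k p A * mat_adjoint U) $$ (i, j)"
      using ij by (simp add: ncpoly_eval_mat_index del: index_mult_mat)
  next
    have d: "dim_row (ncpoly_eval_mat k p B) = k" "dim_col (ncpoly_eval_mat k p B) = k" for B
      by (simp_all add: ncpoly_eval_mat_def)
    show "dim_row (ncpoly_eval_mat k p (\<lambda>i. U * A i * mat_adjoint U)) = dim_row (U * ncpoly_eval_mat k p A * mat_adjoint U)"
      "dim_col (ncpoly_eval_mat k p (\<lambda>i. U * A i * mat_adjoint U)) = dim_col (U * ncpoly_eval_mat k p A * mat_adjoint U)"
      using Uc d by simp_all
  qed
qed

lemma Gamma_top_conj: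
  assumes U: "unitary_mat k U" and A: "A \<in> Gamma_top P R x k \<epsilon> r"
  shows "(\<lambda>i. U * A i * mat_adjoint U) \<in> Gamma_top P R x k \<epsilon> r"
proof -
  have c: "\<And>i. A i \<in> carrier_mat k k" and sa: "\<And>i. mat_adjoint (A i) = A i" and R: "\<And>i. opnorm (A i) \<le> R"
    and e: "\<And>j. j \<in> {1..r} \<Longrightarrow> \<bar>opnorm (ncpoly_eval_mat k (P j) A) - norm (ncpoly_eval (P j) x)\<bar> \<le> \<epsilon>"
    using A by (auto simp: Gamma_top_def)
  show ?thesis
    unfolding Gamma_top_def mem_Collect_eq
    using c sa R e
    by (simp add: conj_carrier[OF U] mat_adjoint_conj[OF U] opnorm_conj[OF U] ncpoly_eval_mat_conj[OF U])
qed

section \<open>Moments of microstates\<close>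

text \<open>The vector functional of \<open>V\<close>, for matrices acting on matrices by multiplication from the left. For the
  identity divided by \<open>sqrt k\<close> it is the normalised trace.\<close>

definition moment :: "nat \<Rightarrow> ('n \<Rightarrow> complex mat) \<Rightarrow> complex mat \<Rightarrow> 'n list \<Rightarrow> complex" where
  "moment k A V w = fip k V (mat_word k A w * V)"

lemma fip_ncpoly_left:
  assumes "\<And>i. A i \<in> carrier_mat k k" "Y \<in> carrier_mat k k"
  shows "fip k X (ncpoly_eval_mat k p A * Y) = (\<Sum>w\<in>Poly_Mapping.keys p. Poly_Mapping.lookup p w * fip k X (mat_word k A w * Y))"
proof -
  have "fip k X (ncpoly_eval_mat k p A * Y)
     = cip (sq k) (($$) X) (\<lambda>q. \<Sum>w\<in>Poly_Mapping.keys p. Poly_Mapping.lookup p w * (mat_word k A w * Y) $$ q)"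
    by (rule cip_cong) (auto simp: ncpoly_eval_mat_mult_index[OF assms])
  then show ?thesis by (simp add: cip_sum_right cip_scale_right)
qed

lemma moment_poly:
  assumes "\<And>i. A i \<in> carrier_mat k k" "V \<in> carrier_mat k k"
  shows "cword_comb (moment k A V) p = fip k V (ncpoly_eval_mat k p A * V)"
  unfolding fip_ncpoly_left[OF assms] word_comb_def moment_def ..

lemma moment_bound:
  assumes "\<And>i. A i \<in> carrier_mat k k" "\<And>i. opnorm (A i) \<le> R" "V \<in> carrier_mat k k" "fnorm k V = 1"
  shows "cmod (moment k A V w) \<le> R ^ length w"
  using cip_CS[of "sq k" "($$) V" "($$) (mat_word k A w * V)"] fnorm_word_mult_le[where A = A and w = w, OF assms(1-3)] assms(4)
  by (simp add: moment_def)

lemma moment_poly_bound: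
  assumes "\<And>i. A i \<in> carrier_mat k k" "V \<in> carrier_mat k k" "fnorm k V = 1"
  shows "cmod (cword_comb (moment k A V) p) \<le> opnorm (ncpoly_eval_mat k p A)"
  unfolding moment_poly[OF assms(1,2)]
  using cip_CS[of "sq k" "($$) V" "($$) (ncpoly_eval_mat k p A * V)"]
    fnorm_mult_le[OF ncpoly_eval_mat_carrier assms(2), of p A] assms(3) by simp

lemma moment_pos:
  assumes "\<And>i. A i \<in> carrier_mat k k" "\<And>i. mat_adjoint (A i) = A i" "V \<in> carrier_mat k k"
  shows "0 \<le> cword_comb (moment k A V) (nc_mult (nc_star p) p)"
proof -
  let ?K = "Poly_Mapping.keys p" and ?c = "Poly_Mapping.lookup p"
  let ?f = "\<lambda>q. \<Sum>w\<in>?K. ?c w * (mat_word k A w * V) $$ q"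
  have W: "mat_word k A w \<in> carrier_mat k k" for w by (rule mat_word_carrier[OF assms(1)])
  have m: "moment k A V (rev v @ w) = fip k (mat_word k A v * V) (mat_word k A w * V)" for v w
  proof -
    have "fip k (mat_word k A v * V) (mat_word k A w * V) = fip k V (mat_word k A (rev v) * (mat_word k A w * V))"
      using fip_mult_left[OF W assms(3) mult_carrier_mat[OF W assms(3)], of v w]
      by (simp add: mat_adjoint_word[OF assms(1,2)])
    also have "mat_word k A (rev v) * (mat_word k A w * V) = mat_word k A (rev v @ w) * V"
      using W assms(3) by (simp add: mat_word_append[OF assms(1)] assoc_mult_mat[of _ k k _ k _ k])
    finally show ?thesis by (simp add: moment_def)
  qed
  have "cword_comb (moment k A V) (nc_mult (nc_star p) p)
     = (\<Sum>v\<in>?K. \<Sum>w\<in>?K. cnj (?c v) * ?c w * fip k (mat_word k A v * V) (mat_word k A w * V))"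
    by (simp add: cword_comb_star_mult m)
  also have "\<dots> = cip (sq k) ?f ?f"
    unfolding cip_sum_left cip_sum_right by (simp add: cip_scale_left cip_scale_right mult_ac)
  finally show ?thesis unfolding cip_self by (simp add: less_eq_complex_def)
qed

text \<open>Moving \<open>A i\<close> to the other side of the inner product turns it into multiplication of \<open>V\<close> from the left; the commutator
  replaces it by multiplication from the right, where the adjoint moves it back to the other factor, and a
  second commutator brings it to the end of the word.\<close>

lemma moment_commutator:
  assumes A: "\<And>i. A i \<in> carrier_mat k k" "\<And>i. mat_adjoint (A i) = A i" "\<And>i. opnorm (A i) \<le> R"
    and V: "V \<in> carrier_mat k k" "fnorm k V = 1" and c: "fnorm k (A i * V - V * A i) \<le> \<theta>"
  shows "cmod (moment k A V (i # w) - moment k A V (w @ [i])) \<le> 2 * R ^ length w * \<theta>"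
proof -
  define M where "M = mat_word k A w"
  have M: "M \<in> carrier_mat k k" unfolding M_def by (rule mat_word_carrier[OF A(1)])
  have car: "A i * V \<in> carrier_mat k k" "V * A i \<in> carrier_mat k k" "M * V \<in> carrier_mat k k"
    using A V M by (auto intro!: mult_carrier_mat)
  have dc: "A i * V - V * A i \<in> carrier_mat k k" "V * A i - A i * V \<in> carrier_mat k k" using car by (auto simp: minus_carrier_mat)
  have e1: "moment k A V (i # w) = fip k (A i * V) (M * V)"
    using fip_mult_left[OF A(1)[of i] V(1) car(3)] A V M
    by (simp add: moment_def A(2) M_def[symmetric] assoc_mult_mat[of _ k k _ k _ k])
  have e2: "moment k A V (w @ [i]) = fip k V (M * (A i * V))"
    using A V M by (simp add: moment_def mat_word_append[OF A(1)] M_def[symmetric] assoc_mult_mat[of _ k k _ k _ k] right_mult_one_mat[OF A(1)])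
  have e3: "fip k (V * A i) (M * V) = fip k V (M * (V * A i))"
    using fip_mult_right[OF A(1)[of i] V(1) car(3)] A V M
    by (simp add: A(2) assoc_mult_mat[of _ k k _ k _ k])
  have e4: "fip k V (M * (V * A i - A i * V)) = fip k V (M * (V * A i)) - fip k V (M * (A i * V))"
    using M car by (simp add: mult_minus_distrib_mat[of _ k k _ k] fip_diff_right[of _ k])
  have "moment k A V (i # w) - moment k A V (w @ [i])
     = fip k (A i * V - V * A i) (M * V) + fip k V (M * (V * A i - A i * V))"
    unfolding e1 e2 e4 fip_diff_left[OF car(1,2)] e3 by simp
  then have "cmod (moment k A V (i # w) - moment k A V (w @ [i]))
     \<le> fnorm k (A i * V - V * A i) * fnorm k (M * V) + fnorm k V * fnorm k (M * (V * A i - A i * V))"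
    using norm_triangle_ineq order_trans[OF norm_triangle_ineq add_mono[OF cip_CS cip_CS]] by metis
  also have "\<dots> \<le> \<theta> * R ^ length w + 1 * (R ^ length w * \<theta>)"
  proof (intro add_mono mult_mono)
    show "fnorm k (M * V) \<le> R ^ length w" using fnorm_word_mult_le[OF A(1,3) V(1), where w = w] V(2) by (simp add: M_def)
    have R: "0 \<le> R" using opnorm_nonneg[OF A(1)] A(3) order_trans by blast
    have "fnorm k (M * (V * A i - A i * V)) \<le> R ^ length w * fnorm k (V * A i - A i * V)"
      using fnorm_word_mult_le[OF A(1,3) dc(2), where w = w] by (simp add: M_def)
    also have "\<dots> \<le> R ^ length w * \<theta>" using c R fnorm_minus_commute[OF car(1,2)] by (intro mult_left_mono) auto
    finally show "fnorm k (M * (V * A i - A i * V)) \<le> R ^ length w * \<theta>" .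
  qed (use c V in \<open>auto intro: order_trans[OF cnrm_nonneg]\<close>)
  finally show ?thesis by (simp add: mult_ac)
qed

text \<open>The averages are states with the properties that \<open>moments_converge_to_unique_trace\<close> asks for: the norm bound for the
  polynomial \<open>P j\<close> holds from the index \<open>j\<close> on, and the trace property holds in the limit because the family nearly
  commutes with the microstate.\<close>

lemma family_moments_converge:
  fixes x :: "'n::finite \<Rightarrow> 'a::unital_cstar_algebra" and P :: "nat \<Rightarrow> 'n ncpoly"
  assumes P: "P ` {1..} = rational_ncpolys"
    and sa: "\<And>i. cstar (x i) = x i" and gen: "generates_cstar (range x)"
    and uniq: "\<exists>!\<tau> :: 'a \<Rightarrow> complex. tracial_state \<tau>" and \<tau>: "tracial_state \<tau>"
    and G: "\<And>s. A s \<in> Gamma_top P R x (k s) (1 / real (Suc s)) (Suc s)"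
    and W: "\<And>s. 0 < (W s :: nat)" and V: "\<And>s a. a < W s \<Longrightarrow> V s a \<in> carrier_mat (k s) (k s)"
    and V1: "\<And>s a. a < W s \<Longrightarrow> fnorm (k s) (V s a) = 1"
    and Vc: "\<And>s a i. a < W s \<Longrightarrow> fnorm (k s) (A s i * V s a - V s a * A s i) \<le> 1 / real (Suc s)"
  shows "(\<lambda>s. (\<Sum>a<W s. moment (k s) (A s) (V s a) w) / of_nat (W s)) \<longlonglongrightarrow> \<tau> (word_prod x w)"
    and "cmod (\<tau> b) \<le> norm b"
proof -
  define m where "m s w = (\<Sum>a<W s. moment (k s) (A s) (V s a) w) / of_nat (W s)" for s w
  have Ac: "A s i \<in> carrier_mat (k s) (k s)" and Asa: "mat_adjoint (A s i) = A s i" and AR: "opnorm (A s i) \<le> R" for s i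
    using G[of s] by (auto simp: Gamma_top_def)
  have R: "0 \<le> R" using opnorm_nonneg[OF Ac[of 0 undefined]] AR[of 0 undefined] by simp
  have comb: "cword_comb (m s) p = (\<Sum>a<W s. cword_comb (moment (k s) (A s) (V s a)) p) / of_nat (W s)" for s p
    unfolding word_comb_def m_def by (subst sum.swap) (simp add: sum_divide_distrib sum_distrib_left)
  have avg: "cmod ((\<Sum>a<W s. f a) / of_nat (W s)) \<le> b" if "\<And>a. a < W s \<Longrightarrow> cmod (f a) \<le> b" for s f b
  proof -
    have "cmod (\<Sum>a<W s. f a) \<le> (\<Sum>a<W s. b)" by (rule order_trans[OF norm_sum sum_mono]) (use that in auto)
    then show ?thesis using W[of s] by (simp add: norm_divide divide_le_eq mult.commute)
  qed
  have 1: "m s [] = 1" for s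
  proof -
    have "moment (k s) (A s) (V s a) [] = 1" if "a < W s" for a
      using V[OF that] V1[OF that] by (simp add: moment_def cip_self)
    then show ?thesis using W[of s] by (simp add: m_def)
  qed
  have 2: "cmod (m s w) \<le> R ^ length w" for s w
    unfolding m_def by (rule avg, rule moment_bound[OF Ac AR V V1])
  have 3: "\<exists>N. N \<longlonglongrightarrow> norm (ncpoly_eval p x) \<and> (\<forall>\<^sub>F s in sequentially. cmod (cword_comb (m s) p) \<le> N s)"
    if "p \<in> rational_ncpolys" for p
  proof -
    from that P have "p \<in> P ` {1..}" by simp
    then obtain j where j: "1 \<le> j" "p = P j" by auto
    have "(\<lambda>s. norm (ncpoly_eval p x) + 1 / real (Suc s)) \<longlonglongrightarrow> norm (ncpoly_eval p x) + 0"
      by (intro tendsto_intros LIMSEQ_Suc lim_1_over_n)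
    moreover have "cmod (cword_comb (m s) p) \<le> norm (ncpoly_eval p x) + 1 / real (Suc s)" if "j \<le> s" for s
    proof -
      have "cmod (cword_comb (m s) p) \<le> opnorm (ncpoly_eval_mat (k s) p (A s))"
        unfolding comb by (rule avg, rule moment_poly_bound[OF Ac V V1])
      moreover have "j \<in> {1..Suc s}" using j that by simp
      then have "\<bar>opnorm (ncpoly_eval_mat (k s) (P j) (A s)) - norm (ncpoly_eval (P j) x)\<bar> \<le> 1 / real (Suc s)"
        using G[of s] unfolding Gamma_top_def by blast
      ultimately show ?thesis by (simp add: j(2) abs_le_iff)
    qed
    then have "\<forall>\<^sub>F s in sequentially. cmod (cword_comb (m s) p) \<le> norm (ncpoly_eval p x) + 1 / real (Suc s)"
      by (auto simp: eventually_sequentially)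
    ultimately show ?thesis by (intro exI[of _ "\<lambda>s. norm (ncpoly_eval p x) + 1 / real (Suc s)"]) simp
  qed
  have 4: "0 \<le> cword_comb (m s) (nc_mult (nc_star p) p)" for s p
  proof -
    have "0 \<le> (\<Sum>a<W s. cword_comb (moment (k s) (A s) (V s a)) (nc_mult (nc_star p) p))"
      using moment_pos[OF Ac Asa V] by (intro sum_nonneg) auto
    then show ?thesis unfolding comb by (auto simp: less_eq_complex_def)
  qed
  have 5: "(\<lambda>s. m s (i # w) - m s (w @ [i])) \<longlonglongrightarrow> 0" for i w
  proof (rule tendsto_0_le[of "\<lambda>s. 1 / real (Suc s)" _ _ "2 * R ^ length w"])
    show "(\<lambda>s. 1 / real (Suc s)) \<longlonglongrightarrow> 0" by (intro LIMSEQ_Suc lim_1_over_n)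
    have "cmod (m s (i # w) - m s (w @ [i])) \<le> 2 * R ^ length w * (1 / real (Suc s))" for s
    proof -
      have "m s (i # w) - m s (w @ [i])
         = (\<Sum>a<W s. moment (k s) (A s) (V s a) (i # w) - moment (k s) (A s) (V s a) (w @ [i])) / of_nat (W s)"
        by (simp add: m_def sum_subtractf diff_divide_distrib)
      then show ?thesis by (simp only:) (rule avg, rule moment_commutator[OF Ac Asa AR V V1 Vc])
    qed
    then show "\<forall>\<^sub>F s in sequentially. norm (m s (i # w) - m s (w @ [i])) \<le> norm (1 / real (Suc s)) * (2 * R ^ length w)"
      by (simp add: mult.commute)
  qed
  show "(\<lambda>s. (\<Sum>a<W s. moment (k s) (A s) (V s a) w) / of_nat (W s)) \<longlonglongrightarrow> \<tau> (word_prod x w)"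
    using moments_converge_to_unique_trace(1)[OF sa gen uniq \<tau> 1 2 3 4 5] by (simp add: m_def)
  show "cmod (\<tau> b) \<le> norm b"
    using moments_converge_to_unique_trace(2)[OF sa gen uniq \<tau> 1 2 3 4 5] .
qed

section \<open>There are few almost commuting matrices\<close>

text \<open>The trace of the operator \<open>Z V = \<Sum>\<^sub>j a\<^sub>j V a\<^sub>j\<^sup>*\<close> on the span of \<open>w\<close> orthonormal matrices is at most \<open>sqrt w\<close> times the
  Hilbert-Schmidt norm of \<open>Z\<close>, by the inequalities of Cauchy-Schwarz and Bessel. As \<open>Z\<close> is a sum of tensor
  products, the square of that norm is the double sum on the right.\<close>

lemma trace_on_family_le:
  fixes a :: "'j \<Rightarrow> complex mat"
  assumes J: "finite J" and a: "\<And>j. j \<in> J \<Longrightarrow> a j \<in> carrier_mat k k"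
    and V: "\<And>\<alpha>. \<alpha> < w \<Longrightarrow> V \<alpha> \<in> carrier_mat k k" and o: "ons (sq k) (\<lambda>\<alpha>. ($$) (V \<alpha>)) {..<w}"
  shows "(cmod (\<Sum>\<alpha><w. \<Sum>j\<in>J. fip k (V \<alpha>) (a j * (V \<alpha> * mat_adjoint (a j)))))\<^sup>2
     \<le> real w * (\<Sum>i\<in>J. \<Sum>j\<in>J. (cmod (fip k (a j) (a i)))\<^sup>2)"
proof -
  define Z where "Z = (\<lambda>p q. \<Sum>j\<in>J. a j $$ (fst p, fst q) * cnj (a j $$ (snd p, snd q)))"
  define X where "X \<alpha> p = (\<Sum>q\<in>sq k. Z p q * V \<alpha> $$ q)" for \<alpha> p
  have prodX: "(\<Sum>j\<in>J. (a j * (V \<alpha> * mat_adjoint (a j))) $$ p) = X \<alpha> p" if al: "\<alpha> < w" and pq: "p \<in> sq k" for \<alpha> p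
  proof -
    obtain b c where p: "p = (b, c)" "b < k" "c < k" using pq by (auto simp: sq_def)
    have "(a j * (V \<alpha> * mat_adjoint (a j))) $$ p = (\<Sum>q\<in>sq k. a j $$ (b, fst q) * cnj (a j $$ (c, snd q)) * V \<alpha> $$ q)"
      if "j \<in> J" for j
    proof -
      have c1: "V \<alpha> * mat_adjoint (a j) \<in> carrier_mat k k"
        using V[OF \<open>\<alpha> < w\<close>] mat_adjoint_carrier[OF a[OF that]] by (rule mult_carrier_mat)
      have "(a j * (V \<alpha> * mat_adjoint (a j))) $$ p = (\<Sum>l<k. a j $$ (b, l) * (\<Sum>r<k. V \<alpha> $$ (l, r) * mat_adjoint (a j) $$ (r, c)))"
        unfolding p(1) mat_mult_index[OF a[OF that] c1 p(2,3)]
        by (intro sum.cong refl) (simp only: lessThan_iff mat_mult_index[OF V[OF \<open>\<alpha> < w\<close>] mat_adjoint_carrier[OF a[OF that]] _ p(3)])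
      also have "\<dots> = (\<Sum>l<k. a j $$ (b, l) * (\<Sum>r<k. V \<alpha> $$ (l, r) * cnj (a j $$ (c, r))))"
        using a[OF that] p by (intro sum.cong refl arg_cong2[where f = "(*)"]) (simp add: mat_adjoint_index)
      finally show ?thesis by (simp add: sum_sq sum_distrib_left mult_ac)
    qed
    then have "(\<Sum>j\<in>J. (a j * (V \<alpha> * mat_adjoint (a j))) $$ p) = (\<Sum>j\<in>J. \<Sum>q\<in>sq k. a j $$ (b, fst q) * cnj (a j $$ (c, snd q)) * V \<alpha> $$ q)"
      by (intro sum.cong) auto
    also have "\<dots> = X \<alpha> p" unfolding X_def Z_def p(1) by (subst sum.swap) (simp add: sum_distrib_right)
    finally show ?thesis .
  qed
  have inner: "(\<Sum>j\<in>J. fip k (V \<alpha>) (a j * (V \<alpha> * mat_adjoint (a j)))) = cip (sq k) (($$) (V \<alpha>)) (X \<alpha>)" if "\<alpha> < w" for \<alpha>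
    unfolding cip_sum_right[symmetric] by (rule cip_cong) (auto simp: prodX[OF that])
  have v1: "cnrm (sq k) (($$) (V \<alpha>)) = 1" if "\<alpha> < w" for \<alpha>
    using ons_norm_one[OF o] that by simp
  have "cmod (\<Sum>\<alpha><w. \<Sum>j\<in>J. fip k (V \<alpha>) (a j * (V \<alpha> * mat_adjoint (a j)))) \<le> (\<Sum>\<alpha><w. \<bar>1\<bar> * \<bar>cnrm (sq k) (X \<alpha>)\<bar>)"
  proof (rule order_trans[OF norm_sum sum_mono])
    fix \<alpha> assume "\<alpha> \<in> {..<w}"
    then show "cmod (\<Sum>j\<in>J. fip k (V \<alpha>) (a j * (V \<alpha> * mat_adjoint (a j)))) \<le> \<bar>1\<bar> * \<bar>cnrm (sq k) (X \<alpha>)\<bar>"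
      using cip_CS[of "sq k" "($$) (V \<alpha>)" "X \<alpha>"] inner v1 by simp
  qed
  also have "\<dots> \<le> L2_set (\<lambda>_. 1) {..<w} * L2_set (\<lambda>\<alpha>. cnrm (sq k) (X \<alpha>)) {..<w}" by (rule L2_set_mult_ineq)
  finally have "(cmod (\<Sum>\<alpha><w. \<Sum>j\<in>J. fip k (V \<alpha>) (a j * (V \<alpha> * mat_adjoint (a j)))))\<^sup>2
     \<le> (L2_set (\<lambda>_. 1) {..<w} * L2_set (\<lambda>\<alpha>. cnrm (sq k) (X \<alpha>)) {..<w})\<^sup>2" by (rule power_mono) simp
  also have "\<dots> = real w * (\<Sum>\<alpha><w. (cnrm (sq k) (X \<alpha>))\<^sup>2)"
    by (simp add: power_mult_distrib L2_set_def sum_nonneg)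
  also have "(\<Sum>\<alpha><w. (cnrm (sq k) (X \<alpha>))\<^sup>2) = (\<Sum>p\<in>sq k. \<Sum>\<alpha><w. (cmod (X \<alpha> p))\<^sup>2)"
    unfolding cnrm_sq by (rule sum.swap)
  also have "\<dots> \<le> (\<Sum>p\<in>sq k. \<Sum>q\<in>sq k. (cmod (Z p q))\<^sup>2)"
  proof (rule sum_mono)
    fix p
    have "(\<Sum>\<alpha><w. (cmod (X \<alpha> p))\<^sup>2) = (\<Sum>\<alpha><w. (cmod (cip (sq k) (($$) (V \<alpha>)) (\<lambda>q. cnj (Z p q))))\<^sup>2)"
    proof (rule sum.cong[OF refl])
      fix \<alpha>
      have "X \<alpha> p = cnj (cip (sq k) (($$) (V \<alpha>)) (\<lambda>q. cnj (Z p q)))"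
        by (simp add: X_def cip_def cnj_sum mult.commute)
      then show "(cmod (X \<alpha> p))\<^sup>2 = (cmod (cip (sq k) (($$) (V \<alpha>)) (\<lambda>q. cnj (Z p q))))\<^sup>2" by simp
    qed
    also have "\<dots> \<le> (cnrm (sq k) (\<lambda>q. cnj (Z p q)))\<^sup>2" by (rule bessel[OF finite_lessThan o])
    finally show "(\<Sum>\<alpha><w. (cmod (X \<alpha> p))\<^sup>2) \<le> (\<Sum>q\<in>sq k. (cmod (Z p q))\<^sup>2)" by (simp add: cnrm_sq)
  qed
  also have "\<dots> = (\<Sum>i\<in>J. \<Sum>j\<in>J. (cmod (fip k (a j) (a i)))\<^sup>2)"
  proof -
    have Zsum: "(\<Sum>p\<in>sq k. \<Sum>q\<in>sq k. g p q) = (\<Sum>b<k. \<Sum>l<k. \<Sum>c<k. \<Sum>r<k. g (b, c) (l, r))" for g :: "nat \<times> nat \<Rightarrow> nat \<times> nat \<Rightarrow> complex"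
      unfolding sum_sq by (intro sum.cong refl sum.swap)
    have "of_real (\<Sum>p\<in>sq k. \<Sum>q\<in>sq k. (cmod (Z p q))\<^sup>2) = (\<Sum>p\<in>sq k. \<Sum>q\<in>sq k. Z p q * cnj (Z p q))"
      by (simp add: complex_norm_square del: of_real_power)
    also have "\<dots> = (\<Sum>p\<in>sq k. \<Sum>q\<in>sq k. \<Sum>i\<in>J. \<Sum>j\<in>J.
        (cnj (a j $$ (fst p, fst q)) * a i $$ (fst p, fst q)) * (cnj (a i $$ (snd p, snd q)) * a j $$ (snd p, snd q)))"
      by (simp add: Z_def cnj_sum sum_product mult_ac)
    also have "\<dots> = (\<Sum>p\<in>sq k. \<Sum>i\<in>J. \<Sum>j\<in>J. \<Sum>q\<in>sq k.
        (cnj (a j $$ (fst p, fst q)) * a i $$ (fst p, fst q)) * (cnj (a i $$ (snd p, snd q)) * a j $$ (snd p, snd q)))"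
      by (intro sum.cong refl) (subst sum.swap, intro sum.cong refl sum.swap)
    also have "\<dots> = (\<Sum>i\<in>J. \<Sum>j\<in>J. \<Sum>p\<in>sq k. \<Sum>q\<in>sq k.
        (cnj (a j $$ (fst p, fst q)) * a i $$ (fst p, fst q)) * (cnj (a i $$ (snd p, snd q)) * a j $$ (snd p, snd q)))"
      by (subst sum.swap, intro sum.cong refl sum.swap)
    also have "\<dots> = (\<Sum>i\<in>J. \<Sum>j\<in>J. fip k (a j) (a i) * fip k (a i) (a j))"
      unfolding Zsum
      unfolding cip_def sum_sq fst_conv snd_conv
      by (intro sum.cong refl) (simp add: sum_distrib_right, simp add: sum_distrib_left)
    also have "\<dots> = (\<Sum>i\<in>J. \<Sum>j\<in>J. fip k (a j) (a i) * cnj (fip k (a j) (a i)))"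
      by (intro sum.cong refl arg_cong2[where f = "(*)"] cip_cnj)
    also have "\<dots> = of_real (\<Sum>i\<in>J. \<Sum>j\<in>J. (cmod (fip k (a j) (a i)))\<^sup>2)"
      by (simp add: complex_norm_square del: of_real_power)
    finally show ?thesis using of_real_eq_iff by blast
  qed
  finally show ?thesis by (simp add: mult_left_mono)
qed

lemma fnorm_mult_word_right_le:
  assumes "\<And>i. A i \<in> carrier_mat k k" "\<And>i. mat_adjoint (A i) = A i" "\<And>i. opnorm (A i) \<le> R" "Y \<in> carrier_mat k k"
  shows "fnorm k (Y * mat_word k A w) \<le> R ^ length w * fnorm k Y"
proof -
  have W: "mat_word k A w \<in> carrier_mat k k" by (rule mat_word_carrier[OF assms(1)])
  have "fnorm k (Y * mat_word k A w) = fnorm k (mat_adjoint (Y * mat_word k A w))"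
    using W assms by (intro fnorm_adjoint[symmetric] mult_carrier_mat)
  also have "\<dots> = fnorm k (mat_word k A (rev w) * mat_adjoint Y)"
    using W assms by (simp add: mat_adjoint_mult[of _ k] mat_adjoint_word)
  also have "\<dots> \<le> R ^ length (rev w) * fnorm k (mat_adjoint Y)"
    by (rule fnorm_word_mult_le[OF assms(1,3) mat_adjoint_carrier[OF assms(4)]])
  finally show ?thesis by (simp add: fnorm_adjoint[OF assms(4)])
qed

lemma word_commutator_le:
  fixes R \<theta> :: real
  assumes A: "\<And>i. A i \<in> carrier_mat k k" "\<And>i. mat_adjoint (A i) = A i" "\<And>i. opnorm (A i) \<le> R"
    and V: "V \<in> carrier_mat k k" and c: "\<And>i. fnorm k (A i * V - V * A i) \<le> \<theta>"
  shows "fnorm k (mat_word k A w * V - V * mat_word k A w) \<le> length w * (R + 1) ^ length w * \<theta>"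
proof (induction w)
  case Nil
  have "fnorm k (V - V) = 0" unfolding fnorm_diff[OF V V] by simp
  then show ?case using V by simp
next
  case (Cons i w)
  define M where "M = mat_word k A w"
  have M: "M \<in> carrier_mat k k" unfolding M_def by (rule mat_word_carrier[OF A(1)])
  have R: "0 \<le> R" using opnorm_nonneg[OF A(1)] A(3) order_trans by blast
  have t: "0 \<le> \<theta>" using c[of i] cnrm_nonneg order_trans by blast
  note [simp] = assoc_mult_mat[of _ k k _ k _ k]
  have X: "A i * (M * V) \<in> carrier_mat k k" "A i * (V * M) \<in> carrier_mat k k" "V * (A i * M) \<in> carrier_mat k k"
    "M * V \<in> carrier_mat k k" "V * M \<in> carrier_mat k k" "A i * V \<in> carrier_mat k k" "V * A i \<in> carrier_mat k k"
    using A(1)[of i] M V by (auto intro!: mult_carrier_mat)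
  have "fnorm k (A i * (M * V) - V * (A i * M)) \<le> fnorm k (A i * (M * V) - A i * (V * M)) + fnorm k (A i * (V * M) - V * (A i * M))"
    by (rule fnorm_triangle_diff[OF X(1-3)])
  also have "A i * (M * V) - A i * (V * M) = A i * (M * V - V * M)"
    using A(1)[of i] X by (simp only: mult_minus_distrib_mat[of _ k k _ k])
  also have "A i * (V * M) - V * (A i * M) = (A i * V - V * A i) * M"
    using A(1)[of i] M V X by (simp add: minus_mult_distrib_mat[of _ k k])
  also have "fnorm k (A i * (M * V - V * M)) \<le> R * (length w * (R + 1) ^ length w * \<theta>)"
  proof -
    have "M * V - V * M \<in> carrier_mat k k" using X by (simp add: minus_carrier_mat)
    then have "fnorm k (A i * (M * V - V * M)) \<le> opnorm (A i) * fnorm k (M * V - V * M)"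
      by (rule fnorm_mult_le[OF A(1)])
    also have "\<dots> \<le> R * (length w * (R + 1) ^ length w * \<theta>)"
      using Cons A(3) R by (intro mult_mono) (auto simp: M_def)
    finally show ?thesis .
  qed
  also have "fnorm k ((A i * V - V * A i) * M) \<le> R ^ length w * \<theta>"
  proof -
    have "A i * V - V * A i \<in> carrier_mat k k" using X by (simp add: minus_carrier_mat)
    then have "fnorm k ((A i * V - V * A i) * M) \<le> R ^ length w * fnorm k (A i * V - V * A i)"
      unfolding M_def by (rule fnorm_mult_word_right_le[OF A])
    also have "\<dots> \<le> R ^ length w * \<theta>" using c R by (intro mult_left_mono) auto
    finally show ?thesis .
  qed
  finally have "fnorm k (A i * (M * V) - V * (A i * M)) \<le> R * (length w * (R + 1) ^ length w * \<theta>) + R ^ length w * \<theta>"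
    by simp
  also have "\<dots> \<le> (R + 1) * (length w * (R + 1) ^ length w * \<theta>) + (R + 1) * (R + 1) ^ length w * \<theta>"
  proof (intro add_mono mult_right_mono t)
    have "R ^ length w \<le> (R + 1) ^ length w" using R by (intro power_mono) auto
    also have "\<dots> \<le> (R + 1) * (R + 1) ^ length w" using R by (simp add: mult_le_cancel_right1)
    finally show "R ^ length w \<le> (R + 1) * (R + 1) ^ length w" .
  qed (use R t in auto)
  also have "\<dots> = length (i # w) * (R + 1) ^ length (i # w) * \<theta>" by (simp add: algebra_simps)
  finally show ?case using A(1)[of i] M V by (simp add: M_def)
qed

lemma ncpoly_eval_mat_mult_right_index:
  assumes "\<And>i. A i \<in> carrier_mat k k" "Y \<in> carrier_mat k k" "q \<in> sq k"
  shows "(Y * ncpoly_eval_mat k p A) $$ q = (\<Sum>w\<in>Poly_Mapping.keys p. Poly_Mapping.lookup p w * (Y * mat_word k A w) $$ q)"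
proof -
  obtain i j where q: "q = (i, j)" "i < k" "j < k" using assms(3) by (auto simp: sq_def)
  have "(Y * ncpoly_eval_mat k p A) $$ (i, j) =
     (\<Sum>l<k. \<Sum>w\<in>Poly_Mapping.keys p. Poly_Mapping.lookup p w * (Y $$ (i, l) * mat_word k A w $$ (l, j)))"
    using q by (subst mat_mult_index[OF assms(2) ncpoly_eval_mat_carrier])
      (auto simp: ncpoly_eval_mat_index sum_distrib_left mult_ac)
  also have "\<dots> = (\<Sum>w\<in>Poly_Mapping.keys p. Poly_Mapping.lookup p w * (Y * mat_word k A w) $$ (i, j))"
    using q by (subst sum.swap) (simp add: mat_mult_index[OF assms(2) mat_word_carrier[OF assms(1)]] sum_distrib_left del: index_mult_mat)
  finally show ?thesis using q by simp
qed

lemma fip_ncpoly_adjoint_right: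
  assumes A: "\<And>i. A i \<in> carrier_mat k k" "\<And>i. mat_adjoint (A i) = A i" and XY: "X \<in> carrier_mat k k" "Y \<in> carrier_mat k k"
  shows "fip k X (Y * mat_adjoint (ncpoly_eval_mat k p A))
    = (\<Sum>u\<in>Poly_Mapping.keys p. cnj (Poly_Mapping.lookup p u) * fip k X (Y * mat_word k A (rev u)))"
proof -
  have W: "mat_word k A w \<in> carrier_mat k k" for w by (rule mat_word_carrier[OF A(1)])
  have "fip k X (Y * mat_adjoint (ncpoly_eval_mat k p A)) = fip k (X * ncpoly_eval_mat k p A) Y"
    by (rule fip_mult_right[symmetric, OF ncpoly_eval_mat_carrier XY])
  also have "\<dots> = cip (sq k) (\<lambda>q. \<Sum>w\<in>Poly_Mapping.keys p. Poly_Mapping.lookup p w * (X * mat_word k A w) $$ q) (($$) Y)"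
    by (rule cip_cong) (auto simp: ncpoly_eval_mat_mult_right_index[OF A(1) XY(1)])
  also have "\<dots> = (\<Sum>u\<in>Poly_Mapping.keys p. cnj (Poly_Mapping.lookup p u) * fip k (X * mat_word k A u) Y)"
    by (simp add: cip_sum_left cip_scale_left)
  also have "\<dots> = (\<Sum>u\<in>Poly_Mapping.keys p. cnj (Poly_Mapping.lookup p u) * fip k X (Y * mat_word k A (rev u)))"
    by (intro sum.cong refl arg_cong2[where f = "(*)"]) (simp add: fip_mult_right[OF W XY] mat_adjoint_word[OF A])
  finally show ?thesis .
qed

text \<open>For \<open>V\<close> nearly commuting with \<open>A\<close> and \<open>a = p(A)\<close>, \<open>a V a\<^sup>*\<close> is near \<open>a a\<^sup>* V\<close>. What matters about the constant is that it depends on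
  \<open>p\<close> and \<open>R\<close> but not on \<open>k\<close>.\<close>

lemma sandwich_near_moment:
  fixes R \<theta> :: real
  assumes A: "\<And>i. A i \<in> carrier_mat k k" "\<And>i. mat_adjoint (A i) = A i" "\<And>i. opnorm (A i) \<le> R"
    and V: "V \<in> carrier_mat k k" "fnorm k V = 1" and c: "\<And>i. fnorm k (A i * V - V * A i) \<le> \<theta>"
  shows "cmod (fip k V (ncpoly_eval_mat k p A * (V * mat_adjoint (ncpoly_eval_mat k p A)))
     - cword_comb (moment k A V) (nc_mult p (nc_star p)))
    \<le> (\<Sum>v\<in>Poly_Mapping.keys p. \<Sum>u\<in>Poly_Mapping.keys p. cmod (Poly_Mapping.lookup p v) * cmod (Poly_Mapping.lookup p u)
        * (R ^ length v * (length u * (R + 1) ^ length u))) * \<theta>"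
proof -
  let ?K = "Poly_Mapping.keys p" and ?c = "Poly_Mapping.lookup p" and ?a = "ncpoly_eval_mat k p A"
  have W: "mat_word k A w \<in> carrier_mat k k" for w by (rule mat_word_carrier[OF A(1)])
  note assoc = assoc_mult_mat[of _ k k _ k _ k]
  have Va: "V * mat_adjoint ?a \<in> carrier_mat k k"
    using V(1) mat_adjoint_carrier[OF ncpoly_eval_mat_carrier[of k p A]] by (rule mult_carrier_mat)
  have R: "0 \<le> R" using opnorm_nonneg[OF A(1)] A(3) order_trans by blast
  have t: "0 \<le> \<theta>" using c[of undefined] cnrm_nonneg order_trans by blast
  have s: "fip k V (?a * (V * mat_adjoint ?a)) = (\<Sum>v\<in>?K. \<Sum>u\<in>?K. ?c v * cnj (?c u) * fip k V ((mat_word k A v * V) * mat_word k A (rev u)))"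
  proof -
    have "fip k V (?a * (V * mat_adjoint ?a)) = (\<Sum>v\<in>?K. ?c v * fip k V ((mat_word k A v * V) * mat_adjoint ?a))"
      unfolding fip_ncpoly_left[OF A(1) Va] using W V mat_adjoint_carrier[OF ncpoly_eval_mat_carrier[of k p A]] by (simp add: assoc)
    also have "\<dots> = (\<Sum>v\<in>?K. \<Sum>u\<in>?K. ?c v * cnj (?c u) * fip k V ((mat_word k A v * V) * mat_word k A (rev u)))"
      using mult_carrier_mat[OF W V(1)] by (simp add: fip_ncpoly_adjoint_right[OF A(1,2) V(1)] sum_distrib_left mult.assoc)
    finally show ?thesis .
  qed
  have m: "cword_comb (moment k A V) (nc_mult p (nc_star p))
     = (\<Sum>v\<in>?K. \<Sum>u\<in>?K. ?c v * cnj (?c u) * fip k V (mat_word k A v * (mat_word k A (rev u) * V)))"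
  proof -
    have "cword_comb f (nc_mult p q) = (\<Sum>v\<in>?K. ?c v * cword_comb (\<lambda>w. f (v @ w)) q)" for f q
      unfolding cword_comb_mult by (simp add: word_comb_def sum_distrib_left mult.assoc)
    then show ?thesis
      by (simp add: cword_comb_star moment_def mat_word_append[OF A(1)] assoc[OF W W V(1)] sum_distrib_left mult.assoc)
  qed
  have d: "cmod (fip k V ((mat_word k A v * V) * mat_word k A (rev u)) - fip k V (mat_word k A v * (mat_word k A (rev u) * V)))
     \<le> R ^ length v * (length u * (R + 1) ^ length u) * \<theta>" for u v
  proof -
    let ?r = "rev u"
    have car: "V * mat_word k A ?r \<in> carrier_mat k k" "mat_word k A ?r * V \<in> carrier_mat k k"
      using W V by (auto intro!: mult_carrier_mat)
    have dc: "V * mat_word k A ?r - mat_word k A ?r * V \<in> carrier_mat k k" using car by (simp add: minus_carrier_mat)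
    have "fip k V ((mat_word k A v * V) * mat_word k A ?r) - fip k V (mat_word k A v * (mat_word k A ?r * V))
       = fip k V (mat_word k A v * (V * mat_word k A ?r - mat_word k A ?r * V))"
      unfolding fip_diff_right[OF mult_carrier_mat[OF W car(1)] mult_carrier_mat[OF W car(2)], symmetric]
        mult_minus_distrib_mat[OF W car] assoc[OF W V(1) W] ..
    then have "cmod (fip k V ((mat_word k A v * V) * mat_word k A ?r) - fip k V (mat_word k A v * (mat_word k A ?r * V)))
       \<le> fnorm k V * fnorm k (mat_word k A v * (V * mat_word k A ?r - mat_word k A ?r * V))"
      using cip_CS by metis
    also have "\<dots> \<le> 1 * (R ^ length v * fnorm k (V * mat_word k A ?r - mat_word k A ?r * V))"
      unfolding V(2) by (intro mult_left_mono fnorm_word_mult_le[OF A(1,3) dc]) auto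
    also have "\<dots> \<le> 1 * (R ^ length v * (length ?r * (R + 1) ^ length ?r * \<theta>))"
      unfolding fnorm_minus_commute[OF car]
      using R by (intro mult_left_mono word_commutator_le[OF A V(1) c]) auto
    finally show ?thesis by (simp add: mult.assoc)
  qed
  have "cmod (fip k V (?a * (V * mat_adjoint ?a)) - cword_comb (moment k A V) (nc_mult p (nc_star p)))
    = cmod (\<Sum>v\<in>?K. \<Sum>u\<in>?K. ?c v * cnj (?c u) *
      (fip k V ((mat_word k A v * V) * mat_word k A (rev u)) - fip k V (mat_word k A v * (mat_word k A (rev u) * V))))"
    unfolding s m by (simp only: sum_subtractf[symmetric] right_diff_distrib)
  also have "\<dots> \<le> (\<Sum>v\<in>?K. \<Sum>u\<in>?K. cmod (?c v) * cmod (?c u) * (R ^ length v * (length u * (R + 1) ^ length u) * \<theta>))"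
  proof (intro order_trans[OF norm_sum] sum_mono)
    fix v u
    show "cmod (?c v * cnj (?c u) *
      (fip k V ((mat_word k A v * V) * mat_word k A (rev u)) - fip k V (mat_word k A v * (mat_word k A (rev u) * V))))
      \<le> cmod (?c v) * cmod (?c u) * (R ^ length v * (length u * (R + 1) ^ length u) * \<theta>)"
      unfolding norm_mult complex_mod_cnj by (intro mult_left_mono d) auto
  qed
  also have "\<dots> = (\<Sum>v\<in>?K. \<Sum>u\<in>?K. cmod (?c v) * cmod (?c u) * (R ^ length v * (length u * (R + 1) ^ length u))) * \<theta>"
    by (simp only: sum_distrib_right mult.assoc)
  finally show ?thesis .
qed

lemma tracial_state_tendsto:
  assumes "tracial_state \<tau>" "\<And>a. cmod (\<tau> a) \<le> norm a" "f \<longlonglongrightarrow> l"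
  shows "(\<lambda>n. \<tau> (f n)) \<longlonglongrightarrow> \<tau> l"
proof (rule LIM_zero_cancel, rule tendsto_0_le[of "\<lambda>n. f n - l" _ _ 1])
  show "(\<lambda>n. f n - l) \<longlonglongrightarrow> 0" using assms(3) by (rule LIM_zero)
qed (use assms(2) in \<open>simp flip: tracial_state_diff[OF assms(1)]\<close>)

lemma tracial_state_poly:
  assumes "tracial_state \<tau>"
  shows "\<tau> (ncpoly_eval p x) = cword_comb (\<lambda>w. \<tau> (word_prod x w)) p"
  using assms unfolding ncpoly_eval_def tracial_state_sum[OF assms] word_comb_def
  by (simp add: tracial_state_def)

lemma tendsto_cword_comb:
  "(\<And>w. (\<lambda>s. m s w) \<longlonglongrightarrow> l w) \<Longrightarrow> (\<lambda>s. cword_comb (m s) p) \<longlonglongrightarrow> cword_comb l p"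
  unfolding word_comb_def by (intro tendsto_sum tendsto_mult tendsto_const) auto

lemma fip_poly_poly:
  assumes A: "\<And>i. A i \<in> carrier_mat k k" "\<And>i. mat_adjoint (A i) = A i" and k: "0 < k"
  shows "fip k (ncpoly_eval_mat k p A) (ncpoly_eval_mat k q A)
     = of_nat k * cword_comb (moment k A (of_real (1 / sqrt k) \<cdot>\<^sub>m 1\<^sub>m k)) (nc_mult (nc_star p) q)"
proof -
  let ?V = "of_real (1 / sqrt k) \<cdot>\<^sub>m 1\<^sub>m k :: complex mat"
  have W: "mat_word k A w \<in> carrier_mat k k" for w by (rule mat_word_carrier[OF A(1)])
  have Wd: "dim_row (mat_word k A w) = k" "dim_col (mat_word k A w) = k" for w using W[of w] by auto
  have m: "of_nat k * moment k A ?V (rev v @ w) = fip k (mat_word k A v) (mat_word k A w)" for v w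
  proof -
    have "mat_word k A (rev v @ w) * ?V = of_real (1 / sqrt k) \<cdot>\<^sub>m mat_word k A (rev v @ w)"
      using W[of "rev v @ w"] by (simp add: mult_smult_distrib[OF W one_carrier_mat])
    then have "moment k A ?V (rev v @ w)
       = cip (sq k) (\<lambda>q. of_real (1 / sqrt k) * 1\<^sub>m k $$ q) (\<lambda>q. of_real (1 / sqrt k) * mat_word k A (rev v @ w) $$ q)"
      unfolding moment_def by (simp only:) (rule cip_cong, auto simp: sq_def Wd)
    also have "\<dots> = of_real (1 / sqrt k) * (of_real (1 / sqrt k) * fip k (1\<^sub>m k) (mat_word k A (rev v @ w)))"
      by (simp only: cip_scale_left cip_scale_right complex_cnj_complex_of_real)
    also have "fip k (1\<^sub>m k) (mat_word k A (rev v @ w)) = fip k (mat_word k A v) (mat_word k A w)"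
    proof -
      have "fip k (mat_word k A v * 1\<^sub>m k) (mat_word k A w) = fip k (1\<^sub>m k) (mat_adjoint (mat_word k A v) * mat_word k A w)"
        by (rule fip_mult_left[OF W one_carrier_mat W])
      then show ?thesis by (simp add: Wd mat_adjoint_word[OF A] mat_word_append[OF A(1)])
    qed
    finally have "moment k A ?V (rev v @ w) = of_real (1 / sqrt k * (1 / sqrt k)) * fip k (mat_word k A v) (mat_word k A w)"
      by (simp only: of_real_mult mult.assoc)
    also have "1 / sqrt k * (1 / sqrt k) = 1 / real k" using k by simp
    finally show ?thesis using k by simp
  qed
  have "fip k (ncpoly_eval_mat k p A) (ncpoly_eval_mat k q A)
     = cip (sq k) (\<lambda>r. \<Sum>v\<in>Poly_Mapping.keys p. Poly_Mapping.lookup p v * mat_word k A v $$ r)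
        (\<lambda>r. \<Sum>w\<in>Poly_Mapping.keys q. Poly_Mapping.lookup q w * mat_word k A w $$ r)"
    by (rule cip_cong) (auto simp: sq_def ncpoly_eval_mat_index)
  also have "\<dots> = (\<Sum>v\<in>Poly_Mapping.keys p. \<Sum>w\<in>Poly_Mapping.keys q.
      cnj (Poly_Mapping.lookup p v) * Poly_Mapping.lookup q w * fip k (mat_word k A v) (mat_word k A w))"
    unfolding cip_sum_left cip_sum_right by (simp add: cip_scale_left cip_scale_right mult_ac)
  also have "\<dots> = of_nat k * cword_comb (moment k A ?V) (nc_mult (nc_star p) q)"
    unfolding cword_comb_star_mult m[symmetric] by (simp add: sum_distrib_left mult_ac)
  finally show ?thesis .
qed

lemma normalized_identity:
  assumes "0 < k"
  shows "of_real (1 / sqrt k) \<cdot>\<^sub>m 1\<^sub>m k \<in> carrier_mat k k"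
    and "fnorm k (of_real (1 / sqrt k) \<cdot>\<^sub>m 1\<^sub>m k) = 1"
    and "A \<in> carrier_mat k k \<Longrightarrow> fnorm k (A * (of_real (1 / sqrt k) \<cdot>\<^sub>m 1\<^sub>m k) - (of_real (1 / sqrt k) \<cdot>\<^sub>m 1\<^sub>m k) * A) = 0"
proof -
  show "of_real (1 / sqrt k) \<cdot>\<^sub>m 1\<^sub>m k \<in> carrier_mat k k" by simp
  have "fnorm k (of_real (1 / sqrt k) \<cdot>\<^sub>m 1\<^sub>m k) = cnrm (sq k) (\<lambda>q. of_real (1 / sqrt k) * 1\<^sub>m k $$ q)"
    by (rule cnrm_cong) (auto simp: sq_def)
  also have "\<dots> = 1 / sqrt k * fnorm k (1\<^sub>m k)" unfolding cnrm_scale by (simp add: norm_divide)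
  also have "fnorm k (1\<^sub>m k) = sqrt k" by (rule fnorm_one)
  finally show "fnorm k (of_real (1 / sqrt k) \<cdot>\<^sub>m 1\<^sub>m k) = 1" using assms by simp
  assume A: "A \<in> carrier_mat k k"
  have "A * (of_real (1 / sqrt k) \<cdot>\<^sub>m 1\<^sub>m k) = of_real (1 / sqrt k) \<cdot>\<^sub>m A"
    "(of_real (1 / sqrt k) \<cdot>\<^sub>m 1\<^sub>m k) * A = of_real (1 / sqrt k) \<cdot>\<^sub>m A"
    using A mult_smult_distrib[OF A one_carrier_mat] mult_smult_assoc_mat[OF one_carrier_mat A] by auto
  then show "fnorm k (A * (of_real (1 / sqrt k) \<cdot>\<^sub>m 1\<^sub>m k) - (of_real (1 / sqrt k) \<cdot>\<^sub>m 1\<^sub>m k) * A) = 0"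
    using fnorm_diff[of "of_real (1 / sqrt k) \<cdot>\<^sub>m A" k "of_real (1 / sqrt k) \<cdot>\<^sub>m A"] A by simp
qed

text \<open>The estimate \<open>trace_on_family_le\<close> for \<open>a\<^sub>j = p\<^sub>j(A s)\<close>, divided by the square of the size of the family, passes to the limit: the
  left side is a family average and the right side consists of normalised traces.\<close>

lemma large_families_contradict_orthonormality:
  fixes x :: "'n::finite \<Rightarrow> 'a::unital_cstar_algebra" and P :: "nat \<Rightarrow> 'n ncpoly" and \<gamma> :: real
    and \<tau> :: "'a \<Rightarrow> complex" and a :: "nat \<Rightarrow> 'a" and m :: nat
  assumes P: "P ` {1..} = rational_ncpolys"
    and sa: "\<And>i. cstar (x i) = x i" and gen: "generates_cstar (range x)"
    and uniq: "\<exists>!\<tau> :: 'a \<Rightarrow> complex. tracial_state \<tau>" and \<tau>: "tracial_state \<tau>"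
    and \<gamma>: "0 < \<gamma>"
    and G: "\<And>s. A s \<in> Gamma_top P R x (k s) (1 / real (Suc s)) (Suc s)"
    and V: "\<And>s a. a < W s \<Longrightarrow> V s a \<in> carrier_mat (k s) (k s)"
    and o: "\<And>s. ons (sq (k s)) (\<lambda>a. ($$) (V s a)) {..<W s}"
    and Vc: "\<And>s a i. a < W s \<Longrightarrow> fnorm (k s) (A s i * V s a - V s a * A s i) \<le> 1 / real (Suc s)"
    and W: "\<And>s. \<gamma> * (real (k s))\<^sup>2 < real (W s)"
  shows "\<gamma> * (cmod (\<Sum>j<m. \<tau> (a j * cstar (a j))))\<^sup>2 \<le> (\<Sum>i<m. \<Sum>j<m. (cmod (\<tau> (cstar (a j) * a i)))\<^sup>2)"
    and "cmod (\<tau> b) \<le> norm b"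
proof -
  have W0: "0 < W s" for s
  proof -
    have "0 \<le> \<gamma> * (real (k s))\<^sup>2" using \<gamma> by simp
    then show ?thesis using W[of s] by linarith
  qed
  have V1: "fnorm (k s) (V s a) = 1" if "a < W s" for s a using ons_norm_one[OF o[of s]] that by simp
  have k0: "0 < k s" for s
    using V1[OF W0[of s]] by (cases "k s") (auto simp: cnrm_def L2_set_def sq_def)
  have Ac: "A s i \<in> carrier_mat (k s) (k s)" and Asa: "mat_adjoint (A s i) = A s i" and AR: "opnorm (A s i) \<le> R" for s i
    using G[of s] by (auto simp: Gamma_top_def)
  have R: "0 \<le> R" using opnorm_nonneg[OF Ac[of 0 undefined]] AR[of 0 undefined] by simp
  define m1 where "m1 s w = (\<Sum>a<W s. moment (k s) (A s) (V s a) w) / of_nat (W s)" for s w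
  \<comment> \<open>The normalised trace is the case of a family with one member, which commutes with everything.\<close>
  define m2 where "m2 s = moment (k s) (A s) (of_real (1 / sqrt (k s)) \<cdot>\<^sub>m 1\<^sub>m (k s))" for s
  have l1: "(\<lambda>s. m1 s w) \<longlonglongrightarrow> \<tau> (word_prod x w)" for w
    unfolding m1_def by (rule family_moments_converge(1)[OF P sa gen uniq \<tau> G W0 V V1 Vc])
  show bd: "cmod (\<tau> b) \<le> norm b" for b
    by (rule family_moments_converge(2)[OF P sa gen uniq \<tau> G W0 V V1 Vc])
  have l2: "(\<lambda>s. m2 s w) \<longlonglongrightarrow> \<tau> (word_prod x w)" for w
  proof -
    have "(\<lambda>s. (\<Sum>a<(1::nat). moment (k s) (A s) (of_real (1 / sqrt (k s)) \<cdot>\<^sub>m 1\<^sub>m (k s)) w) / of_nat 1) \<longlonglongrightarrow> \<tau> (word_prod x w)"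
      by (rule family_moments_converge(1)[OF P sa gen uniq \<tau> G])
        (use normalized_identity[OF k0] Ac in auto)
    then show ?thesis by (simp add: m2_def)
  qed
  have comb1: "cword_comb (m1 s) p = (\<Sum>a<W s. cword_comb (moment (k s) (A s) (V s a)) p) / of_nat (W s)" for s p
    unfolding word_comb_def m1_def by (subst sum.swap) (simp add: sum_divide_distrib sum_distrib_left)
  have poly: "\<gamma> * (cmod (\<Sum>j<m. \<tau> (ncpoly_eval (p j) x * cstar (ncpoly_eval (p j) x))))\<^sup>2
     \<le> (\<Sum>i<m. \<Sum>j<m. (cmod (\<tau> (cstar (ncpoly_eval (p j) x) * ncpoly_eval (p i) x)))\<^sup>2)" for p :: "nat \<Rightarrow> 'n ncpoly"
  proof (rule LIMSEQ_le)
    define T where "T s = (\<Sum>a<W s. \<Sum>j<m. fip (k s) (V s a) (ncpoly_eval_mat (k s) (p j) (A s) *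
       (V s a * mat_adjoint (ncpoly_eval_mat (k s) (p j) (A s))))) / of_nat (W s)" for s
    define C where "C j = (\<Sum>v\<in>Poly_Mapping.keys (p j). \<Sum>u\<in>Poly_Mapping.keys (p j). cmod (Poly_Mapping.lookup (p j) v) *
       cmod (Poly_Mapping.lookup (p j) u) * (R ^ length v * (length u * (R + 1) ^ length u)))" for j
    have near: "cmod (T s - (\<Sum>j<m. cword_comb (m1 s) (nc_mult (p j) (nc_star (p j))))) \<le> (1 / real (Suc s)) * (\<Sum>j<m. C j)" for s
    proof -
      let ?t = "\<lambda>a j. fip (k s) (V s a) (ncpoly_eval_mat (k s) (p j) (A s) *
         (V s a * mat_adjoint (ncpoly_eval_mat (k s) (p j) (A s))))"
      let ?u = "\<lambda>a j. cword_comb (moment (k s) (A s) (V s a)) (nc_mult (p j) (nc_star (p j)))"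
      have "(\<Sum>j<m. cword_comb (m1 s) (nc_mult (p j) (nc_star (p j)))) = (\<Sum>a<W s. \<Sum>j<m. ?u a j) / of_nat (W s)"
        unfolding comb1 by (subst sum.swap) (simp add: sum_divide_distrib)
      then have "T s - (\<Sum>j<m. cword_comb (m1 s) (nc_mult (p j) (nc_star (p j)))) = (\<Sum>a<W s. \<Sum>j<m. ?t a j - ?u a j) / of_nat (W s)"
        by (simp add: T_def sum_subtractf diff_divide_distrib)
      moreover have "cmod (\<Sum>a<W s. \<Sum>j<m. ?t a j - ?u a j) \<le> (\<Sum>a<W s. \<Sum>j<m. C j * (1 / real (Suc s)))"
      proof (intro order_trans[OF norm_sum] sum_mono)
        fix a j assume "a \<in> {..<W s}"
        then have a: "a < W s" by simp
        show "cmod (?t a j - ?u a j) \<le> C j * (1 / real (Suc s))"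
          unfolding C_def by (rule sandwich_near_moment[OF Ac Asa AR V[OF a] V1[OF a] Vc[OF a]])
      qed
      moreover have "(\<Sum>a<W s. \<Sum>j<m. C j * (1 / real (Suc s))) = of_nat (W s) * ((1 / real (Suc s)) * (\<Sum>j<m. C j))"
      proof -
        have "(\<Sum>j<m. C j * (1 / real (Suc s))) = (1 / real (Suc s)) * (\<Sum>j<m. C j)"
          unfolding sum_distrib_left by (simp only: mult.commute)
        then show ?thesis by simp
      qed
      ultimately show ?thesis using W0[of s] by (simp add: norm_divide divide_le_eq mult_ac)
    qed
    have "(\<lambda>s. T s - (\<Sum>j<m. cword_comb (m1 s) (nc_mult (p j) (nc_star (p j))))) \<longlonglongrightarrow> 0"
    proof (rule tendsto_0_le[of "\<lambda>s. 1 / real (Suc s)" _ _ "\<Sum>j<m. C j"])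
      show "(\<lambda>s. 1 / real (Suc s)) \<longlonglongrightarrow> 0" by (intro LIMSEQ_Suc lim_1_over_n)
    qed (use near in \<open>auto intro!: always_eventually\<close>)
    moreover have "(\<lambda>s. \<Sum>j<m. cword_comb (m1 s) (nc_mult (p j) (nc_star (p j))))
       \<longlonglongrightarrow> (\<Sum>j<m. cword_comb (\<lambda>w. \<tau> (word_prod x w)) (nc_mult (p j) (nc_star (p j))))"
      by (intro tendsto_sum tendsto_cword_comb l1)
    ultimately have "T \<longlonglongrightarrow> (\<Sum>j<m. cword_comb (\<lambda>w. \<tau> (word_prod x w)) (nc_mult (p j) (nc_star (p j))))"
      using Lim_transform by blast
    then have "T \<longlonglongrightarrow> (\<Sum>j<m. \<tau> (ncpoly_eval (p j) x * cstar (ncpoly_eval (p j) x)))"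
      by (simp add: tracial_state_poly[OF \<tau>, symmetric] ncpoly_eval_mult ncpoly_eval_star[OF sa])
    then show "(\<lambda>s. \<gamma> * (cmod (T s))\<^sup>2) \<longlonglongrightarrow> \<gamma> * (cmod (\<Sum>j<m. \<tau> (ncpoly_eval (p j) x * cstar (ncpoly_eval (p j) x))))\<^sup>2"
      by (intro tendsto_intros)
    define S where "S s = (\<Sum>i<m. \<Sum>j<m. (cmod (cword_comb (m2 s) (nc_mult (nc_star (p j)) (p i))))\<^sup>2)" for s
    have "S \<longlonglongrightarrow> (\<Sum>i<m. \<Sum>j<m. (cmod (cword_comb (\<lambda>w. \<tau> (word_prod x w)) (nc_mult (nc_star (p j)) (p i))))\<^sup>2)"
      unfolding S_def by (intro tendsto_intros tendsto_cword_comb l2)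
    then show "S \<longlonglongrightarrow> (\<Sum>i<m. \<Sum>j<m. (cmod (\<tau> (cstar (ncpoly_eval (p j) x) * ncpoly_eval (p i) x)))\<^sup>2)"
      by (simp add: tracial_state_poly[OF \<tau>, symmetric] ncpoly_eval_mult ncpoly_eval_star[OF sa])
    have "\<gamma> * (cmod (T s))\<^sup>2 \<le> S s" for s
    proof -
      define w where "w = real (W s)"
      have w: "0 < w" using W0[of s] by (simp add: w_def)
      define N where "N = (\<Sum>a<W s. \<Sum>j<m. fip (k s) (V s a) (ncpoly_eval_mat (k s) (p j) (A s) *
         (V s a * mat_adjoint (ncpoly_eval_mat (k s) (p j) (A s)))))"
      have TN: "cmod (T s) = cmod N / w" by (simp add: T_def N_def w_def norm_divide)
      have "(cmod N)\<^sup>2 \<le> w * (\<Sum>i<m. \<Sum>j<m. (cmod (fip (k s) (ncpoly_eval_mat (k s) (p j) (A s)) (ncpoly_eval_mat (k s) (p i) (A s))))\<^sup>2)"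
        unfolding N_def w_def by (rule trace_on_family_le[OF _ _ V o]) auto
      also have "\<dots> = w * ((real (k s))\<^sup>2 * S s)"
        unfolding S_def m2_def fip_poly_poly[OF Ac Asa k0]
        by (simp add: norm_mult power_mult_distrib sum_distrib_left)
      finally have "(cmod N)\<^sup>2 \<le> w * ((real (k s))\<^sup>2 * S s)" .
      then have "\<gamma> * (cmod N)\<^sup>2 \<le> \<gamma> * (w * ((real (k s))\<^sup>2 * S s))" using \<gamma> by simp
      also have "\<dots> = w * S s * (\<gamma> * (real (k s))\<^sup>2)" by simp
      also have "\<dots> \<le> w * S s * w"
        using W[of s] w by (intro mult_left_mono) (auto simp: w_def S_def sum_nonneg)
      finally have "\<gamma> * (cmod N)\<^sup>2 \<le> S s * w\<^sup>2" by (simp add: power2_eq_square mult_ac)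
      then show ?thesis using w by (simp add: TN power_divide divide_le_eq)
    qed
    then show "\<exists>N. \<forall>s\<ge>N. \<gamma> * (cmod (T s))\<^sup>2 \<le> S s" by blast
  qed
  have "\<forall>b. \<exists>p. (\<lambda>n. ncpoly_eval (p n) x) \<longlonglongrightarrow> b" using ncpoly_eval_dense[OF sa gen] by metis
  then obtain Q where Q: "\<And>b. (\<lambda>n. ncpoly_eval (Q b n) x) \<longlonglongrightarrow> b" by metis
  show "\<gamma> * (cmod (\<Sum>j<m. \<tau> (a j * cstar (a j))))\<^sup>2 \<le> (\<Sum>i<m. \<Sum>j<m. (cmod (\<tau> (cstar (a j) * a i)))\<^sup>2)"
  proof (rule LIMSEQ_le)
    show "(\<lambda>n. \<gamma> * (cmod (\<Sum>j<m. \<tau> (ncpoly_eval (Q (a j) n) x * cstar (ncpoly_eval (Q (a j) n) x))))\<^sup>2)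
       \<longlonglongrightarrow> \<gamma> * (cmod (\<Sum>j<m. \<tau> (a j * cstar (a j))))\<^sup>2"
      by (intro tendsto_intros tracial_state_tendsto[OF \<tau> bd] Q)
    show "(\<lambda>n. \<Sum>i<m. \<Sum>j<m. (cmod (\<tau> (cstar (ncpoly_eval (Q (a j) n) x) * ncpoly_eval (Q (a i) n) x)))\<^sup>2)
       \<longlonglongrightarrow> (\<Sum>i<m. \<Sum>j<m. (cmod (\<tau> (cstar (a j) * a i)))\<^sup>2)"
      by (intro tendsto_intros tracial_state_tendsto[OF \<tau> bd] Q)
  qed (intro exI allI impI, rule poly)
qed

text \<open>Otherwise there are microstates violating the bound for all tolerances \<open>1 / (s + 1)\<close>, and orthonormal elements
  \<open>a 0, ..., a (m - 1)\<close> with \<open>m > 1 / \<gamma>\<close> contradict the limiting inequality.\<close>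

lemma small_almost_commutant:
  fixes x :: "'n::finite \<Rightarrow> 'a::unital_cstar_algebra" and P :: "nat \<Rightarrow> 'n ncpoly" and \<gamma> :: real
  assumes P: "P ` {1..} = rational_ncpolys"
    and inf: "infinite_dimensional TYPE('a)" and simple: "simple_cstar TYPE('a)"
    and uniq: "\<exists>!\<tau> :: 'a \<Rightarrow> complex. tracial_state \<tau>"
    and sa: "\<And>i. cstar (x i) = x i" and gen: "generates_cstar (range x)"
    and \<gamma>: "0 < \<gamma>"
  obtains \<epsilon> r \<theta> where "0 < \<epsilon>" "1 \<le> (r::nat)" "0 < \<theta>"
    "\<And>k A w V. A \<in> Gamma_top P R x k \<epsilon> r \<Longrightarrow> (\<And>a. a < w \<Longrightarrow> V a \<in> carrier_mat k k) \<Longrightarrow>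
       ons (sq k) (\<lambda>a. ($$) (V a)) {..<w} \<Longrightarrow> (\<And>a i. a < w \<Longrightarrow> fnorm k (A i * V a - V a * A i) \<le> \<theta>) \<Longrightarrow>
       real w \<le> \<gamma> * (real k)\<^sup>2"
proof (rule ccontr)
  assume no: "\<not> thesis"
  obtain \<tau> :: "'a \<Rightarrow> complex" where \<tau>: "tracial_state \<tau>" using uniq by blast
  have "\<exists>k A (w :: nat) V. A \<in> Gamma_top P R x k (1 / real (Suc s)) (Suc s) \<and> (\<forall>a<w. V a \<in> carrier_mat k k) \<and>
       ons (sq k) (\<lambda>a. ($$) (V a)) {..<w} \<and> (\<forall>a i. a < w \<longrightarrow> fnorm k (A i * V a - V a * A i) \<le> 1 / real (Suc s)) \<and>
       \<gamma> * (real k)\<^sup>2 < real w" for s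
  proof (rule ccontr)
    assume n: "\<not> ?thesis"
    show False
    proof (rule notE[OF no], rule that[of "1 / real (Suc s)" "Suc s" "1 / real (Suc s)"])
      fix k A and w :: nat and V
      assume "A \<in> Gamma_top P R x k (1 / real (Suc s)) (Suc s)" "\<And>a. a < w \<Longrightarrow> V a \<in> carrier_mat k k"
       "ons (sq k) (\<lambda>a. ($$) (V a)) {..<w}" "\<And>a i. a < w \<Longrightarrow> fnorm k (A i * V a - V a * A i) \<le> 1 / real (Suc s)"
      then show "real w \<le> \<gamma> * (real k)\<^sup>2" using n by (meson not_le)
    qed auto
  qed
  then obtain k A w V where f: "\<And>s. A s \<in> Gamma_top P R x (k s) (1 / real (Suc s)) (Suc s)"
    "\<And>s a. a < w s \<Longrightarrow> V s a \<in> carrier_mat (k s) (k s)"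
    "\<And>s. ons (sq (k s)) (\<lambda>a. ($$) (V s a)) {..<w s}"
    "\<And>s a i. a < w s \<Longrightarrow> fnorm (k s) (A s i * V s a - V s a * A s i) \<le> 1 / real (Suc s)"
    "\<And>s. \<gamma> * (real (k s))\<^sup>2 < real (w s)" by metis
  note main = large_families_contradict_orthonormality[OF P sa gen uniq \<tau> \<gamma> f]
  obtain m :: nat where m: "1 / \<gamma> < real m" using reals_Archimedean2 by blast
  obtain a :: "nat \<Rightarrow> 'a" where a: "\<forall>i<m. \<forall>j<m. \<tau> (cstar (a i) * a j) = (if i = j then 1 else 0)"
    using ex_trace_orthonormal[OF \<tau> main(2) simple inf] by blast
  have "\<tau> (a j * cstar (a j)) = 1" if "j < m" for j
    using a that \<tau> by (metis tracial_state_def)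
  then have "(\<Sum>j<m. \<tau> (a j * cstar (a j))) = of_nat m" by simp
  moreover have "(\<Sum>i<m. \<Sum>j<m. (cmod (\<tau> (cstar (a j) * a i)))\<^sup>2) = (\<Sum>i<m. \<Sum>j<m. if j = i then 1 else 0)"
    using a by (intro sum.cong refl) auto
  then have "(\<Sum>i<m. \<Sum>j<m. (cmod (\<tau> (cstar (a j) * a i)))\<^sup>2) = real m" by simp
  ultimately have "\<gamma> * (real m)\<^sup>2 \<le> real m" using main(1)[where m = m and a = a] by simp
  moreover have "0 < 1 / \<gamma>" using \<gamma> by simp
  then have "0 < real m" using m by linarith
  ultimately have "\<gamma> * real m \<le> 1" by (simp add: power2_eq_square)
  then show False using m \<gamma> by (simp add: field_simps)
qed

section \<open>Covering numbers of microstates\<close>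

text \<open>The coefficients of the linear map sending \<open>V\<close> to the entries \<open>(a, b)\<close> of all commutators \<open>A l * V - V * A l\<close>.\<close>

definition comm_coeff :: "nat \<Rightarrow> ('n \<Rightarrow> complex mat) \<Rightarrow> ('n \<times> nat \<times> nat) \<Rightarrow> (nat \<times> nat) \<Rightarrow> complex" where
  "comm_coeff k A = (\<lambda>(l, a, b) (c, d). (if d = b then A l $$ (a, c) else 0) - (if c = a then A l $$ (d, b) else 0))"

lemma cnrm_comm_coeff:
  fixes A :: "'n::finite \<Rightarrow> complex mat"
  assumes A: "\<And>i. A i \<in> carrier_mat k k" and V: "V \<in> carrier_mat k k" and f: "\<And>p. p \<in> sq k \<Longrightarrow> f p = V $$ p"
  shows "(cnrm (UNIV \<times> sq k) (capply (sq k) (comm_coeff k A) f))\<^sup>2 = (\<Sum>l\<in>UNIV. (fnorm k (A l * V - V * A l))\<^sup>2)"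
proof -
  have AV: "A l * V \<in> carrier_mat k k" "V * A l \<in> carrier_mat k k" for l using A[of l] V by (auto intro!: mult_carrier_mat)
  have val: "capply (sq k) (comm_coeff k A) f (l, p) = (A l * V - V * A l) $$ p" if pq: "p \<in> sq k" for l p
  proof -
    obtain a b where p: "p = (a, b)" "a < k" "b < k" using pq by (auto simp: sq_def)
    have "capply (sq k) (comm_coeff k A) f (l, p)
       = (\<Sum>c<k. \<Sum>d<k. (if d = b then A l $$ (a, c) * V $$ (c, d) else 0) - (if c = a then A l $$ (d, b) * V $$ (c, d) else 0))"
      unfolding capply_def sum_sq p comm_coeff_def
      by (intro sum.cong refl) (auto simp: f sq_def left_diff_distrib)
    also have "\<dots> = (\<Sum>c<k. \<Sum>d<k. (if d = b then A l $$ (a, c) * V $$ (c, d) else 0))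
       - (\<Sum>d<k. \<Sum>c<k. (if c = a then A l $$ (d, b) * V $$ (c, d) else 0))"
      unfolding sum_subtractf by (subst (2) sum.swap) simp
    also have "\<dots> = (\<Sum>c<k. A l $$ (a, c) * V $$ (c, b)) - (\<Sum>d<k. V $$ (a, d) * A l $$ (d, b))"
      using p by (simp add: mult.commute)
    also have "\<dots> = (A l * V - V * A l) $$ p"
      unfolding index_diff_sq[OF AV that] unfolding p(1) mat_mult_index[OF A V p(2,3)] mat_mult_index[OF V A p(2,3)] ..
    finally show ?thesis .
  qed
  have "(cnrm (UNIV \<times> sq k) (capply (sq k) (comm_coeff k A) f))\<^sup>2
     = (\<Sum>l\<in>UNIV. \<Sum>p\<in>sq k. (cmod (capply (sq k) (comm_coeff k A) f (l, p)))\<^sup>2)"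
    unfolding cnrm_sq by (simp add: sum.cartesian_product)
  also have "\<dots> = (\<Sum>l\<in>UNIV. (fnorm k (A l * V - V * A l))\<^sup>2)"
    unfolding cnrm_sq by (intro sum.cong refl) (simp add: val)
  finally show ?thesis .
qed

lemma opnorm_le_tuple_opnorm: "opnorm (A i) \<le> tuple_opnorm (A :: 'n::finite \<Rightarrow> complex mat)"
  unfolding tuple_opnorm_def by (rule Max_ge) auto

lemma frame_unitary:
  assumes "length us = k" "ons {..<k} (\<lambda>a. us ! a) {..<k}"
  shows "unitary_mat k (mat k k (\<lambda>(i, j). (us ! j) i))"
  unfolding unitary_mat_def
proof
  let ?U = "mat k k (\<lambda>(i, j). (us ! j) i) :: complex mat"
  show U: "?U \<in> carrier_mat k k" by simp
  show "mat_adjoint ?U * ?U = 1\<^sub>m k"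
  proof (rule eq_matI)
    fix i j assume "i < dim_row (1\<^sub>m k :: complex mat)" "j < dim_col (1\<^sub>m k :: complex mat)"
    then have ij: "i < k" "j < k" by auto
    have "(mat_adjoint ?U * ?U) $$ (i, j) = (\<Sum>l<k. mat_adjoint ?U $$ (i, l) * ?U $$ (l, j))"
      by (rule mat_mult_index[OF mat_adjoint_carrier[OF U] U ij])
    also have "\<dots> = cip {..<k} (us ! i) (us ! j)"
      unfolding cip_def using ij by (intro sum.cong refl) (simp add: mat_adjoint_index)
    also have "\<dots> = (if i = j then 1 else 0)" using assms(2) ij by (simp add: ons_def)
    finally show "(mat_adjoint ?U * ?U) $$ (i, j) = 1\<^sub>m k $$ (i, j)" using ij by simp
  qed auto
qed

text \<open>After normalisation the matrices \<open>U0\<^sup>* U\<close> are unit vectors that nearly commute with \<open>A\<close>, so their differences are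
  within \<open>\<sigma> / 2\<close> of the low-dimensional space given by \<open>spectral_subspace\<close>. Their coordinates in that space stay \<open>\<sigma> / 2\<close>-separated,
  and \<open>separated_card_le\<close> counts them. The value of \<open>\<sigma>\<close> makes the errors of both members of a difference add up to
  \<open>\<theta> * \<sigma> / 2\<close>.\<close>

lemma fibre_card_le:
  fixes A :: "'n::finite \<Rightarrow> complex mat" and F :: "complex mat set"
  assumes A: "\<And>i. A i \<in> carrier_mat k k" and k: "0 < k" and \<theta>: "0 < \<theta>"
    and small: "\<And>(w :: nat) V. (\<And>a. a < w \<Longrightarrow> V a \<in> carrier_mat k k) \<Longrightarrow> ons (sq k) (\<lambda>a. ($$) (V a)) {..<w} \<Longrightarrow>
       (\<And>a i. a < w \<Longrightarrow> fnorm k (A i * V a - V a * A i) \<le> \<theta>) \<Longrightarrow> real w \<le> L"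
    and F: "\<And>U. U \<in> F \<Longrightarrow> unitary_mat k U"
    and near: "\<And>U U' i. U \<in> F \<Longrightarrow> U' \<in> F \<Longrightarrow> fnorm k (U * A i * mat_adjoint U - U' * A i * mat_adjoint U') \<le> 2 * sqrt k * \<delta>"
    and \<sigma>: "\<sigma> = 8 * sqrt (real CARD('n)) * \<delta> / \<theta>" "0 < \<sigma>" "\<sigma> \<le> 1"
    and sep: "\<And>U U'. U \<in> F \<Longrightarrow> U' \<in> F \<Longrightarrow> U \<noteq> U' \<Longrightarrow> \<sigma> * sqrt k \<le> fnorm k (U - U')"
  shows "finite F \<and> real (card F) \<le> (8 / \<sigma>) powr (2 * L)"
proof (cases "F = {}")
  case True
  then show ?thesis by simp
next
  case False
  then obtain U0 where U0: "U0 \<in> F" by blast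
  let ?I = "sq k" and ?Q = "(UNIV :: 'n set) \<times> sq k" and ?m = "comm_coeff k A"
  obtain w and e :: "nat \<Rightarrow> nat \<times> nat \<Rightarrow> complex" where e: "ons ?I e {..<w}" "real w \<le> L"
    "\<And>v. \<theta> * cnrm ?I (\<lambda>i. v i - cproj ?I e {..<w} v i) \<le> cnrm ?Q (capply ?I ?m v)"
  proof (rule spectral_subspace[of ?I ?Q \<theta> ?m L])
    fix w :: nat and e :: "nat \<Rightarrow> nat \<times> nat \<Rightarrow> complex"
    assume o: "ons ?I e {..<w}" and s: "\<And>b. b < w \<Longrightarrow> cnrm ?Q (capply ?I ?m (e b)) \<le> \<theta>"
    define V where "V b = mat k k (e b)" for b
    have V: "V b \<in> carrier_mat k k" for b by (simp add: V_def)
    have Ve: "e b p = V b $$ p" if "p \<in> sq k" for b p using that by (auto simp: V_def sq_def)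
    show "real w \<le> L"
    proof (rule small[of w V])
      have "cip ?I (($$) (V a)) (($$) (V b)) = cip ?I (e a) (e b)" for a b
        by (rule cip_cong) (simp_all add: Ve)
      then show "ons ?I (\<lambda>a. ($$) (V a)) {..<w}" using o by (simp add: ons_def)
      fix a i assume "a < w"
      have "(fnorm k (A i * V a - V a * A i))\<^sup>2 \<le> (\<Sum>l\<in>UNIV. (fnorm k (A l * V a - V a * A l))\<^sup>2)"
        by (rule member_le_sum) auto
      also have "\<dots> = (cnrm ?Q (capply ?I ?m (e a)))\<^sup>2" by (rule cnrm_comm_coeff[OF A V Ve, symmetric])
      finally have "fnorm k (A i * V a - V a * A i) \<le> cnrm ?Q (capply ?I ?m (e a))" by (rule power2_le_imp_le) simp
      then show "fnorm k (A i * V a - V a * A i) \<le> \<theta>" using s[OF \<open>a < w\<close>] by simp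
    qed (rule V)
  qed (use \<theta> in auto)
  have U0u: "unitary_mat k U0" "unitary_mat k (mat_adjoint U0)" using F[OF U0] unitary_adjoint by auto
  have U0c: "U0 \<in> carrier_mat k k" "mat_adjoint U0 \<in> carrier_mat k k" using U0u unitary_carrier by auto
  note assoc = assoc_mult_mat[of _ k k _ k _ k]
  \<comment> \<open>Dividing by \<open>sqrt k\<close> gives unit vectors for the Frobenius norm.\<close>
  define f where "f U = (\<lambda>p. of_real (1 / sqrt k) * (mat_adjoint U0 * U) $$ p)" for U
  have Uc: "U \<in> carrier_mat k k" "mat_adjoint U0 * U \<in> carrier_mat k k" if "U \<in> F" for U
    using unitary_carrier[OF F[OF that]] U0c by auto
  have f1: "cnrm ?I (f U) = 1" if "U \<in> F" for U
  proof -
    have "fnorm k U = sqrt k" using fnorm_unitary_left[OF F[OF that] one_carrier_mat] Uc[OF that] fnorm_one[of k] by simp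
    then have "fnorm k (mat_adjoint U0 * U) = sqrt k" using fnorm_unitary_left[OF U0u(2) Uc(1)[OF that]] by simp
    then show ?thesis unfolding f_def cnrm_scale using k by (simp add: norm_divide)
  qed
  have fsep: "\<sigma> \<le> cnrm ?I (\<lambda>p. f U p - f U' p)" if "U \<in> F" "U' \<in> F" "U \<noteq> U'" for U U'
  proof -
    have "(\<lambda>p. f U p - f U' p) = (\<lambda>p. of_real (1 / sqrt k) * ((mat_adjoint U0 * U) $$ p - (mat_adjoint U0 * U') $$ p))"
      unfolding f_def by (simp only: right_diff_distrib)
    then have "cnrm ?I (\<lambda>p. f U p - f U' p) = 1 / sqrt k * fnorm k (mat_adjoint U0 * U - mat_adjoint U0 * U')"
      unfolding fnorm_diff[OF Uc(2)[OF that(1)] Uc(2)[OF that(2)]]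
      by (simp only: cnrm_scale) (simp add: norm_divide)
    also have "mat_adjoint U0 * U - mat_adjoint U0 * U' = mat_adjoint U0 * (U - U')"
      using U0c Uc that by (simp add: mult_minus_distrib_mat[of _ k k _ k])
    also have "fnorm k (mat_adjoint U0 * (U - U')) = fnorm k (U - U')"
      using Uc that by (intro fnorm_unitary_left U0u(2)) (simp add: minus_carrier_mat)
    finally have "\<sigma> * sqrt k \<le> cnrm ?I (\<lambda>p. f U p - f U' p) * sqrt k" using sep[OF that] k by simp
    then show ?thesis using k by (simp add: mult_le_cancel_right)
  qed
  have comm: "cnrm ?Q (capply ?I ?m (f U)) \<le> 2 * sqrt (real CARD('n)) * \<delta>" if "U \<in> F" for U
  proof -
    let ?V = "mat_adjoint U0 * U"
    have aU: "mat_adjoint U \<in> carrier_mat k k" "mat_adjoint U * U = 1\<^sub>m k"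
      using F[OF that] by (auto simp: unitary_mat_def mat_adjoint_carrier)
    have "fnorm k (A l * ?V - ?V * A l) \<le> 2 * sqrt k * \<delta>" for l
    proof -
      have c1: "U0 * A l * mat_adjoint U0 \<in> carrier_mat k k" "U * A l * mat_adjoint U \<in> carrier_mat k k"
        by (rule conj_carrier[OF U0u(1) A], rule conj_carrier[OF F[OF that] A])
      let ?D = "U0 * A l * mat_adjoint U0 - U * A l * mat_adjoint U"
      have D: "?D \<in> carrier_mat k k" using c1 by (simp add: minus_carrier_mat)
      have e1: "mat_adjoint U0 * (U0 * A l * mat_adjoint U0) * U = A l * ?V"
      proof -
        have "mat_adjoint U0 * (U0 * A l * mat_adjoint U0) * U = (mat_adjoint U0 * U0) * (A l * ?V)"
          using U0c A[of l] Uc(1)[OF that] by (simp add: assoc)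
        also have "\<dots> = A l * ?V" using U0u(1) A[of l] Uc(2)[OF that] by (simp add: unitary_mat_def)
        finally show ?thesis .
      qed
      have e2: "mat_adjoint U0 * (U * A l * mat_adjoint U) * U = ?V * A l"
      proof -
        have "mat_adjoint U0 * (U * A l * mat_adjoint U) * U = ?V * (A l * (mat_adjoint U * U))"
          using U0c A[of l] Uc(1)[OF that] aU(1) by (simp add: assoc)
        also have "\<dots> = ?V * A l" unfolding aU(2) using A[of l] by simp
        finally show ?thesis .
      qed
      have s1: "A l * ?V - ?V * A l = mat_adjoint U0 * ?D * U"
        unfolding e1[symmetric] e2[symmetric] mult_minus_distrib_mat[OF U0c(2) c1]
        by (rule minus_mult_distrib_mat[symmetric, of _ k k _ _ k]) (use U0c c1 Uc(1)[OF that] in auto)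
      have s2: "fnorm k (mat_adjoint U0 * ?D * U) = fnorm k (mat_adjoint U0 * ?D)"
        by (rule fnorm_unitary_right[OF F[OF that] mult_carrier_mat[OF U0c(2) D]])
      have s3: "fnorm k (mat_adjoint U0 * ?D) = fnorm k ?D" by (rule fnorm_unitary_left[OF U0u(2) D])
      show ?thesis unfolding s1 s2 s3 by (rule near[OF U0 that])
    qed
    then have "(\<Sum>l\<in>(UNIV::'n set). (fnorm k (A l * ?V - ?V * A l))\<^sup>2) \<le> (\<Sum>l\<in>(UNIV::'n set). (2 * sqrt k * \<delta>)\<^sup>2)"
      by (intro sum_mono power_mono) auto
    also have "\<dots> = (2 * sqrt (real CARD('n)) * \<delta> * sqrt k)\<^sup>2" by (simp add: power_mult_distrib)
    finally have sqle: "(cnrm ?Q (capply ?I ?m (($$) ?V)))\<^sup>2 \<le> (2 * sqrt (real CARD('n)) * \<delta> * sqrt k)\<^sup>2"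
      using cnrm_comm_coeff[where A = A and f = "($$) ?V", OF A Uc(2)[OF that]] by simp
    have "0 \<le> \<delta>"
    proof -
      have "0 < 8 * sqrt (real CARD('n)) * \<delta>" using \<sigma>(1,2) \<theta> by (simp add: zero_less_divide_iff)
      then show ?thesis by (simp add: zero_less_mult_iff)
    qed
    then have "cnrm ?Q (capply ?I ?m (($$) ?V)) \<le> 2 * sqrt (real CARD('n)) * \<delta> * sqrt k"
      by (intro power2_le_imp_le[OF sqle]) simp
    then have "1 / sqrt k * cnrm ?Q (capply ?I ?m (($$) ?V)) \<le> 1 / sqrt k * (2 * sqrt (real CARD('n)) * \<delta> * sqrt k)"
      by (rule mult_left_mono) simp
    also have "\<dots> = 2 * sqrt (real CARD('n)) * \<delta>" using k by simp
    also have "1 / sqrt k = cmod (of_real (1 / sqrt k))" by (simp add: norm_divide)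
    finally show ?thesis unfolding f_def capply_scale cnrm_scale .
  qed
  define g where "g U = (\<lambda>a. cip ?I (e a) (f U))" for U
  have g1: "cnrm {..<w} (g U) \<le> 1" if "U \<in> F" for U
  proof -
    have "(cnrm {..<w} (g U))\<^sup>2 \<le> 1\<^sup>2"
      using bessel[OF finite_lessThan e(1), of "f U"] f1[OF that] by (simp add: g_def cnrm_sq)
    then show ?thesis by (rule power2_le_imp_le) simp
  qed
  have gsep: "\<sigma> / 2 \<le> cnrm {..<w} (\<lambda>a. g U a - g U' a)" if "U \<in> F" "U' \<in> F" "U \<noteq> U'" for U U'
  proof -
    define v where "v = (\<lambda>p. f U p - f U' p)"
    have gv: "(\<lambda>a. g U a - g U' a) = (\<lambda>a. cip ?I (e a) v)" by (auto simp: g_def v_def cip_diff_right)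
    have "capply ?I ?m v = (\<lambda>q. capply ?I ?m (f U) q - capply ?I ?m (f U') q)"
      by (auto simp: v_def capply_def right_diff_distrib sum_subtractf)
    then have "cnrm ?Q (capply ?I ?m v) \<le> cnrm ?Q (capply ?I ?m (f U)) + cnrm ?Q (capply ?I ?m (f U'))"
      by (simp only: cnrm_diff_le)
    also have "\<dots> \<le> 2 * sqrt (real CARD('n)) * \<delta> + 2 * sqrt (real CARD('n)) * \<delta>"
      by (rule add_mono[OF comm[OF that(1)] comm[OF that(2)]])
    also have "\<dots> = \<theta> * (\<sigma> / 2)" using \<theta> by (simp add: \<sigma>(1))
    finally have "\<theta> * cnrm ?I (\<lambda>i. v i - cproj ?I e {..<w} v i) \<le> \<theta> * (\<sigma> / 2)" using e(3)[of v] by simp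
    then have r: "cnrm ?I (\<lambda>i. v i - cproj ?I e {..<w} v i) \<le> \<sigma> / 2" using \<theta> by simp
    have "\<sigma>\<^sup>2 \<le> (cnrm ?I v)\<^sup>2" using fsep[OF that] \<sigma>(2) by (intro power_mono) (auto simp: v_def)
    also have "\<dots> = (cnrm {..<w} (\<lambda>a. g U a - g U' a))\<^sup>2 + (cnrm ?I (\<lambda>i. v i - cproj ?I e {..<w} v i))\<^sup>2"
      using cnrm_pythagoras[OF finite_lessThan e(1), of v] unfolding gv by (simp add: cnrm_sq)
    also have "\<dots> \<le> (cnrm {..<w} (\<lambda>a. g U a - g U' a))\<^sup>2 + (\<sigma> / 2)\<^sup>2"
      using r by (intro add_left_mono power_mono) auto
    finally have up: "\<sigma>\<^sup>2 \<le> (cnrm {..<w} (\<lambda>a. g U a - g U' a))\<^sup>2 + (\<sigma> / 2)\<^sup>2" .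
    have "(\<sigma> / 2)\<^sup>2 = \<sigma>\<^sup>2 / 4" by (simp add: power_divide)
    then have "(\<sigma> / 2)\<^sup>2 \<le> (cnrm {..<w} (\<lambda>a. g U a - g U' a))\<^sup>2"
      using up zero_le_power2[of \<sigma>] by linarith
    then show ?thesis by (rule power2_le_imp_le) simp
  qed
  have inj: "inj_on g F"
  proof (rule inj_onI, rule ccontr)
    fix U U' assume "U \<in> F" "U' \<in> F" "g U = g U'" "U \<noteq> U'"
    then show False using gsep[of U U'] \<sigma>(2) by simp
  qed
  have "finite (g ` F) \<and> real (card (g ` F)) \<le> (4 / (\<sigma> / 2)) ^ (2 * card {..<w})"
  proof (rule separated_card_le)
    show "separated {..<w} (\<sigma> / 2) (g ` F)" unfolding separated_def using gsep by blast
  qed (use \<sigma>(2,3) g1 in auto)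
  then have fin: "finite F" and cF: "real (card F) \<le> (8 / \<sigma>) ^ (2 * w)"
    using inj by (auto simp: finite_image_iff card_image)
  note cF
  also have "(8 / \<sigma>) ^ (2 * w) = (8 / \<sigma>) powr (real (2 * w))" using \<sigma>(2) by (subst powr_realpow) auto
  also have "\<dots> \<le> (8 / \<sigma>) powr (2 * L)" using e(2) \<sigma>(2,3) by (intro powr_mono) auto
  finally show ?thesis using fin by blast
qed

text \<open>Sort the separated unitaries by the centre of a ball containing the conjugate of \<open>A\<close>. The squared
  distances of their columns sum to at least \<open>\<gamma> * k * (s / 2)\<^sup>2\<close>, which is \<open>(\<sigma> * sqrt k)\<^sup>2\<close>.\<close>

lemma card_cover_ge:
  fixes A :: "'n::finite \<Rightarrow> complex mat" and x :: "'n \<Rightarrow> 'a::unital_cstar_algebra"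
  assumes A: "A \<in> Gamma_top P R x k \<epsilon> r" and k: "0 < k" and \<theta>: "0 < \<theta>" and \<gamma>: "0 < \<gamma>" "\<gamma> \<le> 1" and \<delta>: "0 < \<delta>"
    and small: "\<And>(w :: nat) V. (\<And>a. a < w \<Longrightarrow> V a \<in> carrier_mat k k) \<Longrightarrow> ons (sq k) (\<lambda>a. ($$) (V a)) {..<w} \<Longrightarrow>
       (\<And>a i. a < w \<Longrightarrow> fnorm k (A i * V a - V a * A i) \<le> \<theta>) \<Longrightarrow> real w \<le> \<gamma> * (real k)\<^sup>2"
    and \<sigma>: "\<sigma> = 8 * sqrt (real CARD('n)) * \<delta> / \<theta>" and s: "s = 2 * \<sigma> / sqrt \<gamma>" "s \<le> 1/4"
    and C: "finite C" "C \<subseteq> Gamma_top P R x k \<epsilon> r" "covers C \<delta> (Gamma_top P R x k \<epsilon> r)"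
  shows "(1 / (576 * s)) ^ (k * k) \<le> real (card C) * (8 / \<sigma>) powr (2 * \<gamma> * (real k)\<^sup>2) * (2 ^ k * (4 / s) powr (2 * \<gamma> * (real k)\<^sup>2))"
proof -
  let ?G = "Gamma_top P R x k \<epsilon> r"
  have Ac: "A i \<in> carrier_mat k k" for i using A by (auto simp: Gamma_top_def)
  have "0 < real CARD('n)" by simp
  then have \<sigma>0: "0 < \<sigma>" using \<delta> \<theta> by (simp add: \<sigma>)
  then have s0: "0 < s" using \<gamma> by (simp add: s(1))
  have "s * sqrt \<gamma> = 2 * \<sigma>" using \<gamma> by (simp add: s(1))
  moreover have "s * sqrt \<gamma> \<le> 1 * 1" using s0 s(2) \<gamma> by (intro mult_mono) auto
  ultimately have \<sigma>1: "\<sigma> \<le> 1" and \<sigma>s: "\<sigma> = s * sqrt \<gamma> / 2" using \<sigma>0 by auto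
  obtain M :: "(nat \<Rightarrow> complex) list set" where M: "finite M" "\<And>us. us \<in> M \<Longrightarrow> length us = k \<and> ons {..<k} (\<lambda>a. us ! a) {..<k}"
    "\<And>us vs. us \<in> M \<Longrightarrow> vs \<in> M \<Longrightarrow> us \<noteq> vs \<Longrightarrow> \<gamma> * k * (s / 2)\<^sup>2 \<le> (\<Sum>i<k. (cnrm {..<k} (\<lambda>a. (us ! i) a - (vs ! i) a))\<^sup>2)"
    "(1 / (576 * s)) ^ (k * k) \<le> real (card M) * (2 ^ k * (4 / s) powr (2 * \<gamma> * k\<^sup>2))"
    using many_separated_frames[of "{..<k}" k s \<gamma>] k s0 s(2) \<gamma>(1) by auto
  define U where "U us = mat k k (\<lambda>(i, j). (us ! j) i)" for us :: "(nat \<Rightarrow> complex) list"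
  have Uu: "unitary_mat k (U us)" if "us \<in> M" for us
    unfolding U_def using M(2)[OF that] by (intro frame_unitary) auto
  have Uc: "U us \<in> carrier_mat k k" for us by (simp add: U_def)
  have Usep: "\<sigma> * sqrt k \<le> fnorm k (U us - U vs)" if "us \<in> M" "vs \<in> M" "us \<noteq> vs" for us vs
  proof -
    have "(\<sigma> * sqrt k)\<^sup>2 = \<gamma> * k * (s / 2)\<^sup>2" using \<gamma> by (simp add: \<sigma>s power_mult_distrib power_divide)
    also have "\<dots> \<le> (\<Sum>i<k. (cnrm {..<k} (\<lambda>a. (us ! i) a - (vs ! i) a))\<^sup>2)" by (rule M(3)[OF that])
    also have "\<dots> = (\<Sum>i<k. \<Sum>a<k. (cmod (U us $$ (a, i) - U vs $$ (a, i)))\<^sup>2)"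
      unfolding cnrm_sq by (intro sum.cong refl) (simp add: U_def)
    also have "\<dots> = (fnorm k (U us - U vs))\<^sup>2"
      unfolding fnorm_diff[OF Uc Uc] cnrm_sq sum_sq by (rule sum.swap)
    finally show ?thesis by (rule power2_le_imp_le) simp
  qed
  have Uinj: "inj_on U M"
  proof (rule inj_onI, rule ccontr)
    fix us vs assume h: "us \<in> M" "vs \<in> M" "U us = U vs" "us \<noteq> vs"
    have "fnorm k (U us - U vs) = 0" unfolding fnorm_diff[OF Uc Uc] using h by simp
    then show False using Usep[OF h(1,2,4)] \<sigma>0 k by (simp add: mult_le_0_iff)
  qed
  define B where "B us = (\<lambda>i. U us * A i * mat_adjoint (U us))" for us
  have BG: "B us \<in> ?G" if "us \<in> M" for us unfolding B_def by (rule Gamma_top_conj[OF Uu[OF that] A])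
  have "\<forall>us\<in>M. \<exists>c\<in>C. tuple_opnorm (\<lambda>i. B us i - c i) < \<delta>" using C(3) BG by (auto simp: covers_def)
  then obtain c where c: "\<And>us. us \<in> M \<Longrightarrow> c us \<in> C \<and> tuple_opnorm (\<lambda>i. B us i - c us i) < \<delta>" by metis
  have Bc: "fnorm k (B us i - c us i) \<le> sqrt k * \<delta>" if "us \<in> M" for us i
  proof -
    have car: "B us i \<in> carrier_mat k k" "c us i \<in> carrier_mat k k"
      using BG[OF that] c[OF that] C(2) by (auto simp: Gamma_top_def)
    then have "B us i - c us i \<in> carrier_mat k k" by (simp add: minus_carrier_mat)
    then have "fnorm k (B us i - c us i) \<le> sqrt k * opnorm (B us i - c us i)" by (rule fnorm_le_opnorm)
    also have "\<dots> \<le> sqrt k * \<delta>"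
      using opnorm_le_tuple_opnorm[of "\<lambda>i. B us i - c us i" i] c[OF that] by (intro mult_left_mono) auto
    finally show ?thesis .
  qed
  define Fb where "Fb d = {us\<in>M. c us = d}" for d
  have fib: "real (card (Fb d)) \<le> (8 / \<sigma>) powr (2 * \<gamma> * (real k)\<^sup>2)" if "d \<in> C" for d
  proof -
    have dc: "d i \<in> carrier_mat k k" for i using that C(2) by (auto simp: Gamma_top_def)
    have "finite (U ` Fb d) \<and> real (card (U ` Fb d)) \<le> (8 / \<sigma>) powr (2 * (\<gamma> * (real k)\<^sup>2))"
    proof (rule fibre_card_le[OF Ac k \<theta> small])
      fix X Y i assume "X \<in> U ` Fb d" "Y \<in> U ` Fb d"
      then obtain us vs where uv: "us \<in> M" "c us = d" "X = U us" "vs \<in> M" "c vs = d" "Y = U vs" by (auto simp: Fb_def)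
      have car: "B us i \<in> carrier_mat k k" "B vs i \<in> carrier_mat k k"
        using BG uv by (auto simp: Gamma_top_def)
      have "fnorm k (B us i - B vs i) \<le> fnorm k (B us i - d i) + fnorm k (d i - B vs i)"
        by (rule fnorm_triangle_diff[OF car(1) dc car(2)])
      also have "\<dots> \<le> sqrt k * \<delta> + sqrt k * \<delta>"
      proof (rule add_mono)
        show "fnorm k (B us i - d i) \<le> sqrt k * \<delta>" using Bc[OF uv(1), of i] uv(2) by simp
        show "fnorm k (d i - B vs i) \<le> sqrt k * \<delta>"
          using Bc[OF uv(4), of i] uv(5) fnorm_minus_commute[OF dc car(2), of i] by simp
      qed
      finally show "fnorm k (X * A i * mat_adjoint X - Y * A i * mat_adjoint Y) \<le> 2 * sqrt k * \<delta>"
        by (simp add: B_def uv(3,6) mult_ac)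
    next
      fix X Y assume "X \<in> U ` Fb d" "Y \<in> U ` Fb d" "X \<noteq> Y"
      then show "\<sigma> * sqrt k \<le> fnorm k (X - Y)" using Usep by (auto simp: Fb_def)
    qed (use Uu \<sigma> \<sigma>0 \<sigma>1 in \<open>auto simp: Fb_def\<close>)
    moreover have "inj_on U (Fb d)" by (rule inj_on_subset[OF Uinj]) (auto simp: Fb_def)
    ultimately show ?thesis by (simp add: card_image mult.assoc)
  qed
  have "M \<subseteq> (\<Union>d\<in>C. Fb d)" using c by (auto simp: Fb_def)
  then have "card M \<le> card (\<Union>d\<in>C. Fb d)" using C(1) M(1) by (intro card_mono) (auto simp: Fb_def)
  also have "\<dots> \<le> (\<Sum>d\<in>C. card (Fb d))" by (rule card_UN_le[OF C(1)])
  finally have "real (card M) \<le> real (\<Sum>d\<in>C. card (Fb d))" by (simp only: of_nat_le_iff)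
  also have "\<dots> = (\<Sum>d\<in>C. real (card (Fb d)))" by (rule of_nat_sum)
  also have "\<dots> \<le> (\<Sum>d\<in>C. (8 / \<sigma>) powr (2 * \<gamma> * (real k)\<^sup>2))" by (intro sum_mono fib)
  finally have "real (card M) \<le> real (card C) * (8 / \<sigma>) powr (2 * \<gamma> * (real k)\<^sup>2)" by simp
  then have "real (card M) * (2 ^ k * (4 / s) powr (2 * \<gamma> * (real k)\<^sup>2))
     \<le> real (card C) * (8 / \<sigma>) powr (2 * \<gamma> * (real k)\<^sup>2) * (2 ^ k * (4 / s) powr (2 * \<gamma> * (real k)\<^sup>2))"
    by (rule mult_right_mono) simp
  moreover have "(1 / (576 * s)) ^ (k * k) \<le> real (card M) * (2 ^ k * (4 / s) powr (2 * \<gamma> * (real k)\<^sup>2))"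
    using M(4) by (simp only: of_nat_power)
  ultimately show ?thesis by (rule order_trans[rotated])
qed

lemma ln_card_cover_ge:
  fixes N k :: nat and \<gamma> \<sigma> s :: real
  assumes k: "0 < k" and s: "0 < s" and \<sigma>: "0 < \<sigma>"
    and le: "(1 / (576 * s)) ^ (k * k) \<le> real N * (8 / \<sigma>) powr (2 * \<gamma> * (real k)\<^sup>2) * (2 ^ k * (4 / s) powr (2 * \<gamma> * (real k)\<^sup>2))"
  shows "0 < N" and "(real k)\<^sup>2 * (- ln (576 * s) - ln 2 - 2 * \<gamma> * ln (8 / \<sigma>) - 2 * \<gamma> * ln (4 / s)) \<le> ln (real N)"
proof -
  have pos: "0 < (1 / (576 * s)) ^ (k * k)" using s by simp
  show N: "0 < N"
  proof (rule ccontr)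
    assume "\<not> 0 < N"
    then show False using le pos by simp
  qed
  have "ln ((1 / (576 * s)) ^ (k * k)) \<le> ln (real N * (8 / \<sigma>) powr (2 * \<gamma> * (real k)\<^sup>2) * (2 ^ k * (4 / s) powr (2 * \<gamma> * (real k)\<^sup>2)))"
    using le pos by simp
  also have "\<dots> = ln (real N) + 2 * \<gamma> * (real k)\<^sup>2 * ln (8 / \<sigma>) + (real k * ln 2 + 2 * \<gamma> * (real k)\<^sup>2 * ln (4 / s))"
    using N s \<sigma> by (simp add: ln_mult_pos ln_realpow ln_powr)
  also have "ln ((1 / (576 * s)) ^ (k * k)) = (real k)\<^sup>2 * - ln (576 * s)"
    using s by (simp add: ln_realpow ln_div power2_eq_square)
  also have "real k * ln 2 \<le> (real k)\<^sup>2 * ln 2"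
    using k by (intro mult_right_mono) (auto simp: power2_eq_square)
  finally show "(real k)\<^sup>2 * (- ln (576 * s) - ln 2 - 2 * \<gamma> * ln (8 / \<sigma>) - 2 * \<gamma> * ln (4 / s)) \<le> ln (real N)"
    by (simp add: algebra_simps)
qed

lemma log_covering_number_ge:
  assumes "\<And>C. finite C \<Longrightarrow> C \<subseteq> S \<Longrightarrow> covers C \<delta> S \<Longrightarrow> 0 < card C \<and> b \<le> ln (real (card C))"
  shows "ereal b \<le> log_enat (covering_number S \<delta>)"
proof (cases "{C. finite C \<and> C \<subseteq> S \<and> covers C \<delta> S} = {}")
  case True
  then have "covering_number S \<delta> = \<infinity>" unfolding covering_number_def True by (simp add: top_enat_def)
  then show ?thesis by (simp add: log_enat_def)
next
  case False
  then have "covering_number S \<delta> \<in> (\<lambda>C. enat (card C)) ` {C. finite C \<and> C \<subseteq> S \<and> covers C \<delta> S}"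
    unfolding covering_number_def Inf_enat_def by (auto intro: LeastI)
  then obtain C where "finite C" "C \<subseteq> S" "covers C \<delta> S" "covering_number S \<delta> = enat (card C)" by auto
  then show ?thesis using assms[of C] by (auto simp: log_enat_def)
qed

lemma Gamma_top_mono:
  assumes "\<epsilon>' \<le> \<epsilon>" "r \<le> r'"
  shows "Gamma_top P R x k \<epsilon>' r' \<subseteq> Gamma_top P R x k \<epsilon> r"
proof
  fix A assume A: "A \<in> Gamma_top P R x k \<epsilon>' r'"
  have "\<bar>opnorm (ncpoly_eval_mat k (P j) A) - norm (ncpoly_eval (P j) x)\<bar> \<le> \<epsilon>" if "j \<in> {1..r}" for j
  proof -
    have "j \<in> {1..r'}" using that assms by auto
    then have "\<bar>opnorm (ncpoly_eval_mat k (P j) A) - norm (ncpoly_eval (P j) x)\<bar> \<le> \<epsilon>'"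
      using A unfolding Gamma_top_def by blast
    then show ?thesis using assms by linarith
  qed
  then show "A \<in> Gamma_top P R x k \<epsilon> r" using A unfolding Gamma_top_def by blast
qed

text \<open>The tolerance and the number of polynomials in the infimum may be arbitrarily strict; making them stricter still, so
  that \<open>small_almost_commutant\<close> applies, only shrinks the set from which the microstate is taken. The radius, \<open>\<theta>\<close> and hence
  \<open>K\<close> are chosen before \<open>\<delta>\<close>, so \<open>K / ln (1 / \<delta>)\<close> tends to \<open>0\<close>.\<close>

lemma delta_top_ge_nearly_one:
  fixes x :: "'n::finite \<Rightarrow> 'a::unital_cstar_algebra" and P :: "nat \<Rightarrow> 'n ncpoly"
  assumes P: "P ` {1..} = rational_ncpolys"
    and inf: "infinite_dimensional TYPE('a)" and simple: "simple_cstar TYPE('a)"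
    and uniq: "\<exists>!\<tau> :: 'a \<Rightarrow> complex. tracial_state \<tau>"
    and sa: "\<And>i. cstar (x i) = x i" and gen: "generates_cstar (range x)"
    and ap: "approximation_property P x"
    and \<gamma>: "0 < \<gamma>" "\<gamma> \<le> 1"
  shows "ereal (1 - 4 * \<gamma>) \<le> delta_top P x"
proof -
  define R where "R = \<bar>Max (range (\<lambda>i. norm (x i)))\<bar> + 1"
  have R: "Max (range (\<lambda>i. norm (x i))) < R" "0 < R" unfolding R_def by linarith+
  obtain \<epsilon>0 r0 \<theta> where small: "0 < \<epsilon>0" "1 \<le> (r0::nat)" "0 < \<theta>"
    "\<And>k A w V. A \<in> Gamma_top P R x k \<epsilon>0 r0 \<Longrightarrow> (\<And>a. a < w \<Longrightarrow> V a \<in> carrier_mat k k) \<Longrightarrow>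
       ons (sq k) (\<lambda>a. ($$) (V a)) {..<w} \<Longrightarrow> (\<And>a i. a < w \<Longrightarrow> fnorm k (A i * V a - V a * A i) \<le> \<theta>) \<Longrightarrow>
       real w \<le> \<gamma> * (real k)\<^sup>2"
    by (rule small_almost_commutant[OF P inf simple uniq sa gen \<gamma>(1), of R]) blast
  \<comment> \<open>For the covering radius \<open>\<delta>\<close>, \<open>card_cover_ge\<close> is applied with \<open>\<sigma> = b * \<delta>\<close> and \<open>s = a * \<delta>\<close>.\<close>
  define b where "b = 8 * sqrt (real CARD('n)) / \<theta>"
  define a where "a = 2 * b / sqrt \<gamma>"
  have "0 < real CARD('n)" by simp
  then have b0: "0 < b" using small(3) by (simp add: b_def)
  have a0: "0 < a" using b0 \<gamma> by (simp add: a_def)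
  define K where "K = ln (576 * a) + ln 2 + 2 * \<gamma> * ln (8 / b) + 2 * \<gamma> * ln (4 / a)"
  define F where "F \<delta> R \<epsilon> r k = log_enat (covering_number (Gamma_top P R x k \<epsilon> r) \<delta>) / ereal (- ((real k)\<^sup>2 * ln \<delta>))"
    for \<delta> R \<epsilon> r k
  have inner: "ereal (1 - 4 * \<gamma> - K / - ln \<delta>) \<le> limsup (F \<delta> R \<epsilon> r)"
    if \<delta>: "0 < \<delta>" "\<delta> < 1" "a * \<delta> \<le> 1 / 4" and \<epsilon>: "0 < \<epsilon>" and r: "1 \<le> r" for \<delta> \<epsilon> r
  proof -
    have "0 < min \<epsilon> \<epsilon>0" "1 \<le> max r r0" using \<epsilon> small r by auto
    then obtain k :: "nat \<Rightarrow> nat" where k: "strict_mono k" "\<And>s. 1 \<le> k s \<and> Gamma_top P R x (k s) (min \<epsilon> \<epsilon>0) (max r r0) \<noteq> {}"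
      using ap R(1) unfolding approximation_property_def by blast
    have ln\<delta>: "ln \<delta> < 0" using \<delta> by simp
    have "ereal (1 - 4 * \<gamma> - K / - ln \<delta>) \<le> F \<delta> R \<epsilon> r (k s)" for s
    proof -
      have k0: "0 < k s" using k(2)[of s] by simp
      obtain A where A: "A \<in> Gamma_top P R x (k s) (min \<epsilon> \<epsilon>0) (max r r0)" using k(2)[of s] by blast
      have A1: "A \<in> Gamma_top P R x (k s) \<epsilon> r" by (rule subsetD[OF Gamma_top_mono A]) auto
      have A2: "A \<in> Gamma_top P R x (k s) \<epsilon>0 r0" by (rule subsetD[OF Gamma_top_mono A]) auto
      have "ereal ((real (k s))\<^sup>2 * ((1 - 4 * \<gamma>) * - ln \<delta> - K)) \<le> log_enat (covering_number (Gamma_top P R x (k s) \<epsilon> r) \<delta>)"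
      proof (rule log_covering_number_ge)
        fix C assume C: "finite C" "C \<subseteq> Gamma_top P R x (k s) \<epsilon> r" "covers C \<delta> (Gamma_top P R x (k s) \<epsilon> r)"
        have le: "(1 / (576 * (a * \<delta>))) ^ (k s * k s) \<le> real (card C) * (8 / (b * \<delta>)) powr (2 * \<gamma> * (real (k s))\<^sup>2) * (2 ^ k s * (4 / (a * \<delta>)) powr (2 * \<gamma> * (real (k s))\<^sup>2))"
          by (rule card_cover_ge[OF A1 k0 small(3) \<gamma> \<delta>(1) small(4)[OF A2] _ _ \<delta>(3) C]) (simp_all add: a_def b_def)
        have "- ln (576 * (a * \<delta>)) - ln 2 - 2 * \<gamma> * ln (8 / (b * \<delta>)) - 2 * \<gamma> * ln (4 / (a * \<delta>)) = (1 - 4 * \<gamma>) * - ln \<delta> - K"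
          using a0 b0 \<delta> by (simp add: K_def ln_mult_pos ln_div algebra_simps)
        then show "0 < card C \<and> (real (k s))\<^sup>2 * ((1 - 4 * \<gamma>) * - ln \<delta> - K) \<le> ln (real (card C))"
          using ln_card_cover_ge[OF k0 _ _ le] a0 b0 \<delta> by simp
      qed
      moreover have "0 < - ((real (k s))\<^sup>2 * ln \<delta>)" using k0 ln\<delta> by (simp add: mult_less_0_iff)
      ultimately have "ereal ((real (k s))\<^sup>2 * ((1 - 4 * \<gamma>) * - ln \<delta> - K)) / ereal (- ((real (k s))\<^sup>2 * ln \<delta>)) \<le> F \<delta> R \<epsilon> r (k s)"
        unfolding F_def by (intro ereal_divide_right_mono) auto
      moreover have "((real (k s))\<^sup>2 * ((1 - 4 * \<gamma>) * - ln \<delta> - K)) / (- ((real (k s))\<^sup>2 * ln \<delta>)) = 1 - 4 * \<gamma> - K / - ln \<delta>"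
        using k0 ln\<delta> by (simp add: field_simps)
      ultimately show ?thesis using k0 ln\<delta> by simp
    qed
    then have "ereal (1 - 4 * \<gamma> - K / - ln \<delta>) \<le> limsup (F \<delta> R \<epsilon> r \<circ> k)"
      by (intro le_Limsup) (auto intro: always_eventually)
    also have "\<dots> \<le> limsup (F \<delta> R \<epsilon> r)" by (rule limsup_subseq_mono[OF k(1)])
    finally show ?thesis .
  qed
  have outer: "ereal (1 - 4 * \<gamma> - K / - ln \<delta>) \<le> (SUP R\<in>{0::real<..}. INF (\<epsilon>, r)\<in>{0::real<..} \<times> {1::nat..}. limsup (F \<delta> R \<epsilon> r))"
    if "0 < \<delta>" "\<delta> < 1" "a * \<delta> \<le> 1 / 4" for \<delta>
  proof (rule SUP_upper2[of R])
    show "ereal (1 - 4 * \<gamma> - K / - ln \<delta>) \<le> (INF (\<epsilon>, r)\<in>{0::real<..} \<times> {1::nat..}. limsup (F \<delta> R \<epsilon> r))"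
      by (rule INF_greatest) (use inner that in auto)
  qed (use R in simp)
  have ev: "\<forall>\<^sub>F \<delta> in at_right (0::real). 0 < \<delta> \<and> \<delta> < 1 \<and> a * \<delta> \<le> 1 / 4"
    unfolding eventually_at_right_field
    by (rule exI[of _ "min 1 (1 / (4 * a))"]) (use a0 in \<open>auto simp: field_simps\<close>)
  have lim: "((\<lambda>\<delta>. ereal (1 - 4 * \<gamma> - K / - ln \<delta>)) \<longlongrightarrow> ereal (1 - 4 * \<gamma>)) (at_right 0)"
  proof -
    have "filterlim (\<lambda>\<delta>::real. - ln \<delta>) at_top (at_right 0)"
      using ln_at_0 by (simp add: filterlim_uminus_at_bot)
    then have "((\<lambda>\<delta>. K / - ln \<delta>) \<longlongrightarrow> 0) (at_right 0)" by (intro tendsto_divide_0[OF tendsto_const] filterlim_at_top_imp_at_infinity)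
    then have "((\<lambda>\<delta>. 1 - 4 * \<gamma> - K / - ln \<delta>) \<longlongrightarrow> 1 - 4 * \<gamma> - 0) (at_right 0)" by (intro tendsto_intros)
    then show ?thesis by simp
  qed
  have "ereal (1 - 4 * \<gamma>) = Limsup (at_right 0) (\<lambda>\<delta>. ereal (1 - 4 * \<gamma> - K / - ln \<delta>))"
    by (rule lim_imp_Limsup[OF _ lim, symmetric]) simp
  also have "\<dots> \<le> delta_top P x"
    unfolding delta_top_def F_def[symmetric]
    by (rule Limsup_mono) (use ev outer in \<open>auto elim: eventually_mono\<close>)
  finally show ?thesis .
qed

theorem theorem5p2:
  fixes x :: "'n::finite \<Rightarrow> 'a::unital_cstar_algebra"
    and P :: "nat \<Rightarrow> 'n ncpoly"
  assumes "P ` {1..} = rational_ncpolys"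
    and "infinite_dimensional TYPE('a)"
    and "simple_cstar TYPE('a)"
    and "\<exists>!\<tau> :: 'a \<Rightarrow> complex. tracial_state \<tau>"
    and "\<And>i. cstar (x i) = x i"
    and "generates_cstar (range x)"
    and "approximation_property P x"
  shows "delta_top P x \<ge> 1"
proof (rule tendsto_upperbound)
  have "(\<lambda>n. 1 - 4 * (1 / real (Suc n))) \<longlonglongrightarrow> 1 - 4 * 0"
    by (intro tendsto_intros LIMSEQ_Suc lim_1_over_n)
  then show "(\<lambda>n. ereal (1 - 4 * (1 / real (Suc n)))) \<longlonglongrightarrow> 1"
    by (simp add: one_ereal_def)
  have "ereal (1 - 4 * (1 / real (Suc n))) \<le> delta_top P x" for n
    by (rule delta_top_ge_nearly_one[OF assms]) auto
  then show "\<forall>\<^sub>F n in sequentially. ereal (1 - 4 * (1 / real (Suc n))) \<le> delta_top P x" by simp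
qed simp

end
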